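(* Let $N\ge 2$ and $1\le m\le N-1$ be integers, let $P$ be an a.e. positive and a.e. symmetric probability density on $\Lambda^N$, and let $\rho^{(m)}$ be its $m$-variable reduction. Suppose that for a.e. $x_N$ in some subset $B\subset\Lambda$ of positive $dx$ measure there is a constant $\gamma(x_N)>0$ such that $$P(\cdot,x_N)\ge \gamma(x_N)\,\rho^{(N-1)}\quad\text{a.e. on }\Lambda^{N-1}.$$ Let $W$ be an a.e. finite and a.e. symmetric measurable function on $\Lambda^N$. Then $\mathcal V_P=\mathcal V_{\rho^{(m)}}$. If, in addition, $\mathcal V_P\neq\emptyset$ and $(W+\log P)_+\in L^1(\Lambda^N;P\,d^Nx)$, then there is $U\in\mathcal V_P$ (so $U(x_1,\dots,x_N)=\sum_{1\le i_1<\cdots<i_m\le N}u(x_{i_1},\dots,x_{i_m})$ a.e. for some symmetric real-valued measurable $u$ on $\Lambda^m$) such that $\rho^{(m)}_U=\rho^{(m)}$ a.e. on $\Lambda^m$. Moreover, if $U_0,U_1\in\mathcal V_P$, with $U_j(x_1,\dots,x_N)=\sum_{1\le i_1<\cdots<i_m\le N}u_j(x_{i_1},\dots,x_{i_m})$ a.e. where $u_j$ is a symmetric real-valued measurable function on $\Lambda^m$ ($j=0,1$), and $\rho^{(m)}_{U_0}=\rho^{(m)}_{U_1}=\rho^{(m)}$ a.e., then $U_1-U_0$ is a.e. equal to a constant on $\Lambda^N$, and $u_1-u_0$ is a.e. equal to a constant on $\Lambda^m$.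
   Context: $(\Lambda;dx)$ is a complete $\sigma$-finite measure space with non-zero measure $dx$; $d^kx$ denotes the completion of the product measure $dx^{\otimes k}$ on $\Lambda^k$. "A.e." and "measurable" on $\Lambda^k$ refer to $d^kx$. Functions take values in $[-\infty,+\infty]$ unless stated otherwise. $t_+=\max(t,0)$. A function is symmetric if it is invariant under permutations of its variables. A probability density $P$ on $\Lambda^N$ is a measurable function with $\int_{\Lambda^N}P\,d^Nx=1$. For $1\le k\le N$ its $k$-variable reduction is $\rho^{(k)}(x_1,\dots,x_k)=\int_{\Lambda^{N-k}}P(x_1,\dots,x_N)\,dx_{k+1}\cdots dx_N$ (defined a.e. on $\Lambda^k$). For a measurable function $U$ on $\Lambda^N$ with $e^{-U}\in L^1(\Lambda^N;e^{-W}d^Nx)$, put $Z(U)=\int_{\Lambda^N}e^{-W-U}d^Nx$ and $$\rho_U^{(m)}(x_1,\dots,x_m)=\frac{1}{Z(U)}\int_{\Lambda^{N-m}}e^{-W-U}\,dx_{m+1}\cdots dx_N .$$ $\mathcal V_P$ is the set of all functions $V$ such that $V\in L^1(\Lambda^N;P\,d^Nx)$, $e^{-V}\in L^1(\Lambda^N;e^{-W}d^Nx)$, and $V(x_1,\dots,x_N)=\sum_{1\le i_1<\cdots<i_m\le N}v(x_{i_1},\dots,x_{i_m})$ a.e. on $\Lambda^N$ for some symmetric real-valued measurable function $v$ on $\Lambda^m$. $\mathcal V_{\rho^{(m)}}$ is the set of all functions $V$ such that $e^{-V}\in L^1(\Lambda^N;e^{-W}d^Nx)$ and $V(x_1,\dots,x_N)=\sum_{1\le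 i_1<\cdots<i_m\le N}v(x_{i_1},\dots,x_{i_m})$ a.e. on $\Lambda^N$ for some symmetric real-valued measurable function $v$ on $\Lambda^m$ with $v\in L^1(\Lambda^m;\rho^{(m)}d^mx)$. *)

theory Defs
  imports "HOL-Analysis.Analysis" "HOL-Combinatorics.Permutations"
begin

(* The variables are indexed from 0: a point of Lambda^k, Lambda = space M, is a function in
   PiE {..<k} (\<lambda>_. space M), and the last variable of a point of Lambda^N has index N - 1. *)

definition pow_measure :: "'a measure \<Rightarrow> nat set \<Rightarrow> (nat \<Rightarrow> 'a) measure" where
  "pow_measure M I = completion (PiM I (\<lambda>_. M))"

definition exp_ereal :: "ereal \<Rightarrow> ereal" where
  "exp_ereal x = (case x of ereal r \<Rightarrow> ereal (exp r) | PInfty \<Rightarrow> \<infinity> | MInfty \<Rightarrow> 0)"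

(* Negative arguments are mapped to -\<infinity>; the logarithm is only used for a.e. positive functions. *)
definition ln_ereal :: "ereal \<Rightarrow> ereal" where
  "ln_ereal x = (case x of ereal r \<Rightarrow> if r > 0 then ereal (ln r) else -\<infinity>
                 | PInfty \<Rightarrow> \<infinity> | MInfty \<Rightarrow> -\<infinity>)"

definition L1 :: "'b measure \<Rightarrow> ('b \<Rightarrow> ereal) set" where
  "L1 M = {f. f \<in> borel_measurable M \<and> (\<integral>\<^sup>+x. e2ennreal \<bar>f x\<bar> \<partial>M) < \<infinity>}"

definition symmetric_fun :: "'a measure \<Rightarrow> nat \<Rightarrow> ((nat \<Rightarrow> 'a) \<Rightarrow> 'b) \<Rightarrow> bool" where
  "symmetric_fun M k f \<longleftrightarrow>
     (\<forall>p. p permutes {..<k} \<longrightarrow> (\<forall>x\<in>space (pow_measure M {..<k}). f (x \<circ> p) = f x))"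

definition ae_symmetric :: "'a measure \<Rightarrow> nat \<Rightarrow> ((nat \<Rightarrow> 'a) \<Rightarrow> 'b) \<Rightarrow> bool" where
  "ae_symmetric M k f \<longleftrightarrow>
     (\<forall>p. p permutes {..<k} \<longrightarrow> (AE x in pow_measure M {..<k}. f (x \<circ> p) = f x))"

definition prob_density :: "'a measure \<Rightarrow> nat \<Rightarrow> ((nat \<Rightarrow> 'a) \<Rightarrow> ereal) \<Rightarrow> bool" where
  "prob_density M N P \<longleftrightarrow>
     P \<in> borel_measurable (pow_measure M {..<N}) \<and>
     (AE x in pow_measure M {..<N}. P x \<ge> 0) \<and>
     (\<integral>\<^sup>+x. e2ennreal (P x) \<partial>pow_measure M {..<N}) = 1"

(* The sections are measurable, and so the value is the integral, for a.e. x in Lambda^k only;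
   the values on the exceptional null set are irrelevant. *)
definition reduction :: "'a measure \<Rightarrow> nat \<Rightarrow> nat \<Rightarrow> ((nat \<Rightarrow> 'a) \<Rightarrow> ereal) \<Rightarrow> (nat \<Rightarrow> 'a) \<Rightarrow> ennreal" where
  "reduction M N k F x =
     (\<integral>\<^sup>+y. e2ennreal (F (merge {..<k} {k..<N} (x, y))) \<partial>pow_measure M {k..<N})"

definition partition_fun ::
  "'a measure \<Rightarrow> nat \<Rightarrow> ((nat \<Rightarrow> 'a) \<Rightarrow> ereal) \<Rightarrow> ((nat \<Rightarrow> 'a) \<Rightarrow> ereal) \<Rightarrow> ennreal" where
  "partition_fun M N W U =
     (\<integral>\<^sup>+x. e2ennreal (exp_ereal (- W x - U x)) \<partial>pow_measure M {..<N})"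

definition rho_U ::
  "'a measure \<Rightarrow> nat \<Rightarrow> nat \<Rightarrow> ((nat \<Rightarrow> 'a) \<Rightarrow> ereal) \<Rightarrow> ((nat \<Rightarrow> 'a) \<Rightarrow> ereal)
     \<Rightarrow> (nat \<Rightarrow> 'a) \<Rightarrow> ennreal" where
  "rho_U M N m W U x =
     reduction M N m (\<lambda>z. exp_ereal (- W z - U z)) x / partition_fun M N W U"

(* The index sequences i_1 < ... < i_m are the strictly increasing maps {..<m} \<rightarrow> {..<N}. *)
definition body_sum :: "nat \<Rightarrow> nat \<Rightarrow> ((nat \<Rightarrow> 'a) \<Rightarrow> real) \<Rightarrow> (nat \<Rightarrow> 'a) \<Rightarrow> real" where
  "body_sum N m v x =
     (\<Sum>i\<in>{i \<in> {..<m} \<rightarrow>\<^sub>E {..<N}. strict_mono_on {..<m} i}. v (\<lambda>j\<in>{..<m}. x (i j)))"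

definition generates ::
  "'a measure \<Rightarrow> nat \<Rightarrow> nat \<Rightarrow> ((nat \<Rightarrow> 'a) \<Rightarrow> real) \<Rightarrow> ((nat \<Rightarrow> 'a) \<Rightarrow> ereal) \<Rightarrow> bool" where
  "generates M N m v V \<longleftrightarrow>
     v \<in> borel_measurable (pow_measure M {..<m}) \<and> symmetric_fun M m v \<and>
     (AE x in pow_measure M {..<N}. V x = ereal (body_sum N m v x))"

definition exp_integrable ::
  "'a measure \<Rightarrow> nat \<Rightarrow> ((nat \<Rightarrow> 'a) \<Rightarrow> ereal) \<Rightarrow> ((nat \<Rightarrow> 'a) \<Rightarrow> ereal) \<Rightarrow> bool" where
  "exp_integrable M N W V \<longleftrightarrow>
     (\<lambda>x. exp_ereal (- V x))
       \<in> L1 (density (pow_measure M {..<N}) (\<lambda>x. e2ennreal (exp_ereal (- W x))))"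

definition V_P ::
  "'a measure \<Rightarrow> nat \<Rightarrow> nat \<Rightarrow> ((nat \<Rightarrow> 'a) \<Rightarrow> ereal) \<Rightarrow> ((nat \<Rightarrow> 'a) \<Rightarrow> ereal)
     \<Rightarrow> ((nat \<Rightarrow> 'a) \<Rightarrow> ereal) set" where
  "V_P M N m W P =
     {V. V \<in> L1 (density (pow_measure M {..<N}) (\<lambda>x. e2ennreal (P x))) \<and>
         exp_integrable M N W V \<and>
         (\<exists>v. generates M N m v V)}"

definition V_rho ::
  "'a measure \<Rightarrow> nat \<Rightarrow> nat \<Rightarrow> ((nat \<Rightarrow> 'a) \<Rightarrow> ereal) \<Rightarrow> ((nat \<Rightarrow> 'a) \<Rightarrow> ennreal)
     \<Rightarrow> ((nat \<Rightarrow> 'a) \<Rightarrow> ereal) set" where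
  "V_rho M N m W \<rho> =
     {V. exp_integrable M N W V \<and>
         (\<exists>v. generates M N m v V \<and>
              (\<lambda>x. ereal (v x)) \<in> L1 (density (pow_measure M {..<m}) \<rho>))}"

end

theory Submission
  imports Defs
begin

text \<open>
  Write \<open>V = \<Sum> v\<close> for the function on \<open>\<Lambda>\<^sup>N\<close> generated by an \<open>m\<close>-body potential \<open>v\<close>. Three observations
  carry the proof.

  \<^item> \<open>v\<close> can be recovered from \<open>V\<close>: on \<open>N + m\<close> points, the value of \<open>v\<close> at an \<open>m\<close>-subset is a linear
    combination of the values of \<open>V\<close> at the \<open>N\<close>-subsets. Hence any linear property of \<open>V\<close> (being
    a.e. constant, a.e. convergence of a sequence) passes to \<open>v\<close>. For integrability, freeze all but the
    first \<open>m\<close> of the \<open>N + m\<close> points in \<open>B\<close>: by symmetry of \<open>P\<close> and the lower bound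
    on \<open>P(\<cdot>, t)\<close>, integrability against \<open>P\<close> survives replacing any variable by a.e. point of
    \<open>B\<close>, so \<open>V \<in> L\<^sup>1(P)\<close> forces \<open>v \<in> L\<^sup>1(\<rho>\<^sup>(\<^sup>m\<^sup>))\<close>.

  \<^item> A minimizer of \<open>F(V) = \<integral> P V + \<integral> e\<^sup>-\<^sup>W\<^sup>-\<^sup>V\<close> has the required reduction, as the first variation in
    the direction of bounded potentials shows. The midpoint gap of \<open>F\<close> is half the squared Hellinger
    distance of the Gibbs weights, so a minimizing sequence with rapidly decreasing excess converges
    a.e.; the limit is finite and minimizing by Fatou, since \<open>F(V)\<close> minus the constant
    \<open>\<integral> P (1 - W - log P)\<close> is the integral of a nonnegative function.

  \<^item> If the Gibbs densities \<open>Q\<^sub>0\<close>, \<open>Q\<^sub>1\<close> of \<open>U\<^sub>0\<close>, \<open>U\<^sub>1\<close> have the same \<open>m\<close>-variable reduction, then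
    \<open>\<integral> (Q\<^sub>0 - Q\<^sub>1) (log Q\<^sub>0 - log Q\<^sub>1) = \<integral> (Q\<^sub>0 - Q\<^sub>1) (U\<^sub>1 - U\<^sub>0) = 0\<close>, whence \<open>Q\<^sub>0 = Q\<^sub>1\<close>.
\<close>

section \<open>Subset sums and body sums\<close>

lemma sum_subsets_card_insert:
  fixes g :: "'b set \<Rightarrow> real"
  assumes "finite T" "t \<notin> T"
  shows "(\<Sum>K | K \<subseteq> insert t T \<and> card K = Suc k. g K) =
    (\<Sum>K | K \<subseteq> T \<and> card K = Suc k. g K) + (\<Sum>K | K \<subseteq> T \<and> card K = k. g (insert t K))"
proof -
  have fin: "finite {K. K \<subseteq> T \<and> Q K}" for Q
    by (rule finite_subset[of _ "Pow T"]) (use assms in auto)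
  have eq: "{K. K \<subseteq> insert t T \<and> card K = Suc k} =
      {K. K \<subseteq> T \<and> card K = Suc k} \<union> insert t ` {K. K \<subseteq> T \<and> card K = k}" (is "?A = ?B \<union> ?C")
  proof (intro equalityI subsetI)
    fix K assume K: "K \<in> ?A"
    show "K \<in> ?B \<union> ?C"
    proof (cases "t \<in> K")
      case True
      have "finite K" using K assms finite_subset by fastforce
      then have "K - {t} \<subseteq> T \<and> card (K - {t}) = k" "K = insert t (K - {t})"
        using K True by auto
      then show ?thesis by blast
    qed (use K in auto)
  next
    fix K assume "K \<in> ?B \<union> ?C"
    then show "K \<in> ?A"
    proof
      assume "K \<in> ?C"
      then obtain K' where "K' \<subseteq> T" "card K' = k" "K = insert t K'" by auto
      moreover have "finite K'" using \<open>K' \<subseteq> T\<close> assms finite_subset by auto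
      moreover have "t \<notin> K'" using \<open>K' \<subseteq> T\<close> assms by auto
      ultimately show ?thesis by auto
    qed auto
  qed
  have inj: "inj_on (insert t) {K. K \<subseteq> T \<and> card K = k}"
    using assms(2) unfolding inj_on_def by (auto simp: insert_eq_iff subset_iff) 
  have "?B \<inter> ?C = {}" using assms(2) by auto
  then show ?thesis
    unfolding eq using fin by (subst sum.union_disjoint) (auto simp: sum.reindex[OF inj])
qed

text \<open>Replacing one point \<open>t\<close> of an \<open>n\<close>-subset by \<open>t'\<close> changes its sum by a sum over \<open>(k - 1)\<close>-subsets of
  \<open>f (insert t K) - f (insert t' K)\<close>. By induction these differences lie in \<open>L\<close>, so modulo \<open>L\<close> all values
  of \<open>f\<close> agree and each sum is a positive multiple of any of them.\<close>

lemma subset_sum_extract: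
  fixes f :: "'b set \<Rightarrow> 'y \<Rightarrow> real"
  assumes lin: "\<And>a b g h. L g \<Longrightarrow> L h \<Longrightarrow> L (\<lambda>y. a * g y + b * h y)"
    and "finite X" "k \<le> n" "n + k \<le> card X"
    and "\<And>T. T \<subseteq> X \<Longrightarrow> card T = n \<Longrightarrow> L (\<lambda>y. \<Sum>K | K \<subseteq> T \<and> card K = k. f K y)"
    and "K \<subseteq> X" "card K = k"
  shows "L (f K)"
  using assms(2-)
proof (induction k arbitrary: n X f K)
  case 0
  obtain T where T: "T \<subseteq> X" "card T = n"
    using obtain_subset_with_card_n[of n X] 0 by auto
  then have "finite T" using 0 finite_subset by auto
  have "{K. K \<subseteq> T \<and> card K = 0} = {{}}"
    using finite_subset[OF _ \<open>finite T\<close>] by auto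
  moreover have "K = {}"
    using "0.prems" by (metis card_0_eq finite_subset)
  ultimately show ?case
    using 0(4)[OF T] by simp
next
  case (Suc k)
  obtain n' where n': "n = Suc n'" using Suc.prems(2) by (cases n) auto
  obtain T0 where T0: "T0 \<subseteq> X" "card T0 = n"
    using obtain_subset_with_card_n[of n X] Suc.prems by auto
  have fT0: "finite T0" using T0 Suc.prems finite_subset by auto
  have zero: "L (\<lambda>y. 0)"
    using lin[OF Suc.prems(4)[OF T0] Suc.prems(4)[OF T0], of 0 0] by simp
  have Lsum: "L (\<lambda>y. \<Sum>i\<in>I. g i y)" if "finite I" "\<And>i. i \<in> I \<Longrightarrow> L (g i)" for I and g :: "'b set \<Rightarrow> 'y \<Rightarrow> real"
    using that
  proof (induction I rule: finite_induct)
    case (insert i I)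
    then show ?case using lin[of "g i" "\<lambda>y. \<Sum>i\<in>I. g i y" 1 1] by simp
  qed (simp add: zero)
  \<comment> \<open>Induction hypothesis on \<open>X - {t, t'}\<close> with sums over
    \<open>n'\<close>-subsets \<open>T\<close>. In the difference of the sums over
    \<open>insert t T\<close> and \<open>insert t' T\<close> the subsets of \<open>T\<close> itself
    cancel. Two points leave \<open>X\<close> while \<open>n\<close> and the size of the subsets
    drop by one each, so the cardinality condition survives.\<close>
  have exch: "L (\<lambda>y. f (insert t K') y - f (insert t' K') y)"
    if t: "t \<in> X" "t' \<in> X" "t \<noteq> t'" and K': "K' \<subseteq> X - {t, t'}" "card K' = k" for t t' K'
  proof (rule Suc.IH[of "X - {t, t'}" n' "\<lambda>K y. f (insert t K) y - f (insert t' K) y" K'])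
    show "finite (X - {t, t'})" using Suc.prems by auto
    show "k \<le> n'" using Suc.prems n' by auto
    have "card (X - {t, t'}) = card X - 2"
      using t Suc.prems(1) by (subst card_Diff_subset) auto
    then show "n' + k \<le> card (X - {t, t'})" using Suc.prems n' by auto
    fix T assume T: "T \<subseteq> X - {t, t'}" "card T = n'"
    have fT: "finite T" using T Suc.prems finite_subset by (metis finite_Diff)
    have *: "L (\<lambda>y. \<Sum>K | K \<subseteq> insert s T \<and> card K = Suc k. f K y)" if "s \<in> {t, t'}" for s
    proof (rule Suc.prems(4))
      show "insert s T \<subseteq> X" using T t that by auto
      have "s \<notin> T" using T that by auto
      then show "card (insert s T) = n" using T n' fT by auto
    qed
    have "t \<notin> T" "t' \<notin> T" using T by auto
    then have "(\<lambda>y. \<Sum>K | K \<subseteq> T \<and> card K = k. f (insert t K) y - f (insert t' K) y) =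
      (\<lambda>y. 1 * (\<Sum>K | K \<subseteq> insert t T \<and> card K = Suc k. f K y) +
           (-1) * (\<Sum>K | K \<subseteq> insert t' T \<and> card K = Suc k. f K y))"
      using fT by (simp add: sum_subsets_card_insert sum_subtractf)
    then show "L (\<lambda>y. \<Sum>K | K \<subseteq> T \<and> card K = k. f (insert t K) y - f (insert t' K) y)"
      using lin[OF *[of t] *[of t'], of 1 "-1"] by simp
  qed (use K' in auto)
  \<comment> \<open>Any two subsets of the same size are joined by exchanges of single points.
    \<open>K2\<close> is one exchange away from \<open>K1\<close> and one step closer to
    \<open>K0\<close>.\<close>
  have conn: "L (\<lambda>y. f K1 y - f K0 y)"
    if "K1 \<subseteq> X" "card K1 = Suc k" "K0 \<subseteq> X" "card K0 = Suc k" for K1 K0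
    using that
  proof (induction "card (K1 - K0)" arbitrary: K1 rule: less_induct)
    case less
    have fin: "finite K1" "finite K0" using less.prems Suc.prems finite_subset by auto
    show ?case
    proof (cases "K1 \<subseteq> K0")
      case True
      then have "K1 = K0" using less.prems fin by (intro card_subset_eq) auto
      then show ?thesis by (simp add: zero)
    next
      case False
      then obtain t where t: "t \<in> K1" "t \<notin> K0" by auto
      have "\<not> K0 \<subseteq> K1"
        using False less.prems fin card_subset_eq[of K1 K0] by auto
      then obtain t' where t': "t' \<in> K0" "t' \<notin> K1" by auto
      define K2 where "K2 = insert t' (K1 - {t})"
      have K2: "K2 \<subseteq> X" "card K2 = Suc k"
        using less.prems t t' fin unfolding K2_def by (auto simp: card_insert_if)
      have "card (K2 - K0) < card (K1 - K0)"
        using t t' fin unfolding K2_def by (intro psubset_card_mono) auto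
      from less.hyps[OF this K2 less.prems(3,4)] have a: "L (\<lambda>y. f K2 y - f K0 y)" .
      have "L (\<lambda>y. f (insert t (K1 - {t})) y - f (insert t' (K1 - {t})) y)"
        using less.prems t t' by (intro exch) auto
      then have b: "L (\<lambda>y. f K1 y - f K2 y)"
        using t by (simp add: K2_def insert_absorb)
      from lin[OF b a, of 1 1] show ?thesis by simp
    qed
  qed
  \<comment> \<open>The sum over \<open>I\<close> lies in \<open>L\<close> and differs from
    \<open>card I\<close> copies of \<open>f K\<close> by an element of \<open>L\<close>. The number
    \<open>card I\<close> is a binomial coefficient, positive because \<open>Suc k\<close> is at
    most \<open>n\<close>, so it can be divided out.\<close>
  define I where "I = {K'. K' \<subseteq> T0 \<and> card K' = Suc k}"
  have fI: "finite I" unfolding I_def by (rule finite_subset[of _ "Pow T0"]) (use fT0 in auto)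
  have a: "L (\<lambda>y. \<Sum>K'\<in>I. f K' y - f K y)"
    by (rule Lsum[OF fI]) (use conn Suc.prems T0 in \<open>auto simp: I_def\<close>)
  have b: "L (\<lambda>y. \<Sum>K'\<in>I. f K' y)"
    using Suc.prems(4)[OF T0] by (simp add: I_def)
  have "card I = n choose Suc k"
    unfolding I_def using n_subsets[OF fT0, of "Suc k"] T0 by simp
  then have "card I > 0" using Suc.prems by simp
  then have fK: "f K = (\<lambda>y. inverse (card I) * (\<Sum>K'\<in>I. f K' y) +
      (- inverse (card I)) * (\<Sum>K'\<in>I. f K' y - f K y))"
    by (auto simp: sum_subtractf algebra_simps)
  then show ?case by (subst fK) (rule lin[OF b a])
qed

text \<open>The increasing enumeration of a finite index set, cut off to an extensional function so
  that it is itself one of the index sequences summed over in \<open>body_sum\<close>. It translates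
  between index sequences and subsets.\<close>

definition enum_set :: "nat \<Rightarrow> nat set \<Rightarrow> nat \<Rightarrow> nat" where
  "enum_set k K = (\<lambda>j\<in>{..<k}. sorted_list_of_set K ! j)"

lemma enum_set_image:
  assumes "strict_mono_on {..<k} i"
  shows "enum_set k (i ` {..<k}) = restrict i {..<k}"
proof -
  have "sorted_list_of_set (i ` {..<k}) = map i [0..<k]"
  proof -
    have "inj_on i {..<k}" using assms strict_mono_on_imp_inj_on by auto
    moreover have "sorted (map i [0..<k])"
      using assms by (auto simp: sorted_iff_nth_mono strict_mono_on_def le_less)
    ultimately have "sorted_list_of_set (set (map i [0..<k])) = map i [0..<k]"
      by (intro sorted_list_of_set.idem_if_sorted_distinct) (auto simp: distinct_map atLeast0LessThan)
    then show ?thesis by (simp add: atLeast0LessThan)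
  qed
  then show ?thesis by (auto simp: enum_set_def)
qed

lemma enum_set:
  assumes "finite K" "card K = k"
  shows "strict_mono_on {..<k} (enum_set k K)" "enum_set k K ` {..<k} = K"
    "bij_betw (enum_set k K) {..<k} K" "enum_set k K \<in> {..<k} \<rightarrow>\<^sub>E K"
proof -
  have len: "length (sorted_list_of_set K) = k" using assms by simp
  show 1: "strict_mono_on {..<k} (enum_set k K)"
    using len sorted_wrt_nth_less[OF strict_sorted_list_of_set[of K]]
    by (auto simp: strict_mono_on_def enum_set_def)
  have "enum_set k K ` {..<k} = set (sorted_list_of_set K)"
    using len by (auto simp: enum_set_def set_conv_nth)
  then show 2: "enum_set k K ` {..<k} = K" using assms by simp
  show "bij_betw (enum_set k K) {..<k} K"
    using 2 strict_mono_on_imp_inj_on[OF 1] by (simp add: bij_betw_def)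
  show "enum_set k K \<in> {..<k} \<rightarrow>\<^sub>E K" using 2 by (auto simp: enum_set_def)
qed

text \<open>Following an increasing map by the increasing enumeration of \<open>T\<close> and taking
  the range is a bijection from index sequences onto the \<open>m\<close>-subsets of
  \<open>T\<close>. Thus the body sums at all \<open>N\<close>-subsets of a larger index set become
  subset sums of one fixed function, the form that \<open>subset_sum_extract\<close> takes.\<close>

lemma body_sum_enum_set:
  assumes "finite T" "card T = N"
  shows "body_sum N m v (\<lambda>j\<in>{..<N}. x (enum_set N T j)) =
    (\<Sum>K | K \<subseteq> T \<and> card K = m. v (\<lambda>j\<in>{..<m}. x (enum_set m K j)))"
proof -
  define S where "S = {i \<in> {..<m} \<rightarrow>\<^sub>E {..<N}. strict_mono_on {..<m} i}"
  define e where "e = enum_set N T"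
  define h where "h i = (e \<circ> i) ` {..<m}" for i :: "nat \<Rightarrow> nat"
  note eT = enum_set[OF assms, folded e_def]
  have sm: "strict_mono_on {..<m} (e \<circ> i)" if "i \<in> S" for i
    using that eT(1) by (auto simp: S_def strict_mono_on_def PiE_iff)
  have en: "enum_set m (h i) = (\<lambda>j\<in>{..<m}. e (i j))" if "i \<in> S" for i
    unfolding h_def using enum_set_image[OF sm[OF that]] by (simp add: comp_def)
  have "bij_betw h S {K. K \<subseteq> T \<and> card K = m}"
    unfolding bij_betw_def
  proof
    show "inj_on h S"
    proof (rule inj_onI)
      fix i i' assume i: "i \<in> S" "i' \<in> S" "h i = h i'"
      show "i = i'"
      proof (rule PiE_ext)
        show "i \<in> {..<m} \<rightarrow>\<^sub>E {..<N}" "i' \<in> {..<m} \<rightarrow>\<^sub>E {..<N}" using i by (auto simp: S_def)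
        fix j assume j: "j \<in> {..<m}"
        have "e (i j) = e (i' j)"
          using en[OF i(1)] en[OF i(2)] i(3) j by (metis restrict_apply')
        moreover have "i j < N" "i' j < N" using i j by (auto simp: S_def PiE_iff)
        ultimately show "i j = i' j"
          using eT(3) by (auto simp: bij_betw_def inj_on_def)
      qed
    qed
    show "h ` S = {K. K \<subseteq> T \<and> card K = m}"
    proof (intro equalityI subsetI)
      fix K assume "K \<in> h ` S"
      then obtain i where i: "i \<in> S" "K = h i" by auto
      have "K \<subseteq> T" using i eT(2) by (auto simp: h_def S_def PiE_iff)
      moreover have "card K = m"
        unfolding i(2) h_def using card_image[OF strict_mono_on_imp_inj_on[OF sm[OF i(1)]]] by simp
      ultimately show "K \<in> {K. K \<subseteq> T \<and> card K = m}" by simp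
    next
      fix K assume K: "K \<in> {K. K \<subseteq> T \<and> card K = m}"
      then have fK: "finite K" using assms finite_subset by auto
      note eK = enum_set[OF fK, of m]
      define i where "i = (\<lambda>j\<in>{..<m}. inv_into {..<N} e (enum_set m K j))"
      have ei: "e (i j) = enum_set m K j" "i j < N" if "j < m" for j
      proof -
        have "enum_set m K j \<in> e ` {..<N}" using eK(4) K that eT(2) by (auto simp: PiE_iff)
        from f_inv_into_f[OF this] inv_into_into[OF this] show "e (i j) = enum_set m K j" "i j < N"
          using that by (auto simp: i_def)
      qed
      have "strict_mono_on {..<m} i"
      proof (rule strict_mono_onI)
        fix a b assume ab: "a \<in> {..<m}" "b \<in> {..<m}" "a < b"
        then have "e (i a) < e (i b)"
          using eK(1) K ei by (auto simp: strict_mono_on_def)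
        moreover have "strict_mono_on {..<N} e" by (rule eT)
        ultimately show "i a < i b"
          using ei(2)[of a] ei(2)[of b] ab unfolding strict_mono_on_def
          by (metis lessThan_iff linorder_neqE_nat order_less_asym)
      qed
      then have "i \<in> S" using ei by (auto simp: S_def i_def)
      moreover have "h i = K"
        using eK(2) K ei by (auto simp: h_def image_def)
      ultimately show "K \<in> h ` S" by auto
    qed
  qed
  then have "(\<Sum>K | K \<subseteq> T \<and> card K = m. v (\<lambda>j\<in>{..<m}. x (enum_set m K j))) =
     (\<Sum>i\<in>S. v (\<lambda>j\<in>{..<m}. x (enum_set m (h i) j)))"
    by (rule sum.reindex_bij_betw[symmetric])
  also have "\<dots> = (\<Sum>i\<in>S. v (\<lambda>j\<in>{..<m}. (\<lambda>j\<in>{..<N}. x (e j)) (i j)))"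
  proof (rule sum.cong[OF refl])
    fix i assume i: "i \<in> S"
    have "(\<lambda>j\<in>{..<m}. x (enum_set m (h i) j)) = (\<lambda>j\<in>{..<m}. (\<lambda>j\<in>{..<N}. x (e j)) (i j))"
      using i by (auto simp: en S_def PiE_iff restrict_def)
    then show "v (\<lambda>j\<in>{..<m}. x (enum_set m (h i) j)) = v (\<lambda>j\<in>{..<m}. (\<lambda>j\<in>{..<N}. x (e j)) (i j))"
      by simp
  qed
  finally show ?thesis unfolding body_sum_def S_def e_def by simp
qed

lemma enum_set_lessThan: "enum_set N {..<N} = restrict id {..<N}"
  using enum_set_image[of N id] by (simp add: strict_mono_on_def)

lemma body_sum_eq_sum_subsets:
  "body_sum N m v x = (\<Sum>K | K \<subseteq> {..<N} \<and> card K = m. v (\<lambda>j\<in>{..<m}. x (enum_set m K j)))"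
proof -
  have "body_sum N m v x = body_sum N m v (\<lambda>j\<in>{..<N}. x (enum_set N {..<N} j))"
    unfolding body_sum_def enum_set_lessThan
    by (intro sum.cong refl arg_cong[of _ _ v]) (auto simp: PiE_iff)
  then show ?thesis using body_sum_enum_set[of "{..<N}" N m v x] by simp
qed

text \<open>A permutation of the variables permutes the \<open>m\<close>-subsets of indices. Within
  each subset it only changes the order of the arguments, which the symmetry of \<open>v\<close>
  absorbs.\<close>

lemma body_sum_permute:
  assumes sym: "symmetric_fun M m v" and p: "p permutes {..<N}"
    and x: "x \<in> space (pow_measure M {..<N})"
  shows "body_sum N m v (x \<circ> p) = body_sum N m v x"
proof -
  define A where "A = {K. K \<subseteq> {..<N} \<and> card K = m}"
  have eq: "v (\<lambda>j\<in>{..<m}. (x \<circ> p) (enum_set m K j)) = v (\<lambda>j\<in>{..<m}. x (enum_set m (p ` K) j))"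
    if K: "K \<in> A" for K
  proof -
    have fK: "finite K" "card K = m" using K finite_subset[of K "{..<N}"] by (auto simp: A_def)
    have injp: "inj_on p K" using permutes_inj[OF p] inj_on_subset by blast
    have fpK: "finite (p ` K)" "card (p ` K) = m" using fK card_image[OF injp] by auto
    note eK = enum_set[OF fK] and epK = enum_set[OF fpK]
    define y where "y = (\<lambda>j\<in>{..<m}. x (enum_set m (p ` K) j))"
    \<comment> \<open>The reordering that \<open>p\<close> induces on the places
      \<open>{..<m}\<close>: enumerate \<open>K\<close>, apply \<open>p\<close>, read off the place
      in the enumeration of its image. It is extended by the identity to be a permutation of all
      naturals.\<close>
    define q where "q j = (if j < m then inv_into {..<m} (enum_set m (p ` K)) (p (enum_set m K j)) else j)" for j
    have bp: "bij_betw p K (p ` K)" using injp by (simp add: bij_betw_def)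
    have "bij_betw (inv_into {..<m} (enum_set m (p ` K)) \<circ> (p \<circ> enum_set m K)) {..<m} {..<m}"
      by (rule bij_betw_trans[OF bij_betw_trans[OF eK(3) bp] bij_betw_inv_into[OF epK(3)]])
    then have "bij_betw q {..<m} {..<m}"
      by (subst bij_betw_cong[of _ q]) (auto simp: q_def)
    then have q: "q permutes {..<m}"
      by (rule bij_imp_permutes) (auto simp: q_def)
    have "p ` K \<subseteq> {..<N}" using K permutes_in_image[OF p] by (auto simp: A_def)
    then have "y \<in> space (pow_measure M {..<m})"
      using x epK(4) by (fastforce simp: y_def pow_measure_def space_PiM PiE_iff)
    with sym q have "v (y \<circ> q) = v y" by (auto simp: symmetric_fun_def)
    moreover have "y \<circ> q = (\<lambda>j\<in>{..<m}. (x \<circ> p) (enum_set m K j))"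
    proof
      fix j
      show "(y \<circ> q) j = (\<lambda>j\<in>{..<m}. (x \<circ> p) (enum_set m K j)) j"
      proof (cases "j < m")
        case True
        then have "q j < m" using permutes_in_image[OF q] by auto
        have "p (enum_set m K j) \<in> enum_set m (p ` K) ` {..<m}"
          unfolding epK(2) using True eK(2) by auto
        then have "enum_set m (p ` K) (q j) = p (enum_set m K j)"
          using True by (simp add: q_def f_inv_into_f)
        then show ?thesis using True \<open>q j < m\<close> by (simp add: y_def)
      qed (simp add: y_def q_def)
    qed
    ultimately show ?thesis unfolding y_def by simp
  qed
  have "bij_betw (\<lambda>K. p ` K) A A"
  proof (rule bij_betw_byWitness[where f' = "\<lambda>K. inv p ` K"])
    have inj: "inj p" "inj (inv p)" using p permutes_inj permutes_inv by blast+
    show "(\<lambda>K. p ` K) ` A \<subseteq> A" "(\<lambda>K. inv p ` K) ` A \<subseteq> A"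
      using permutes_in_image[OF p] permutes_in_image[OF permutes_inv[OF p]]
        card_image[OF inj_on_subset[OF inj(1)]] card_image[OF inj_on_subset[OF inj(2)]]
      by (auto simp: A_def)
  qed (auto simp: image_comp permutes_inv_o[OF p])
  from sum.reindex_bij_betw[OF this, of "\<lambda>K. v (\<lambda>j\<in>{..<m}. x (enum_set m K j))"]
  show ?thesis unfolding body_sum_eq_sum_subsets A_def[symmetric] using sum.cong[OF refl eq, of A] by simp
qed

section \<open>Products of a \<sigma>-finite measure\<close>

lemma (in complete_measure) measurable_AE_cong:
  assumes f': "f' \<in> M \<rightarrow>\<^sub>M S" and eq: "AE x in M. f x = f' x"
    and sp: "\<And>x. x \<in> space M \<Longrightarrow> f x \<in> space S"
  shows "f \<in> M \<rightarrow>\<^sub>M S"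
proof (rule measurableI)
  show "x \<in> space M \<Longrightarrow> f x \<in> space S" for x using sp by simp
  fix A assume A: "A \<in> sets S"
  show "f -` A \<inter> space M \<in> sets M"
  proof (rule in_sets_AE[where A = "f' -` A \<inter> space M"])
    show "AE x in M. x \<in> f' -` A \<inter> space M \<longleftrightarrow> x \<in> f -` A \<inter> space M"
      using eq by eventually_elim simp
    show "f' -` A \<inter> space M \<in> sets M" using measurable_sets[OF f' A] .
  qed simp
qed

text \<open>The complements of \<open>J\<close> and of its image in \<open>I\<close> have the same
  size, so any bijection between them completes \<open>i\<close>. This turns a selection of
  variables into a permutation of all of them, to which symmetry applies.\<close>

lemma permutes_extend:
  assumes "inj_on i J" "J \<subseteq> I" "i ` J \<subseteq> I" "finite I"
  obtains p where "p permutes I" "\<And>j. j \<in> J \<Longrightarrow> p j = i j"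
proof -
  have fJ: "finite J" using assms finite_subset by auto
  have "card (I - J) = card (I - i ` J)"
    using assms fJ by (simp add: card_Diff_subset card_image)
  then obtain h where h: "bij_betw h (I - J) (I - i ` J)"
    using finite_same_card_bij[of "I - J" "I - i ` J"] assms(4) by auto
  define p where "p j = (if j \<in> J then i j else if j \<in> I then h j else j)" for j
  have "bij_betw p J (i ` J)"
    using assms(1) by (subst bij_betw_cong[of _ p i]) (auto simp: p_def bij_betw_def)
  moreover have "bij_betw p (I - J) (I - i ` J)"
    using h by (subst bij_betw_cong[of _ p h]) (auto simp: p_def)
  ultimately have "bij_betw p (J \<union> (I - J)) (i ` J \<union> (I - i ` J))"
    by (rule bij_betw_combine) auto
  moreover have "J \<union> (I - J) = I" "i ` J \<union> (I - i ` J) = I" using assms by auto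
  ultimately have "p permutes I"
    using assms(2) by (intro bij_imp_permutes) (auto simp: p_def)
  then show ?thesis by (rule that) (simp add: p_def)
qed

context sigma_finite_measure
begin

lemma product_sigma_finite_const: "product_sigma_finite (\<lambda>_. M)"
  by standard

lemma sigma_finite_PiM_const: "finite I \<Longrightarrow> sigma_finite_measure (PiM I (\<lambda>_. M))"
  by (rule product_sigma_finite.sigma_finite[OF product_sigma_finite_const])

lemma measurable_reindex [measurable]:
  "f ` J \<subseteq> I \<Longrightarrow> (\<lambda>x. \<lambda>j\<in>J. x (f j)) \<in> PiM I (\<lambda>_. M) \<rightarrow>\<^sub>M PiM J (\<lambda>_. M)"
  by (rule measurable_restrict) (auto intro!: measurable_component_singleton)

lemma distr_PiM_reindex_bij:
  fixes I J :: "'i set"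
  assumes "finite I" "bij_betw f J I"
  shows "distr (PiM I (\<lambda>_. M)) (PiM J (\<lambda>_. M)) (\<lambda>x. \<lambda>j\<in>J. x (f j)) = PiM J (\<lambda>_. M)"
proof -
  interpret product_sigma_finite "\<lambda>_::'i. M" by (rule product_sigma_finite_const)
  have fJ: "finite J" using assms bij_betw_finite by blast
  have fJI: "f ` J = I" "inj_on f J" using assms by (auto simp: bij_betw_def)
  show ?thesis
  proof (rule PiM_eqI[OF fJ])
    fix A assume A: "\<And>i. i \<in> J \<Longrightarrow> A i \<in> sets M"
    let ?g = "inv_into J f"
    have gf: "?g (f j) = j" if "j \<in> J" for j using that fJI by simp
    have fg: "f (?g i) = i" "?g i \<in> J" if "i \<in> I" for i
      using that fJI f_inv_into_f[of i f J] inv_into_into[of i f J] by auto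
    have fI: "f j \<in> I" if "j \<in> J" for j using that fJI by auto
    have "(\<lambda>x. \<lambda>j\<in>J. x (f j)) -` Pi\<^sub>E J A \<inter> space (PiM I (\<lambda>_. M)) = Pi\<^sub>E I (\<lambda>i. A (?g i))"
    proof (intro equalityI subsetI)
      fix x assume x: "x \<in> (\<lambda>x. \<lambda>j\<in>J. x (f j)) -` Pi\<^sub>E J A \<inter> space (PiM I (\<lambda>_. M))"
      have "x i \<in> A (?g i)" if "i \<in> I" for i
        using x fg[OF that] by (auto simp: PiE_iff dest!: bspec[of _ _ "?g i"])
      then show "x \<in> Pi\<^sub>E I (\<lambda>i. A (?g i))" using x by (auto simp: space_PiM PiE_iff)
    next
      fix x assume x: "x \<in> Pi\<^sub>E I (\<lambda>i. A (?g i))"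
      have "x (f j) \<in> A j" if "j \<in> J" for j
        using x fI[OF that] gf[OF that] by (metis PiE_mem)
      moreover have "x i \<in> space M" if "i \<in> I" for i
        using x fg[OF that] A[THEN sets.sets_into_space] that by (auto simp: PiE_iff)
      ultimately show "x \<in> (\<lambda>x. \<lambda>j\<in>J. x (f j)) -` Pi\<^sub>E J A \<inter> space (PiM I (\<lambda>_. M))"
        using x by (auto simp: space_PiM PiE_iff)
    qed
    then have "emeasure (distr (PiM I (\<lambda>_. M)) (PiM J (\<lambda>_. M)) (\<lambda>x. \<lambda>j\<in>J. x (f j))) (Pi\<^sub>E J A) =
        emeasure (PiM I (\<lambda>_. M)) (Pi\<^sub>E I (\<lambda>i. A (?g i)))"
      using fJI A fJ by (subst emeasure_distr) (auto intro!: sets_PiM_I_finite)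
    also have "\<dots> = (\<Prod>i\<in>I. emeasure M (A (?g i)))"
      using assms fJI A inv_into_into[of _ f J] by (intro emeasure_PiM) auto
    also have "\<dots> = (\<Prod>j\<in>J. emeasure M (A j))"
      using prod.reindex_bij_betw[OF assms(2), of "\<lambda>i. emeasure M (A (?g i))"] fJI by simp
    finally show "emeasure (distr (PiM I (\<lambda>_. M)) (PiM J (\<lambda>_. M)) (\<lambda>x. \<lambda>j\<in>J. x (f j))) (Pi\<^sub>E J A) =
        (\<Prod>j\<in>J. emeasure M (A j))" .
  qed simp
qed

lemma AE_PiM_merge:
  fixes I J :: "'i set"
  assumes "AE z in PiM (I \<union> J) (\<lambda>_. M). R z" "I \<inter> J = {}" "finite I" "finite J"
  shows "AE x in PiM I (\<lambda>_. M). AE y in PiM J (\<lambda>_. M). R (merge I J (x, y))"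
proof -
  interpret product_sigma_finite "\<lambda>_::'i. M" by (rule product_sigma_finite_const)
  interpret pair_sigma_finite "PiM I (\<lambda>_. M)" "PiM J (\<lambda>_. M)"
    by (intro pair_sigma_finite.intro sigma_finite_PiM_const assms)
  have "AE z in distr (PiM I (\<lambda>_. M) \<Otimes>\<^sub>M PiM J (\<lambda>_. M)) (PiM (I \<union> J) (\<lambda>_. M)) (merge I J). R z"
    unfolding distr_merge[OF assms(2-4)] by (rule assms(1))
  then have "AE z in PiM I (\<lambda>_. M) \<Otimes>\<^sub>M PiM J (\<lambda>_. M). R (merge I J z)"
    by (rule AE_distrD[rotated]) simp
  then show ?thesis by (rule AE_pair)
qed

text \<open>Fubini with the added variable outermost. This is the order of quantifiers in the lower
  bound on the density, which holds for a.e. value of the last variable.\<close>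

lemma AE_PiM_fun_upd:
  fixes I :: "'i set"
  assumes "AE z in PiM (insert i I) (\<lambda>_. M). R z" "finite I" "i \<notin> I"
  shows "AE s in M. AE x in PiM I (\<lambda>_. M). R (x(i := s))"
proof -
  interpret product_sigma_finite "\<lambda>_::'i. M" by (rule product_sigma_finite_const)
  obtain A where A: "A \<in> null_sets (PiM (insert i I) (\<lambda>_. M))" "{z\<in>space (PiM (insert i I) (\<lambda>_. M)). \<not> R z} \<subseteq> A"
    using assms(1) unfolding eventually_ae_filter by auto
  interpret I: sigma_finite_measure "PiM I (\<lambda>_. M)" by (rule sigma_finite_PiM_const) fact
  have [measurable]: "A \<in> sets (PiM (insert i I) (\<lambda>_. M))" using A by auto
  have "0 = (\<integral>\<^sup>+z. indicator A z \<partial>PiM (insert i I) (\<lambda>_. M))" using A by auto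
  also have "\<dots> = (\<integral>\<^sup>+s. \<integral>\<^sup>+x. indicator A (x(i := s)) \<partial>PiM I (\<lambda>_. M) \<partial>M)"
    using assms by (intro product_nn_integral_insert_rev) auto
  finally have "(\<integral>\<^sup>+s. \<integral>\<^sup>+x. indicator A (x(i := s)) \<partial>PiM I (\<lambda>_. M) \<partial>M) = (0::ennreal)" by simp
  then have "AE s in M. (\<integral>\<^sup>+x. indicator A (x(i := s)) \<partial>PiM I (\<lambda>_. M)) = (0::ennreal)"
    by (subst (asm) nn_integral_0_iff_AE) measurable
  with AE_space show ?thesis
  proof eventually_elim
    case (elim s)
    note [measurable] = elim(1)
    have "AE x in PiM I (\<lambda>_. M). indicator A (x(i := s)) = (0::ennreal)"
      using elim(2) by (subst (asm) nn_integral_0_iff_AE) measurable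
    with AE_space show ?case
    proof eventually_elim
      case (elim x)
      have "x(i := s) \<in> space (PiM (insert i I) (\<lambda>_. M))"
        using elim \<open>s \<in> space M\<close> by (auto simp: space_PiM PiE_iff extensional_def)
      then show ?case using A elim by (auto simp: indicator_def split: if_splits)
    qed
  qed
qed

lemma AE_PiM_reindex:
  fixes I J :: "'i set"
  assumes "AE y in PiM J (\<lambda>_. M). Q y" "finite I" "inj_on f J" "f ` J \<subseteq> I"
  shows "AE x in PiM I (\<lambda>_. M). Q (\<lambda>j\<in>J. x (f j))"
proof -
  interpret product_sigma_finite "\<lambda>_::'i. M" by (rule product_sigma_finite_const)
  define I1 where "I1 = f ` J"
  have fin: "finite I1" "finite (I - I1)" and I: "I1 \<union> (I - I1) = I"
    using assms finite_subset by (auto simp: I1_def)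
  interpret P: pair_sigma_finite "PiM I1 (\<lambda>_. M)" "PiM (I - I1) (\<lambda>_. M)"
    by (intro pair_sigma_finite.intro sigma_finite_PiM_const fin)
  have "bij_betw f J I1" using assms by (simp add: I1_def bij_betw_def)
  then have "AE y in distr (PiM I1 (\<lambda>_. M)) (PiM J (\<lambda>_. M)) (\<lambda>x. \<lambda>j\<in>J. x (f j)). Q y"
    using assms(1) distr_PiM_reindex_bij[OF fin(1)] by metis
  then have "AE x in PiM I1 (\<lambda>_. M). Q (\<lambda>j\<in>J. x (f j))"
    by (rule AE_distrD[OF measurable_reindex, rotated]) (simp add: I1_def)
  then obtain A where A: "A \<in> null_sets (PiM I1 (\<lambda>_. M))"
      "{x\<in>space (PiM I1 (\<lambda>_. M)). \<not> Q (\<lambda>j\<in>J. x (f j))} \<subseteq> A"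
    unfolding eventually_ae_filter by auto
  have [measurable]: "A \<in> sets (PiM I1 (\<lambda>_. M))" using A by auto
  have "AE x in PiM I1 (\<lambda>_. M). AE y in PiM (I - I1) (\<lambda>_. M). fst (x, y) \<notin> A"
    using AE_not_in[OF A(1)] by eventually_elim simp
  then have pr: "AE z in PiM I1 (\<lambda>_. M) \<Otimes>\<^sub>M PiM (I - I1) (\<lambda>_. M). fst z \<notin> A"
    by (rule P.AE_pair_measure[rotated]) measurable
  have "AE z in PiM I1 (\<lambda>_. M) \<Otimes>\<^sub>M PiM (I - I1) (\<lambda>_. M). restrict (merge I1 (I - I1) z) I1 \<notin> A"
    using pr AE_space by eventually_elim (auto simp: space_pair_measure space_PiM PiE_def extensional_restrict)
  moreover have [measurable]: "(\<lambda>x. restrict x I1) \<in> PiM I (\<lambda>_. M) \<rightarrow>\<^sub>M PiM I1 (\<lambda>_. M)"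
    using I by (intro measurable_restrict_subset) auto
  have "{z \<in> space (PiM (I1 \<union> (I - I1)) (\<lambda>_. M)). restrict z I1 \<notin> A} \<in> sets (PiM (I1 \<union> (I - I1)) (\<lambda>_. M))"
    unfolding I by measurable
  ultimately have "AE z in distr (PiM I1 (\<lambda>_. M) \<Otimes>\<^sub>M PiM (I - I1) (\<lambda>_. M)) (PiM (I1 \<union> (I - I1)) (\<lambda>_. M)) (merge I1 (I - I1)). restrict z I1 \<notin> A"
    by (subst AE_distr_iff[OF measurable_merge])
  then have "AE z in PiM I (\<lambda>_. M). restrict z I1 \<notin> A"
    unfolding distr_merge[OF Diff_disjoint fin] unfolding I .
  with AE_space show ?thesis
  proof eventually_elim
    case (elim z)
    then have "restrict z I1 \<in> space (PiM I1 (\<lambda>_. M))"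
      using I by (auto simp: space_PiM PiE_iff)
    with A(2) elim have "Q (\<lambda>j\<in>J. (restrict z I1) (f j))" by auto
    moreover have "(\<lambda>j\<in>J. (restrict z I1) (f j)) = (\<lambda>j\<in>J. z (f j))"
      by (auto simp: I1_def)
    ultimately show ?case by simp
  qed
qed

lemma emeasure_PiM_space_nonzero:
  fixes I :: "'i set"
  assumes "emeasure M (space M) \<noteq> 0" "finite I"
  shows "emeasure (PiM I (\<lambda>_. M)) (space (PiM I (\<lambda>_. M))) \<noteq> 0"
proof -
  interpret product_sigma_finite "\<lambda>_::'i. M" by (rule product_sigma_finite_const)
  show ?thesis using assms by (simp add: space_PiM emeasure_PiM)
qed

text \<open>Removes variables on which the property does not depend. The measure of the removed
  factor must be nonzero, since otherwise the assumption would be vacuous.\<close>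

lemma AE_PiM_restrict:
  fixes I J :: "'i set"
  assumes "AE z in PiM (I \<union> J) (\<lambda>_. M). Q (restrict z I)" "I \<inter> J = {}" "finite I" "finite J"
    and "emeasure M (space M) \<noteq> 0"
  shows "AE x in PiM I (\<lambda>_. M). Q x"
  using AE_PiM_merge[OF assms(1-4)] AE_space
proof eventually_elim
  case (elim x)
  have "restrict (merge I J (x, y)) I = x" for y
    using elim(2) assms(2) by (auto simp: space_PiM PiE_def extensional_restrict)
  then have "AE y in PiM J (\<lambda>_. M). Q x" using elim(1) by simp
  then show ?case
    using emeasure_PiM_space_nonzero[OF assms(5,4)] by (cases "Q x") (auto simp: ae_filter_eq_bot_iff eventually_False)
qed

lemma AE_pow_measure_reindex:
  assumes "AE y in pow_measure M J. Q y" "finite I" "inj_on f J" "f ` J \<subseteq> I"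
  shows "AE x in pow_measure M I. Q (\<lambda>j\<in>J. x (f j))"
proof -
  have "AE y in PiM J (\<lambda>_. M). Q y"
    using assms(1) unfolding pow_measure_def AE_completion_iff .
  from AE_PiM_reindex[OF this assms(2-4)] show ?thesis
    unfolding pow_measure_def AE_completion_iff .
qed

text \<open>Measurability into a completion requires, beyond measurability into the product, that
  preimages of null sets are null. \<open>AE_PiM_reindex\<close> supplies this.\<close>

lemma measurable_pow_measure_reindex:
  assumes "finite I" "inj_on f J" "f ` J \<subseteq> I"
  shows "(\<lambda>x. \<lambda>j\<in>J. x (f j)) \<in> pow_measure M I \<rightarrow>\<^sub>M pow_measure M J"
  unfolding pow_measure_def
proof (rule completion.measurable_completion2)
  show *: "(\<lambda>x. \<lambda>j\<in>J. x (f j)) \<in> completion (PiM I (\<lambda>_. M)) \<rightarrow>\<^sub>M PiM J (\<lambda>_. M)"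
    by (rule measurable_completion[OF measurable_reindex[OF assms(3)]])
  show "null_sets (PiM J (\<lambda>_. M)) \<subseteq> null_sets (distr (completion (PiM I (\<lambda>_. M))) (PiM J (\<lambda>_. M)) (\<lambda>x. \<lambda>j\<in>J. x (f j)))"
  proof
    fix A assume A: "A \<in> null_sets (PiM J (\<lambda>_. M))"
    from AE_PiM_reindex[OF AE_not_in[OF this] assms]
    have "AE x in completion (PiM I (\<lambda>_. M)). (\<lambda>j\<in>J. x (f j)) \<notin> A" by (rule AE_completion)
    moreover have [measurable]: "A \<in> sets (PiM J (\<lambda>_. M))" using A by auto
    ultimately have "AE x in distr (completion (PiM I (\<lambda>_. M))) (PiM J (\<lambda>_. M)) (\<lambda>x. \<lambda>j\<in>J. x (f j)). x \<notin> A"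
      using * by (subst AE_distr_iff) auto
    then show "A \<in> null_sets (distr (completion (PiM I (\<lambda>_. M))) (PiM J (\<lambda>_. M)) (\<lambda>x. \<lambda>j\<in>J. x (f j)))"
      using A by (subst (asm) AE_iff_null_sets[symmetric]) auto
  qed
qed

lemma nn_integral_pow_measure_permute:
  assumes F: "F \<in> borel_measurable (pow_measure M I)" and p: "p permutes I" "finite I"
  shows "(\<integral>\<^sup>+x. F (x \<circ> p) \<partial>pow_measure M I) = (\<integral>\<^sup>+x. F x \<partial>pow_measure M I)"
proof -
  obtain F' where F': "F' \<in> borel_measurable (PiM I (\<lambda>_. M))" "AE x in PiM I (\<lambda>_. M). F x = F' x"
    by (rule bexE[OF completion_ex_borel_measurable[OF F[unfolded pow_measure_def]]])
  note [measurable] = F'(1)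
  have pI: "p ` I = I" "inj_on p I" "bij_betw p I I"
    using permutes_image[OF p(1)] permutes_inj_on[OF p(1)] permutes_imp_bij[OF p(1)] by auto
  have eq: "x \<circ> p = (\<lambda>j\<in>I. x (p j))" if "x \<in> space (PiM I (\<lambda>_. M))" for x
    using that permutes_not_in[OF p(1)] by (auto simp: space_PiM PiE_iff extensional_def restrict_def)
  have "(\<integral>\<^sup>+x. F (x \<circ> p) \<partial>pow_measure M I) = (\<integral>\<^sup>+x. F (\<lambda>j\<in>I. x (p j)) \<partial>PiM I (\<lambda>_. M))"
    unfolding pow_measure_def nn_integral_completion by (intro nn_integral_cong) (simp add: eq)
  also have "\<dots> = (\<integral>\<^sup>+x. F' (\<lambda>j\<in>I. x (p j)) \<partial>PiM I (\<lambda>_. M))"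
    using AE_PiM_reindex[OF F'(2) p(2) pI(2)] pI(1) by (intro nn_integral_cong_AE) auto
  also have "\<dots> = (\<integral>\<^sup>+x. F' x \<partial>distr (PiM I (\<lambda>_. M)) (PiM I (\<lambda>_. M)) (\<lambda>x. \<lambda>j\<in>I. x (p j)))"
    using pI by (subst nn_integral_distr) auto
  also have "\<dots> = (\<integral>\<^sup>+x. F' x \<partial>PiM I (\<lambda>_. M))"
    using distr_PiM_reindex_bij[OF p(2) pI(3)] by simp
  also have "\<dots> = (\<integral>\<^sup>+x. F x \<partial>pow_measure M I)"
    unfolding pow_measure_def nn_integral_completion using F'(2) by (intro nn_integral_cong_AE) auto
  finally show ?thesis .
qed

text \<open>Fubini is applied to a representative \<open>Q'\<close> measurable for the uncompleted
  product, all of whose sections are measurable. For a.e. \<open>x\<close> the sections of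
  \<open>Q\<close> and \<open>Q'\<close> agree a.e. and so have the same integral.\<close>

lemma marginal_base:
  fixes Q :: "(nat \<Rightarrow> 'a) \<Rightarrow> ennreal"
  assumes Q: "Q \<in> borel_measurable (pow_measure M (I \<union> J))" and IJ: "I \<inter> J = {}" "finite I" "finite J"
  obtains Q' where "Q' \<in> borel_measurable (PiM (I \<union> J) (\<lambda>_. M))" "AE x in PiM (I \<union> J) (\<lambda>_. M). Q x = Q' x"
    "(\<lambda>x. \<integral>\<^sup>+y. Q' (merge I J (x, y)) \<partial>PiM J (\<lambda>_. M)) \<in> borel_measurable (PiM I (\<lambda>_. M))"
    "AE x in PiM I (\<lambda>_. M). (\<integral>\<^sup>+y. Q (merge I J (x, y)) \<partial>pow_measure M J) =
       (\<integral>\<^sup>+y. Q' (merge I J (x, y)) \<partial>PiM J (\<lambda>_. M))"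
proof -
  interpret J: sigma_finite_measure "PiM J (\<lambda>_. M)" by (rule sigma_finite_PiM_const) fact
  obtain Q' where Q': "Q' \<in> borel_measurable (PiM (I \<union> J) (\<lambda>_. M))" "AE x in PiM (I \<union> J) (\<lambda>_. M). Q x = Q' x"
    by (rule bexE[OF completion_ex_borel_measurable[OF Q[unfolded pow_measure_def]]])
  note [measurable] = Q'(1)
  have "(\<lambda>x. \<integral>\<^sup>+y. Q' (merge I J (x, y)) \<partial>PiM J (\<lambda>_. M)) \<in> borel_measurable (PiM I (\<lambda>_. M))"
    by measurable
  moreover have "AE x in PiM I (\<lambda>_. M). (\<integral>\<^sup>+y. Q (merge I J (x, y)) \<partial>pow_measure M J) =
       (\<integral>\<^sup>+y. Q' (merge I J (x, y)) \<partial>PiM J (\<lambda>_. M))"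
    using AE_PiM_merge[OF Q'(2) IJ]
    by eventually_elim (simp add: pow_measure_def nn_integral_completion nn_integral_cong_AE)
  ultimately show ?thesis using that Q' by blast
qed

lemma measurable_marginal:
  fixes Q :: "(nat \<Rightarrow> 'a) \<Rightarrow> ennreal"
  assumes Q: "Q \<in> borel_measurable (pow_measure M (I \<union> J))" and IJ: "I \<inter> J = {}" "finite I" "finite J"
  shows "(\<lambda>x. \<integral>\<^sup>+y. Q (merge I J (x, y)) \<partial>pow_measure M J) \<in> borel_measurable (pow_measure M I)"
proof -
  obtain Q' where Q': "(\<lambda>x. \<integral>\<^sup>+y. Q' (merge I J (x, y)) \<partial>PiM J (\<lambda>_. M)) \<in> borel_measurable (PiM I (\<lambda>_. M))"
    "AE x in PiM I (\<lambda>_. M). (\<integral>\<^sup>+y. Q (merge I J (x, y)) \<partial>pow_measure M J) =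
       (\<integral>\<^sup>+y. Q' (merge I J (x, y)) \<partial>PiM J (\<lambda>_. M))"
    using marginal_base[OF assms] by blast
  show ?thesis
    unfolding pow_measure_def[of M I]
    by (rule completion.measurable_AE_cong[OF measurable_completion[OF Q'(1)] AE_completion[OF Q'(2)]]) simp
qed

lemma nn_integral_marginal:
  fixes Q :: "(nat \<Rightarrow> 'a) \<Rightarrow> ennreal"
  assumes Q: "Q \<in> borel_measurable (pow_measure M (I \<union> J))" and IJ: "I \<inter> J = {}" "finite I" "finite J"
    and g: "g \<in> borel_measurable (pow_measure M I)"
  shows "(\<integral>\<^sup>+x. g (restrict x I) * Q x \<partial>pow_measure M (I \<union> J)) =
    (\<integral>\<^sup>+x. g x * (\<integral>\<^sup>+y. Q (merge I J (x, y)) \<partial>pow_measure M J) \<partial>pow_measure M I)"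
proof -
  interpret product_sigma_finite "\<lambda>_::nat. M" by (rule product_sigma_finite_const)
  obtain Q' where [measurable]: "Q' \<in> borel_measurable (PiM (I \<union> J) (\<lambda>_. M))" and Q': "AE x in PiM (I \<union> J) (\<lambda>_. M). Q x = Q' x"
    "AE x in PiM I (\<lambda>_. M). (\<integral>\<^sup>+y. Q (merge I J (x, y)) \<partial>pow_measure M J) =
       (\<integral>\<^sup>+y. Q' (merge I J (x, y)) \<partial>PiM J (\<lambda>_. M))"
    using marginal_base[OF Q IJ] by blast
  obtain g' where g'[measurable]: "g' \<in> borel_measurable (PiM I (\<lambda>_. M))" and g'g: "AE x in PiM I (\<lambda>_. M). g x = g' x"
    by (rule bexE[OF completion_ex_borel_measurable[OF g[unfolded pow_measure_def]]])
  have [measurable]: "(\<lambda>x. restrict x I) \<in> PiM (I \<union> J) (\<lambda>_. M) \<rightarrow>\<^sub>M PiM I (\<lambda>_. M)"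
    by (intro measurable_restrict_subset) auto
  have "AE x in PiM (I \<union> J) (\<lambda>_. M). g (restrict x I) = g' (restrict x I)"
    using AE_PiM_reindex[OF g'g, of "I \<union> J" id] IJ by (simp add: restrict_def)
  then have "AE x in PiM (I \<union> J) (\<lambda>_. M). g (restrict x I) * Q x = g' (restrict x I) * Q' x"
    using Q'(1) by eventually_elim simp
  then have "(\<integral>\<^sup>+x. g (restrict x I) * Q x \<partial>pow_measure M (I \<union> J)) =
      (\<integral>\<^sup>+x. g' (restrict x I) * Q' x \<partial>PiM (I \<union> J) (\<lambda>_. M))"
    unfolding pow_measure_def nn_integral_completion by (rule nn_integral_cong_AE)
  also have "\<dots> = (\<integral>\<^sup>+x. \<integral>\<^sup>+y. g' (restrict (merge I J (x, y)) I) * Q' (merge I J (x, y)) \<partial>PiM J (\<lambda>_. M) \<partial>PiM I (\<lambda>_. M))"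
    using IJ by (intro product_nn_integral_fold) auto
  also have "\<dots> = (\<integral>\<^sup>+x. g' x * (\<integral>\<^sup>+y. Q' (merge I J (x, y)) \<partial>PiM J (\<lambda>_. M)) \<partial>PiM I (\<lambda>_. M))"
  proof (rule nn_integral_cong)
    fix x assume x[measurable]: "x \<in> space (PiM I (\<lambda>_. M))"
    then have "restrict (merge I J (x, y)) I = x" for y
      using IJ(1) by (auto simp: space_PiM PiE_def extensional_restrict)
    then show "(\<integral>\<^sup>+y. g' (restrict (merge I J (x, y)) I) * Q' (merge I J (x, y)) \<partial>PiM J (\<lambda>_. M)) =
      g' x * (\<integral>\<^sup>+y. Q' (merge I J (x, y)) \<partial>PiM J (\<lambda>_. M))"
      by (simp add: nn_integral_cmult)
  qed
  also have "\<dots> = (\<integral>\<^sup>+x. g x * (\<integral>\<^sup>+y. Q (merge I J (x, y)) \<partial>pow_measure M J) \<partial>pow_measure M I)"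
    unfolding pow_measure_def[of M I] nn_integral_completion
  proof (rule nn_integral_cong_AE)
    show "AE x in PiM I (\<lambda>_. M). g' x * (\<integral>\<^sup>+y. Q' (merge I J (x, y)) \<partial>PiM J (\<lambda>_. M)) =
        g x * (\<integral>\<^sup>+y. Q (merge I J (x, y)) \<partial>pow_measure M J)"
      using Q'(2) g'g by eventually_elim simp
  qed
  finally show ?thesis .
qed

text \<open>Extend the selection \<open>i\<close> to a permutation of all \<open>N\<close>
  variables. Symmetry of \<open>Q\<close> then moves the selected variables into the first
  \<open>m\<close> places, where the marginal is taken.\<close>

lemma nn_integral_marginal_reindex:
  fixes Q :: "(nat \<Rightarrow> 'a) \<Rightarrow> ennreal"
  assumes Q: "Q \<in> borel_measurable (pow_measure M {..<N})" and sym: "ae_symmetric M N Q"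
    and i: "inj_on i {..<m}" "i ` {..<m} \<subseteq> {..<N}" and "m \<le> N"
    and g: "g \<in> borel_measurable (pow_measure M {..<m})"
  shows "(\<integral>\<^sup>+x. g (\<lambda>j\<in>{..<m}. x (i j)) * Q x \<partial>pow_measure M {..<N}) =
    (\<integral>\<^sup>+x. g x * (\<integral>\<^sup>+y. Q (merge {..<m} {m..<N} (x, y)) \<partial>pow_measure M {m..<N}) \<partial>pow_measure M {..<m})"
proof -
  have N: "{..<N} = {..<m} \<union> {m..<N}" and dis: "{..<m} \<inter> {m..<N} = {}" using \<open>m \<le> N\<close> by auto
  obtain p where p: "p permutes {..<N}" "\<And>j. j \<in> {..<m} \<Longrightarrow> p j = i j"
    using permutes_extend[OF i(1) _ i(2)] \<open>m \<le> N\<close> by auto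
  have [measurable]: "(\<lambda>x. restrict x {..<m}) \<in> pow_measure M {..<N} \<rightarrow>\<^sub>M pow_measure M {..<m}"
    using measurable_pow_measure_reindex[of "{..<N}" id "{..<m}"] \<open>m \<le> N\<close> by (simp add: restrict_def)
  note [measurable] = Q g
  have "(\<integral>\<^sup>+x. g (\<lambda>j\<in>{..<m}. x (i j)) * Q x \<partial>pow_measure M {..<N}) =
     (\<integral>\<^sup>+x. g (restrict (x \<circ> p) {..<m}) * Q (x \<circ> p) \<partial>pow_measure M {..<N})"
  proof (rule nn_integral_cong_AE)
    have "AE x in pow_measure M {..<N}. Q (x \<circ> p) = Q x"
      using sym p by (auto simp: ae_symmetric_def)
    then show "AE x in pow_measure M {..<N}. g (\<lambda>j\<in>{..<m}. x (i j)) * Q x = g (restrict (x \<circ> p) {..<m}) * Q (x \<circ> p)"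
    proof eventually_elim
      case (elim x)
      have "restrict (x \<circ> p) {..<m} = (\<lambda>j\<in>{..<m}. x (i j))" using p(2) by (auto simp: restrict_def)
      then show ?case using elim by simp
    qed
  qed
  also have "\<dots> = (\<integral>\<^sup>+x. g (restrict x {..<m}) * Q x \<partial>pow_measure M {..<N})"
    by (rule nn_integral_pow_measure_permute[OF _ p(1), where F = "\<lambda>x. g (restrict x {..<m}) * Q x"]) auto
  also have "\<dots> = (\<integral>\<^sup>+x. g x * (\<integral>\<^sup>+y. Q (merge {..<m} {m..<N} (x, y)) \<partial>pow_measure M {m..<N}) \<partial>pow_measure M {..<m})"
    using nn_integral_marginal[of Q "{..<m}" "{m..<N}" g] Q g dis by (simp add: N[symmetric])
  finally show ?thesis .
qed

end

section \<open>Recovering the potential from its body sum\<close>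

context sigma_finite_measure
begin

section \<open>Freezing variables at values in \<open>B\<close>\<close>

lemma measurable_fun_upd_const:
  "i \<in> I \<Longrightarrow> t \<in> space M \<Longrightarrow> (\<lambda>y. y(i := t)) \<in> PiM I (\<lambda>_. M) \<rightarrow>\<^sub>M PiM I (\<lambda>_. M)"
  by (rule measurable_fun_upd[where J = I]) auto

lemma nn_integral_PiM_permute_weight:
  fixes G p :: "(nat \<Rightarrow> 'a) \<Rightarrow> ennreal"
  assumes [measurable]: "G \<in> borel_measurable (PiM I (\<lambda>_. M))" "p \<in> borel_measurable (PiM I (\<lambda>_. M))"
    and q: "q permutes I" "finite I" and sym: "AE x in PiM I (\<lambda>_. M). p (x \<circ> q) = p x"
  shows "(\<integral>\<^sup>+x. G (\<lambda>j\<in>I. x (q j)) * p x \<partial>PiM I (\<lambda>_. M)) = (\<integral>\<^sup>+x. G x * p x \<partial>PiM I (\<lambda>_. M))"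
proof -
  have "(\<integral>\<^sup>+x. G (x \<circ> q) * p (x \<circ> q) \<partial>PiM I (\<lambda>_. M)) = (\<integral>\<^sup>+x. G x * p x \<partial>PiM I (\<lambda>_. M))"
    using nn_integral_pow_measure_permute[OF _ q, of "\<lambda>x. G x * p x"]
    unfolding pow_measure_def nn_integral_completion by (simp add: measurable_completion)
  moreover have "(\<integral>\<^sup>+x. G (x \<circ> q) * p (x \<circ> q) \<partial>PiM I (\<lambda>_. M)) = (\<integral>\<^sup>+x. G (\<lambda>j\<in>I. x (q j)) * p x \<partial>PiM I (\<lambda>_. M))"
  proof (rule nn_integral_cong_AE)
    show "AE x in PiM I (\<lambda>_. M). G (x \<circ> q) * p (x \<circ> q) = G (\<lambda>j\<in>I. x (q j)) * p x"
      using sym AE_space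
    proof eventually_elim
      case (elim x)
      have "x \<circ> q = (\<lambda>j\<in>I. x (q j))"
        using elim(2) permutes_not_in[OF q(1)] by (auto simp: space_PiM PiE_iff extensional_def restrict_def)
      then show ?case using elim(1) by simp
    qed
  qed
  ultimately show ?thesis by simp
qed

text \<open>After freezing, \<open>G\<close> no longer depends on the last variable, so
  \<open>p\<close> can be integrated over it, giving its reduction. By \<open>dom\<close>, \<gamma>
  times this reduction is at most \<open>p (y(n := t))\<close>, and the integral of
  \<open>G (y(n := t)) * p (y(n := t))\<close> over \<open>y\<close> is finite for a.e.
  \<open>t\<close> by Fubini. Since \<gamma> is positive, it can be cancelled.\<close>

lemma decouple_last:
  fixes G p :: "(nat \<Rightarrow> 'a) \<Rightarrow> ennreal"
  assumes [measurable]: "G \<in> borel_measurable (PiM {..<Suc n} (\<lambda>_. M))" "p \<in> borel_measurable (PiM {..<Suc n} (\<lambda>_. M))"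
    and dom: "AE t in M. t \<in> B \<longrightarrow> (\<exists>\<gamma>::real. \<gamma> > 0 \<and>
      (AE y in PiM {..<n} (\<lambda>_. M). ennreal \<gamma> * (\<integral>\<^sup>+s. p (y(n := s)) \<partial>M) \<le> p (y(n := t))))"
    and fin: "(\<integral>\<^sup>+y. G y * p y \<partial>PiM {..<Suc n} (\<lambda>_. M)) < \<infinity>"
  shows "AE t in M. t \<in> B \<longrightarrow> (\<integral>\<^sup>+y. G (y(n := t)) * p y \<partial>PiM {..<Suc n} (\<lambda>_. M)) < \<infinity>"
proof -
  interpret product_sigma_finite "\<lambda>_::nat. M" by (rule product_sigma_finite_const)
  interpret I: sigma_finite_measure "PiM {..<n} (\<lambda>_::nat. M)" by (rule sigma_finite_PiM_const) simp
  have ins: "{..<Suc n} = insert n {..<n}" by auto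
  note [measurable] = assms(1,2)[unfolded ins]
  have "(\<integral>\<^sup>+t. \<integral>\<^sup>+y. G (y(n := t)) * p (y(n := t)) \<partial>PiM {..<n} (\<lambda>_. M) \<partial>M) = (\<integral>\<^sup>+y. G y * p y \<partial>PiM {..<Suc n} (\<lambda>_. M))"
    unfolding ins by (rule product_nn_integral_insert_rev[symmetric]) auto
  then have "AE t in M. (\<integral>\<^sup>+y. G (y(n := t)) * p (y(n := t)) \<partial>PiM {..<n} (\<lambda>_. M)) \<noteq> \<infinity>"
    using fin by (intro nn_integral_PInf_AE) auto
  with dom AE_space show ?thesis
  proof eventually_elim
    case (elim t)
    note t[measurable] = \<open>t \<in> space M\<close>
    show ?case
    proof
      assume "t \<in> B"
      then obtain \<gamma> :: real where g: "\<gamma> > 0"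
        "AE y in PiM {..<n} (\<lambda>_. M). ennreal \<gamma> * (\<integral>\<^sup>+s. p (y(n := s)) \<partial>M) \<le> p (y(n := t))"
        using elim by auto
      have [measurable]: "(\<lambda>y. G (y(n := t))) \<in> borel_measurable (PiM (insert n {..<n}) (\<lambda>_. M))"
        by (rule measurable_compose[OF measurable_fun_upd_const]) (use t in auto)
      have "(\<integral>\<^sup>+y. G (y(n := t)) * p y \<partial>PiM {..<Suc n} (\<lambda>_. M)) =
          (\<integral>\<^sup>+y. \<integral>\<^sup>+s. G (y(n := t)) * p (y(n := s)) \<partial>M \<partial>PiM {..<n} (\<lambda>_. M))"
        unfolding ins by (subst product_nn_integral_insert) auto
      also have "\<dots> = (\<integral>\<^sup>+y. G (y(n := t)) * (\<integral>\<^sup>+s. p (y(n := s)) \<partial>M) \<partial>PiM {..<n} (\<lambda>_. M))"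
        by (intro nn_integral_cong nn_integral_cmult) measurable
      finally have "ennreal \<gamma> * (\<integral>\<^sup>+y. G (y(n := t)) * p y \<partial>PiM {..<Suc n} (\<lambda>_. M)) =
          (\<integral>\<^sup>+y. ennreal \<gamma> * (G (y(n := t)) * (\<integral>\<^sup>+s. p (y(n := s)) \<partial>M)) \<partial>PiM {..<n} (\<lambda>_. M))"
        by (simp add: nn_integral_cmult)
      also have "\<dots> \<le> (\<integral>\<^sup>+y. G (y(n := t)) * p (y(n := t)) \<partial>PiM {..<n} (\<lambda>_. M))"
      proof (rule nn_integral_mono_AE)
        show "AE y in PiM {..<n} (\<lambda>_. M). ennreal \<gamma> * (G (y(n := t)) * (\<integral>\<^sup>+s. p (y(n := s)) \<partial>M)) \<le> G (y(n := t)) * p (y(n := t))"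
          using g(2)
        proof eventually_elim
          case (elim y)
          from mult_left_mono[OF this, of "G (y(n := t))"] show ?case by (simp add: ac_simps)
        qed
      qed
      also have "\<dots> < \<infinity>" using elim by (simp add: less_top)
      finally show "(\<integral>\<^sup>+y. G (y(n := t)) * p y \<partial>PiM {..<Suc n} (\<lambda>_. M)) < \<infinity>"
        using g(1) by (auto simp: ennreal_mult_less_top)
    qed
  qed
qed

text \<open>Conjugate \<open>decouple_last\<close> with the transposition of \<open>i\<close> and
  \<open>n\<close>; the weight does not see the transposition because it is symmetric.\<close>

lemma decouple_at:
  fixes G p :: "(nat \<Rightarrow> 'a) \<Rightarrow> ennreal"
  assumes [measurable]: "G \<in> borel_measurable (PiM {..<Suc n} (\<lambda>_. M))" "p \<in> borel_measurable (PiM {..<Suc n} (\<lambda>_. M))"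
    and sym: "\<And>q. q permutes {..<Suc n} \<Longrightarrow> AE x in PiM {..<Suc n} (\<lambda>_. M). p (x \<circ> q) = p x"
    and dom: "AE t in M. t \<in> B \<longrightarrow> (\<exists>\<gamma>::real. \<gamma> > 0 \<and>
      (AE y in PiM {..<n} (\<lambda>_. M). ennreal \<gamma> * (\<integral>\<^sup>+s. p (y(n := s)) \<partial>M) \<le> p (y(n := t))))"
    and fin: "(\<integral>\<^sup>+y. G y * p y \<partial>PiM {..<Suc n} (\<lambda>_. M)) < \<infinity>"
    and i: "i < Suc n"
  shows "AE t in M. t \<in> B \<longrightarrow> (\<integral>\<^sup>+y. G (y(i := t)) * p y \<partial>PiM {..<Suc n} (\<lambda>_. M)) < \<infinity>"
proof -
  let ?A = "PiM {..<Suc n} (\<lambda>_. M)"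
  define q where "q = Transposition.transpose i n"
  have q: "q permutes {..<Suc n}" unfolding q_def using i by (intro permutes_swap_id) auto
  have qi: "q i = n" "q n = i" "q (q j) = j" for j by (auto simp: q_def)
  have qj: "q j \<noteq> n" if "j \<noteq> i" for j using that by (metis qi)
  have qlt: "q ` {..<Suc n} \<subseteq> {..<Suc n}" using permutes_image[OF q] by simp
  have [measurable]: "(\<lambda>x. \<lambda>j\<in>{..<Suc n}. x (q j)) \<in> ?A \<rightarrow>\<^sub>M ?A"
    by (rule measurable_reindex[OF qlt])
  have "(\<integral>\<^sup>+y. G (\<lambda>j\<in>{..<Suc n}. y (q j)) * p y \<partial>?A) < \<infinity>"
    using fin nn_integral_PiM_permute_weight[of G _ p, OF _ _ q _ sym[OF q]] by simp
  then have "AE t in M. t \<in> B \<longrightarrow> (\<integral>\<^sup>+y. G (\<lambda>j\<in>{..<Suc n}. (y(n := t)) (q j)) * p y \<partial>?A) < \<infinity>"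
    by (intro decouple_last[where G = "\<lambda>y. G (\<lambda>j\<in>{..<Suc n}. y (q j))"] dom) auto
  with AE_space show ?thesis
  proof eventually_elim
    case (elim t)
    note [measurable] = \<open>t \<in> space M\<close>
    have [measurable]: "(\<lambda>y. G (y(i := t))) \<in> borel_measurable ?A"
      by (rule measurable_compose[OF measurable_fun_upd_const]) (use i \<open>t \<in> space M\<close> in auto)
    have "(\<lambda>j\<in>{..<Suc n}. (y(n := t)) (q j)) = (\<lambda>j\<in>{..<Suc n}. y (q j))(i := t)" for y
      using qi qj i by (auto simp: restrict_def fun_eq_iff)
    then have "(\<integral>\<^sup>+y. G (\<lambda>j\<in>{..<Suc n}. (y(n := t)) (q j)) * p y \<partial>?A) = (\<integral>\<^sup>+y. G (y(i := t)) * p y \<partial>?A)"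
      using nn_integral_PiM_permute_weight[of "\<lambda>y. G (y(i := t))" _ p, OF _ _ q _ sym[OF q]] by simp
    then show ?case using elim by simp
  qed
qed

text \<open>Freeze one variable after another: once the coordinates in \<open>D\<close> are fixed at
  good values \<open>b\<close>, the resulting function of \<open>y\<close> is again integrable
  against the same weight \<open>p\<close>, so \<open>decouple_at\<close> applies to it.\<close>

lemma decouple_set:
  fixes G p :: "(nat \<Rightarrow> 'a) \<Rightarrow> ennreal"
  assumes [measurable]: "G \<in> borel_measurable (PiM {..<Suc n} (\<lambda>_. M))" "p \<in> borel_measurable (PiM {..<Suc n} (\<lambda>_. M))"
    and sym: "\<And>q. q permutes {..<Suc n} \<Longrightarrow> AE x in PiM {..<Suc n} (\<lambda>_. M). p (x \<circ> q) = p x"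
    and dom: "AE t in M. t \<in> B \<longrightarrow> (\<exists>\<gamma>::real. \<gamma> > 0 \<and>
      (AE y in PiM {..<n} (\<lambda>_. M). ennreal \<gamma> * (\<integral>\<^sup>+s. p (y(n := s)) \<partial>M) \<le> p (y(n := t))))"
    and fin: "(\<integral>\<^sup>+y. G y * p y \<partial>PiM {..<Suc n} (\<lambda>_. M)) < \<infinity>"
    and [measurable]: "B \<in> sets M"
    and "finite D" "D \<subseteq> {..<Suc n}"
  shows "AE b in PiM D (\<lambda>_. M). (\<forall>i\<in>D. b i \<in> B) \<longrightarrow>
    (\<integral>\<^sup>+y. G (\<lambda>j\<in>{..<Suc n}. if j \<in> D then b j else y j) * p y \<partial>PiM {..<Suc n} (\<lambda>_. M)) < \<infinity>"
  using assms(7,8)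
proof (induction D rule: finite_induct)
  case empty
  have "(\<integral>\<^sup>+y. G (restrict y {..<Suc n}) * p y \<partial>PiM {..<Suc n} (\<lambda>_. M)) =
      (\<integral>\<^sup>+y. G y * p y \<partial>PiM {..<Suc n} (\<lambda>_. M))"
    by (intro nn_integral_cong) (auto simp: space_PiM PiE_def extensional_restrict)
  then show ?case using fin by (simp add: restrict_def)
next
  case (insert i D)
  interpret product_sigma_finite "\<lambda>_::nat. M" by (rule product_sigma_finite_const)
  let ?A = "PiM {..<Suc n} (\<lambda>_. M)"
  interpret A: sigma_finite_measure ?A by (rule sigma_finite_PiM_const) simp
  have msub: "(\<lambda>z. \<lambda>j\<in>{..<Suc n}. if j \<in> D' then fst z j else snd z j) \<in> PiM D' (\<lambda>_. M) \<Otimes>\<^sub>M ?A \<rightarrow>\<^sub>M ?A" for D'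
  proof (rule measurable_restrict)
    fix j assume "j \<in> {..<Suc n}"
    then show "(\<lambda>z. if j \<in> D' then fst z j else snd z j) \<in> PiM D' (\<lambda>_. M) \<Otimes>\<^sub>M ?A \<rightarrow>\<^sub>M M"
      by (cases "j \<in> D'") (auto intro!: measurable_compose[OF measurable_fst measurable_component_singleton]
        measurable_compose[OF measurable_snd measurable_component_singleton])
  qed
  define P where "P b \<longleftrightarrow> (\<forall>i\<in>insert i D. b i \<in> B) \<longrightarrow>
    (\<integral>\<^sup>+y. G (\<lambda>j\<in>{..<Suc n}. if j \<in> insert i D then b j else y j) * p y \<partial>?A) < \<infinity>" for b
  have [measurable]: "(\<lambda>z. G (\<lambda>j\<in>{..<Suc n}. if j \<in> insert i D then fst z j else snd z j)) \<in> borel_measurable (PiM (insert i D) (\<lambda>_. M) \<Otimes>\<^sub>M ?A)"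
    by (rule measurable_compose[OF msub assms(1)])
  have "(\<lambda>(b, y). G (\<lambda>j\<in>{..<Suc n}. if j \<in> insert i D then b j else y j) * p y) \<in> borel_measurable (PiM (insert i D) (\<lambda>_. M) \<Otimes>\<^sub>M ?A)"
    unfolding split_beta' by measurable
  then have [measurable]: "(\<lambda>b. \<integral>\<^sup>+y. G (\<lambda>j\<in>{..<Suc n}. if j \<in> insert i D then b j else y j) * p y \<partial>?A) \<in> borel_measurable (PiM (insert i D) (\<lambda>_. M))"
    by (rule A.borel_measurable_nn_integral)
  have fD: "finite (insert i D)" using insert by simp
  \<comment> \<open>Measurability of the finiteness condition is what allows the passage from an
    iterated to a joint a.e. statement.\<close>
  have [measurable]: "Measurable.pred (PiM (insert i D) (\<lambda>_. M)) P"
    unfolding P_def using fD by measurable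
  have "AE b in PiM D (\<lambda>_. M). (\<forall>i\<in>D. b i \<in> B) \<longrightarrow>
    (\<integral>\<^sup>+y. G (\<lambda>j\<in>{..<Suc n}. if j \<in> D then b j else y j) * p y \<partial>?A) < \<infinity>"
    by (rule insert.IH) (use insert.prems in auto)
  with AE_space have "AE b in PiM D (\<lambda>_. M). AE s in M. P (b(i := s))"
  proof eventually_elim
    case (elim b)
    note b = elim(1)
    show ?case
    proof (cases "\<forall>i\<in>D. b i \<in> B")
      case True
      have "(\<lambda>y. G (\<lambda>j\<in>{..<Suc n}. if j \<in> D then b j else y j)) \<in> borel_measurable ?A"
        using measurable_compose[OF measurable_Pair1'[OF b, of ?A] measurable_compose[OF msub assms(1)]]
        unfolding fst_conv snd_conv .
      then have "AE t in M. t \<in> B \<longrightarrow>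
          (\<integral>\<^sup>+y. G (\<lambda>j\<in>{..<Suc n}. if j \<in> D then b j else (y(i := t)) j) * p y \<partial>?A) < \<infinity>"
        by (rule decouple_at[OF _ assms(2) sym dom]) (use elim True insert in auto)
      then show ?thesis
      proof eventually_elim
        case (elim t)
        have "(\<lambda>j\<in>{..<Suc n}. if j \<in> D then b j else (y(i := t)) j) =
          (\<lambda>j\<in>{..<Suc n}. if j \<in> insert i D then (b(i := t)) j else y j)" for y
          using insert by (auto simp: restrict_def fun_eq_iff)
        then show ?case using elim by (simp add: P_def)
      qed
    next
      case False
      then have "P (b(i := s))" for s using insert unfolding P_def by (metis fun_upd_other insertCI)
      then show ?thesis by simp
    qed
  qed
  \<comment> \<open>Iterated to joint: the exceptional set has null sections for a.e.
    \<open>b\<close>, hence measure zero by Tonelli.\<close>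
  then have "(\<integral>\<^sup>+b. (\<integral>\<^sup>+s. indicator {b \<in> space (PiM (insert i D) (\<lambda>_. M)). \<not> P b} (b(i := s)) \<partial>M) \<partial>PiM D (\<lambda>_. M)) = (\<integral>\<^sup>+b. 0 \<partial>PiM D (\<lambda>_. M))"
  proof (intro nn_integral_cong_AE, eventually_elim)
    case (elim b)
    from elim(2) have "AE s in M. indicator {b \<in> space (PiM (insert i D) (\<lambda>_. M)). \<not> P b} (b(i := s)) = (0::ennreal)"
      by eventually_elim simp
    from nn_integral_cong_AE[OF this] show ?case by simp
  qed
  moreover have "(\<integral>\<^sup>+b. indicator {b \<in> space (PiM (insert i D) (\<lambda>_. M)). \<not> P b} b \<partial>PiM (insert i D) (\<lambda>_. M)) =
    (\<integral>\<^sup>+b. (\<integral>\<^sup>+s. indicator {b \<in> space (PiM (insert i D) (\<lambda>_. M)). \<not> P b} (b(i := s)) \<partial>M) \<partial>PiM D (\<lambda>_. M))"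
    using insert by (intro product_nn_integral_insert) auto
  ultimately have "emeasure (PiM (insert i D) (\<lambda>_. M)) {b \<in> space (PiM (insert i D) (\<lambda>_. M)). \<not> P b} = 0"
    by simp
  then have "AE b in PiM (insert i D) (\<lambda>_. M). P b"
    by (intro AE_I'[of "{b \<in> space (PiM (insert i D) (\<lambda>_. M)). \<not> P b}"]) (auto simp: null_sets_def)
  then show ?case unfolding P_def .
qed

section \<open>Extracting the potential by linearity\<close>

lemma measurable_body_sum:
  assumes "u \<in> borel_measurable (PiM {..<m} (\<lambda>_. M))"
  shows "body_sum N m u \<in> borel_measurable (PiM {..<N} (\<lambda>_. M))"
proof -
  have "(\<lambda>x. u (\<lambda>j\<in>{..<m}. x (i j))) \<in> borel_measurable (PiM {..<N} (\<lambda>_. M))"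
    if "i \<in> {..<m} \<rightarrow>\<^sub>E {..<N}" for i
    using that by (intro measurable_compose[OF measurable_reindex assms]) auto
  then show ?thesis
    unfolding body_sum_def[abs_def] by (intro borel_measurable_sum) auto
qed

text \<open>\<open>subset_sum_extract\<close> for \<open>m + N\<close> points, whose
  \<open>m\<close>-subset of interest consists of the first \<open>m\<close>. The points and the
  potential may both depend on the parameter \<open>y\<close>: frozen variables use the first
  freedom, sequences of potentials the second.\<close>

lemma body_sum_extract:
  fixes z :: "'y \<Rightarrow> nat \<Rightarrow> 'b" and u :: "'y \<Rightarrow> (nat \<Rightarrow> 'b) \<Rightarrow> real"
  assumes lin: "\<And>a b g h. L g \<Longrightarrow> L h \<Longrightarrow> L (\<lambda>y. a * g y + b * h y)"
    and "m \<le> N"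
    and sums: "\<And>e. e \<in> {..<N} \<rightarrow>\<^sub>E {..<m + N} \<Longrightarrow> inj_on e {..<N} \<Longrightarrow>
      L (\<lambda>y. body_sum N m (u y) (\<lambda>j\<in>{..<N}. z y (e j)))"
  shows "L (\<lambda>y. u y (restrict (z y) {..<m}))"
proof -
  have "L (\<lambda>y. u y (\<lambda>j\<in>{..<m}. z y (enum_set m {..<m} j)))"
  proof (rule subset_sum_extract[where L = L and X = "{..<m + N}" and k = m and n = N
        and f = "\<lambda>K y. u y (\<lambda>j\<in>{..<m}. z y (enum_set m K j))", OF lin])
    fix T assume T: "T \<subseteq> {..<m + N}" "card T = N"
    then have fT: "finite T" using finite_subset by blast
    note eT = enum_set[OF fT T(2)]
    have "L (\<lambda>y. body_sum N m (u y) (\<lambda>j\<in>{..<N}. z y (enum_set N T j)))"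
      using eT T(1) by (intro sums) (auto simp: bij_betw_def PiE_iff)
    then show "L (\<lambda>y. \<Sum>K | K \<subseteq> T \<and> card K = m. u y (\<lambda>j\<in>{..<m}. z y (enum_set m K j)))"
      by (simp only: body_sum_enum_set[OF fT T(2)])
  qed (use \<open>m \<le> N\<close> in auto)
  moreover have "(\<lambda>j\<in>{..<m}. z y (enum_set m {..<m} j)) = restrict (z y) {..<m}" for y
    by (auto simp: enum_set_lessThan)
  ultimately show ?thesis by simp
qed

text \<open>Of the \<open>m + N\<close> points \<open>z b y\<close>, the first \<open>m\<close> are
  variables and the other \<open>N\<close> are frozen at values \<open>b\<close> in
  \<open>B\<close>. For almost all such \<open>b\<close> every body sum of \<open>N\<close> of these
  points is integrable against \<open>p\<close>; one such \<open>b\<close> is fixed and the linear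
  extraction is applied to the property of being integrable against \<open>p\<close>.\<close>

lemma potential_integrable_of_body_sum:
  fixes p :: "(nat \<Rightarrow> 'a) \<Rightarrow> ennreal"
  assumes u: "u \<in> borel_measurable (PiM {..<m} (\<lambda>_. M))"
    and p[measurable]: "p \<in> borel_measurable (PiM {..<Suc n} (\<lambda>_. M))"
    and sym: "\<And>q. q permutes {..<Suc n} \<Longrightarrow> AE x in PiM {..<Suc n} (\<lambda>_. M). p (x \<circ> q) = p x"
    and dom: "AE t in M. t \<in> B \<longrightarrow> (\<exists>\<gamma>::real. \<gamma> > 0 \<and>
      (AE y in PiM {..<n} (\<lambda>_. M). ennreal \<gamma> * (\<integral>\<^sup>+s. p (y(n := s)) \<partial>M) \<le> p (y(n := t))))"
    and fin: "(\<integral>\<^sup>+y. ennreal \<bar>body_sum (Suc n) m u y\<bar> * p y \<partial>PiM {..<Suc n} (\<lambda>_. M)) < \<infinity>"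
    and B: "B \<in> sets M" "emeasure M B > 0"
    and mn: "m \<le> Suc n"
  shows "(\<integral>\<^sup>+y. ennreal \<bar>u (restrict y {..<m})\<bar> * p y \<partial>PiM {..<Suc n} (\<lambda>_. M)) < \<infinity>"
proof -
  interpret product_sigma_finite "\<lambda>_::nat. M" by (rule product_sigma_finite_const)
  define N where "N = Suc n"
  let ?A = "PiM {..<N} (\<lambda>_. M)"
  let ?b = "PiM {m..<m + N} (\<lambda>_. M)"
  define z where "z b y k = (if k < m then y k else b k)" for b y :: "nat \<Rightarrow> 'a" and k
  define E where "E = {e \<in> {..<N} \<rightarrow>\<^sub>E {..<m + N}. inj_on e {..<N}}"
  note mbs[measurable] = measurable_body_sum[OF u, of N]
  note [measurable] = p[folded N_def]
  define F where "F e b y = body_sum N m u (\<lambda>j\<in>{..<N}. z b y (e j))" for e b y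
  have "AE b in ?b. \<forall>e\<in>E. (\<forall>i\<in>{m..<m + N}. b i \<in> B) \<longrightarrow>
      (\<integral>\<^sup>+y. ennreal \<bar>F e b y\<bar> * p y \<partial>?A) < \<infinity>"
  proof (rule AE_finite_allI)
    show "finite E" unfolding E_def
      by (rule finite_subset[of _ "{..<N} \<rightarrow>\<^sub>E {..<m + N}"]) (auto intro: finite_PiE)
    fix e assume e: "e \<in> E"
    \<comment> \<open>Places in \<open>J\<close> read a variable, the others a frozen value. The
      permutation \<open>q\<close> lets each place of \<open>J\<close> read its own variable
      \<open>y (e j)\<close>, using that these indices are below \<open>m\<close> and hence below
      \<open>N\<close>. The remaining places read the coordinates in \<open>D\<close>, which are
      then overwritten by frozen values.\<close>
    define J where "J = {j \<in> {..<N}. e j < m}"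
    have eJ: "inj_on e J" "J \<subseteq> {..<N}" "e ` J \<subseteq> {..<N}"
      using e mn by (auto simp: E_def J_def N_def inj_on_def)
    obtain q where q: "q permutes {..<N}" and qe: "\<And>j. j \<in> J \<Longrightarrow> q j = e j"
      by (rule permutes_extend[OF eJ finite_lessThan]) blast
    define D where "D = q ` ({..<N} - J)"
    have qD: "q j \<in> D \<longleftrightarrow> j \<notin> J" "q j < N" if "j < N" for j
      using that permutes_inj[OF q] permutes_in_image[OF q, of j] by (auto simp: D_def inj_def)
    have iq: "inv q (q j) = j" for j using permutes_inverses(2)[OF q] .
    have D: "D \<subseteq> {..<N}" using permutes_in_image[OF q] by (auto simp: D_def)
    define G where "G y = ennreal \<bar>body_sum N m u (\<lambda>j\<in>{..<N}. y (q j))\<bar>" for y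
    have [measurable]: "(\<lambda>y. \<lambda>j\<in>{..<N}. y (q j)) \<in> ?A \<rightarrow>\<^sub>M ?A"
      using permutes_image[OF q] by (intro measurable_reindex) auto
    have Gm: "G \<in> borel_measurable ?A" unfolding G_def by measurable
    have "(\<integral>\<^sup>+y. G y * p y \<partial>?A) < \<infinity>"
      unfolding G_def using fin nn_integral_PiM_permute_weight[of "\<lambda>y. ennreal \<bar>body_sum N m u y\<bar>" _ p, OF _ _ q _ sym[folded N_def, OF q]]
      by (simp add: N_def[symmetric])
    then have "AE b in PiM D (\<lambda>_. M). (\<forall>i\<in>D. b i \<in> B) \<longrightarrow>
        (\<integral>\<^sup>+y. G (\<lambda>j\<in>{..<N}. if j \<in> D then b j else y j) * p y \<partial>?A) < \<infinity>"
      using Gm D finite_subset[OF D] unfolding N_def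
      by (intro decouple_set[OF _ p sym dom _ B(1)]) auto
    then have "AE b in ?b. (\<forall>i\<in>D. (\<lambda>i\<in>D. b ((e \<circ> inv q) i)) i \<in> B) \<longrightarrow>
        (\<integral>\<^sup>+y. G (\<lambda>j\<in>{..<N}. if j \<in> D then (\<lambda>i\<in>D. b ((e \<circ> inv q) i)) j else y j) * p y \<partial>?A) < \<infinity>"
    proof (rule AE_PiM_reindex)
      show "inj_on (e \<circ> inv q) D" using e by (auto simp: D_def E_def inj_on_def iq)
      show "(e \<circ> inv q) ` D \<subseteq> {m..<m + N}" using e by (auto simp: D_def E_def iq J_def PiE_iff)
    qed simp
    then show "AE b in ?b. (\<forall>i\<in>{m..<m + N}. b i \<in> B) \<longrightarrow> (\<integral>\<^sup>+y. ennreal \<bar>F e b y\<bar> * p y \<partial>?A) < \<infinity>"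
    proof eventually_elim
      case (elim b)
      have "G (\<lambda>j\<in>{..<N}. if j \<in> D then (\<lambda>i\<in>D. b ((e \<circ> inv q) i)) j else y j) = ennreal \<bar>F e b y\<bar>" for y
      proof -
        have "(\<lambda>j\<in>{..<N}. (\<lambda>j\<in>{..<N}. if j \<in> D then (\<lambda>i\<in>D. b ((e \<circ> inv q) i)) j else y j) (q j)) =
            (\<lambda>j\<in>{..<N}. z b y (e j))"
        proof (rule restrict_ext)
          fix j assume "j \<in> {..<N}"
          then show "(\<lambda>j\<in>{..<N}. if j \<in> D then (\<lambda>i\<in>D. b ((e \<circ> inv q) i)) j else y j) (q j) = z b y (e j)"
            using qD[of j] qe[of j] iq by (auto simp: z_def J_def)
        qed
        then show ?thesis by (simp add: G_def F_def)
      qed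
      moreover have "\<forall>i\<in>D. (\<lambda>i\<in>D. b ((e \<circ> inv q) i)) i \<in> B" if "\<forall>i\<in>{m..<m + N}. b i \<in> B"
        using that e by (auto simp: D_def E_def iq J_def PiE_iff)
      ultimately show ?case using elim by simp
    qed
  qed
  note fb = this
  \<comment> \<open>The product of \<open>N\<close> copies of \<open>B\<close> has positive measure,
    so a tuple with entries in \<open>B\<close> that is good for all the finitely many
    \<open>e\<close> exists.\<close>
  have nonnull: "\<not> (AE b in ?b. b \<notin> Pi\<^sub>E {m..<m + N} (\<lambda>_. B))"
  proof
    assume *: "AE b in ?b. b \<notin> Pi\<^sub>E {m..<m + N} (\<lambda>_. B)"
    have "Pi\<^sub>E {m..<m + N} (\<lambda>_. B) \<in> sets ?b" using B by (intro sets_PiM_I_finite) auto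
    with * have "emeasure ?b (Pi\<^sub>E {m..<m + N} (\<lambda>_. B)) = 0"
      using AE_iff_null_sets by blast
    then show False using B by (simp add: emeasure_PiM)
  qed
  obtain b where b: "b \<in> Pi\<^sub>E {m..<m + N} (\<lambda>_. B)"
    and fb: "\<And>e. e \<in> E \<Longrightarrow> (\<integral>\<^sup>+y. ennreal \<bar>F e b y\<bar> * p y \<partial>?A) < \<infinity>"
  proof (rule ccontr)
    assume n: "\<not> thesis"
    from fb have "AE b in ?b. b \<notin> Pi\<^sub>E {m..<m + N} (\<lambda>_. B)"
    proof eventually_elim
      case (elim b)
      show ?case
      proof
        assume b: "b \<in> Pi\<^sub>E {m..<m + N} (\<lambda>_. B)"
        then have "\<forall>i\<in>{m..<m + N}. b i \<in> B" by (auto simp: PiE_iff)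
        with elim that[OF b] n show False by blast
      qed
    qed
    with nonnull show False by contradiction
  qed
  define L where "L g \<longleftrightarrow> g \<in> borel_measurable ?A \<and> (\<integral>\<^sup>+y. ennreal \<bar>g y\<bar> * p y \<partial>?A) < \<infinity>" for g :: "(nat \<Rightarrow> 'a) \<Rightarrow> real"
  have "L (\<lambda>y. u (restrict (z b y) {..<m}))"
  proof (rule body_sum_extract[where L = L and N = N])
    show "m \<le> N" using mn by (simp add: N_def)
    fix a c g h assume "L g" "L h"
    then have [measurable]: "g \<in> borel_measurable ?A" "h \<in> borel_measurable ?A"
      and f: "(\<integral>\<^sup>+y. ennreal \<bar>g y\<bar> * p y \<partial>?A) < \<infinity>" "(\<integral>\<^sup>+y. ennreal \<bar>h y\<bar> * p y \<partial>?A) < \<infinity>"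
      by (auto simp: L_def)
    have "(\<integral>\<^sup>+y. ennreal \<bar>a * g y + c * h y\<bar> * p y \<partial>?A) \<le>
        (\<integral>\<^sup>+y. ennreal \<bar>a\<bar> * (ennreal \<bar>g y\<bar> * p y) + ennreal \<bar>c\<bar> * (ennreal \<bar>h y\<bar> * p y) \<partial>?A)"
    proof (rule nn_integral_mono)
      fix y
      have "ennreal \<bar>a * g y + c * h y\<bar> \<le> ennreal (\<bar>a\<bar> * \<bar>g y\<bar> + \<bar>c\<bar> * \<bar>h y\<bar>)"
        by (intro ennreal_leI) (metis abs_mult abs_triangle_ineq)
      also have "\<dots> = ennreal \<bar>a\<bar> * ennreal \<bar>g y\<bar> + ennreal \<bar>c\<bar> * ennreal \<bar>h y\<bar>"
        by (simp add: ennreal_mult)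
      finally show "ennreal \<bar>a * g y + c * h y\<bar> * p y \<le>
          ennreal \<bar>a\<bar> * (ennreal \<bar>g y\<bar> * p y) + ennreal \<bar>c\<bar> * (ennreal \<bar>h y\<bar> * p y)"
        using mult_right_mono[of _ _ "p y"] by (fastforce simp: distrib_right mult.assoc)
    qed
    also have "\<dots> < \<infinity>"
      using f by (subst nn_integral_add) (auto simp: nn_integral_cmult ennreal_mult_less_top)
    finally show "L (\<lambda>y. a * g y + c * h y)" by (simp add: L_def)
  next
    fix e assume e: "e \<in> {..<N} \<rightarrow>\<^sub>E {..<m + N}" "inj_on e {..<N}"
    then have "e \<in> E" by (simp add: E_def)
    moreover have "(\<lambda>y. \<lambda>j\<in>{..<N}. z b y (e j)) \<in> ?A \<rightarrow>\<^sub>M ?A"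
    proof (rule measurable_restrict)
      fix j assume j: "j \<in> {..<N}"
      show "(\<lambda>y. z b y (e j)) \<in> ?A \<rightarrow>\<^sub>M M"
      proof (cases "e j < m")
        case True
        then have "e j \<in> {..<N}" using mn by (simp add: N_def)
        from measurable_component_singleton[OF this] show ?thesis using True by (simp add: z_def)
      next
        case False
        then have "b (e j) \<in> space M"
          using b e(1) j sets.sets_into_space[OF B(1)] by (auto simp: PiE_iff)
        then show ?thesis using False by (simp add: z_def)
      qed
    qed
    then have "F e b \<in> borel_measurable ?A"
      unfolding F_def[abs_def] by (rule measurable_compose[OF _ mbs])
    ultimately show "L (\<lambda>y. body_sum N m u (\<lambda>j\<in>{..<N}. z b y (e j)))"
      using fb[of e] by (simp add: L_def F_def[abs_def])
  qed
  moreover have "restrict (z b y) {..<m} = restrict y {..<m}" for y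
    by (auto simp: z_def restrict_def)
  ultimately show ?thesis by (simp add: L_def N_def)
qed

lemma AE_restrict_lessThan:
  fixes m N :: nat
  assumes "AE z in PiM {..<m + N} (\<lambda>_. M). Q (restrict z {..<m})" "emeasure M (space M) \<noteq> 0"
  shows "AE x in PiM {..<m} (\<lambda>_. M). Q x"
proof -
  have eq: "{..<m + N} = {..<m} \<union> {m..<m + N}" by auto
  show ?thesis
    using assms(2) assms(1)[unfolded eq] AE_PiM_restrict[where I = "{..<m}" and J = "{m..<m + N}" and Q = Q] by (simp add: ivl_disj_int)
qed

lemma AE_body_sum_reindex:
  fixes N K :: nat
  assumes "AE x in PiM {..<N} (\<lambda>_. M). Q x" "e \<in> {..<N} \<rightarrow>\<^sub>E {..<K}" "inj_on e {..<N}"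
  shows "AE z in PiM {..<K} (\<lambda>_. M). Q (\<lambda>j\<in>{..<N}. z (e j))"
  by (rule AE_PiM_reindex[OF assms(1) _ assms(3)]) (use assms(2) in auto)

lemma potential_AE_const:
  assumes "AE x in PiM {..<N} (\<lambda>_. M). body_sum N m u x = c" "m \<le> N" "emeasure M (space M) \<noteq> 0"
  shows "\<exists>c. AE x in PiM {..<m} (\<lambda>_. M). u x = c"
proof -
  define L where "L g \<longleftrightarrow> (\<exists>c. AE z in PiM {..<m + N} (\<lambda>_. M). g z = c)" for g :: "(nat \<Rightarrow> 'a) \<Rightarrow> real"
  have "L (\<lambda>z. u (restrict z {..<m}))"
  proof (rule body_sum_extract[where L = L and N = N and z = "\<lambda>z. z" and u = "\<lambda>_. u"])
    fix a b g h assume "L g" "L h"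
    then obtain c d where "AE z in PiM {..<m + N} (\<lambda>_. M). g z = c" "AE z in PiM {..<m + N} (\<lambda>_. M). h z = d"
      by (auto simp: L_def)
    then have "AE z in PiM {..<m + N} (\<lambda>_. M). a * g z + b * h z = a * c + b * d"
      by eventually_elim simp
    then show "L (\<lambda>y. a * g y + b * h y)" by (auto simp: L_def)
  next
    fix e assume "e \<in> {..<N} \<rightarrow>\<^sub>E {..<m + N}" "inj_on e {..<N}"
    from AE_body_sum_reindex[OF assms(1) this]
    show "L (\<lambda>z. body_sum N m u (\<lambda>j\<in>{..<N}. z (e j)))" by (auto simp: L_def)
  qed fact
  then obtain c where "AE z in PiM {..<m + N} (\<lambda>_. M). u (restrict z {..<m}) = c"
    by (auto simp: L_def)
  from AE_restrict_lessThan[OF this assms(3)] show ?thesis by blast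
qed

lemma potential_AE_convergent:
  fixes u :: "nat \<Rightarrow> (nat \<Rightarrow> 'a) \<Rightarrow> real"
  assumes "AE x in PiM {..<N} (\<lambda>_. M). convergent (\<lambda>k. body_sum N m (u k) x)" "m \<le> N" "emeasure M (space M) \<noteq> 0"
  shows "AE x in PiM {..<m} (\<lambda>_. M). convergent (\<lambda>k. u k x)"
proof -
  \<comment> \<open>The sequence index is made part of the argument, since \<open>body_sum_extract\<close> is about a single function.\<close>
  define L where "L g \<longleftrightarrow> (AE z in PiM {..<m + N} (\<lambda>_. M). convergent (\<lambda>k. g (z, k)))" for g :: "(nat \<Rightarrow> 'a) \<times> nat \<Rightarrow> real"
  have "L (\<lambda>y. u (snd y) (restrict (fst y) {..<m}))"
  proof (rule body_sum_extract[where L = L and N = N and z = fst and u = "\<lambda>y. u (snd y)"])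
    fix a b g h assume "L g" "L h"
    then show "L (\<lambda>y. a * g y + b * h y)"
      unfolding L_def by eventually_elim (intro convergent_add convergent_mult convergent_const)
  next
    fix e assume "e \<in> {..<N} \<rightarrow>\<^sub>E {..<m + N}" "inj_on e {..<N}"
    from AE_body_sum_reindex[OF assms(1) this]
    show "L (\<lambda>y. body_sum N m (u (snd y)) (\<lambda>j\<in>{..<N}. fst y (e j)))" by (simp add: L_def)
  qed fact
  then have "AE z in PiM {..<m + N} (\<lambda>_. M). convergent (\<lambda>k. u k (restrict z {..<m}))"
    by (simp add: L_def)
  then show ?thesis by (rule AE_restrict_lessThan) fact
qed

end

section \<open>The free energy functional\<close>

text \<open>With \<open>log \<integral> e\<^sup>-\<^sup>w\<^sup>-\<^sup>V\<close> in place of \<open>\<integral> e\<^sup>-\<^sup>w\<^sup>-\<^sup>V\<close> this is the usual functional, invariant under adding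
  constants to \<open>V\<close>. As \<open>log z \<le> z - 1\<close>, the minima agree up to \<open>1\<close>, and minimizers of the present
  version are automatically normalized.\<close>

definition free_energy :: "'b measure \<Rightarrow> ('b \<Rightarrow> real) \<Rightarrow> ('b \<Rightarrow> real) \<Rightarrow> ('b \<Rightarrow> real) \<Rightarrow> real" where
  "free_energy C p w V = (\<integral>x. p x * V x + exp (- w x - V x) \<partial>C)"

definition admissible :: "'b measure \<Rightarrow> ('b \<Rightarrow> real) \<Rightarrow> ('b \<Rightarrow> real) \<Rightarrow> ('b \<Rightarrow> real) \<Rightarrow> bool" where
  "admissible C p w V \<longleftrightarrow> integrable C (\<lambda>x. p x * V x) \<and> integrable C (\<lambda>x. exp (- w x - V x))"

text \<open>With \<open>t = w + V + ln p\<close> the difference of the two sides of the first bound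
  is \<open>p * (exp (- t) - 1 + t)\<close>, which is nonnegative. The second bound amounts to
  \<open>exp (- t) + 2 * t\<close> being nonnegative, seen from the tangent of
  \<open>exp (- t)\<close> at \<open>t = - ln 2\<close>; it lets finiteness of the gap control the
  Gibbs weight alone.\<close>

lemma relative_entropy_bounds:
  fixes p w V :: real
  assumes "p > 0"
  shows "p * V + exp (- w - V) \<ge> p - p * (w + ln p)"
    and "exp (- w - V) \<le> 2 * (p * V + exp (- w - V) - (p - p * (w + ln p))) + 2 * p"
proof -
  define t where "t = w + V + ln p"
  have e: "exp (- w - V) = p * exp (- t)"
    using assms by (simp add: t_def exp_diff exp_minus exp_add field_simps)
  have gap: "p * V + exp (- w - V) - (p - p * (w + ln p)) = p * (exp (- t) - 1 + t)"
    unfolding e by (simp add: t_def algebra_simps)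
  have "0 \<le> p * (exp (- t) - 1 + t)"
    using assms exp_ge_add_one_self[of "- t"] by (intro mult_nonneg_nonneg) auto
  then show "p * V + exp (- w - V) \<ge> p - p * (w + ln p)" unfolding gap[symmetric] by simp
  define l :: real where "l = ln 2"
  have "exp (- t) = 2 * exp (- t - l)" by (simp add: l_def exp_diff)
  moreover have "1 + (- t - l) \<le> exp (- t - l)" by (rule exp_ge_add_one_self)
  moreover have "l \<le> 1" using ln_le_minus_one[of 2] by (simp add: l_def)
  ultimately have "exp (- t) \<le> 2 * (exp (- t) - 1 + t) + 2" by argo
  then have "p * exp (- t) \<le> p * (2 * (exp (- t) - 1 + t) + 2)"
    using assms by (intro mult_left_mono) auto
  then show "exp (- w - V) \<le> 2 * (p * V + exp (- w - V) - (p - p * (w + ln p))) + 2 * p"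
    unfolding gap unfolding e by (simp add: algebra_simps)
qed

lemma midpoint_gap:
  fixes w V V' :: real
  shows "(exp (- w - V) + exp (- w - V')) - 2 * exp (- w - (V + V') / 2) =
    (exp ((- w - V) / 2) - exp ((- w - V') / 2))\<^sup>2"
proof -
  have "exp (- w - V) = (exp ((- w - V) / 2))\<^sup>2" "exp (- w - V') = (exp ((- w - V') / 2))\<^sup>2"
    by (simp_all add: power2_eq_square flip: exp_add)
  moreover have "exp (- w - (V + V') / 2) = exp ((- w - V) / 2) * exp ((- w - V') / 2)"
    by (simp add: field_simps flip: exp_add)
  ultimately show ?thesis by (simp add: power2_diff)
qed

text \<open>The term \<open>p * V\<close> is affine in \<open>V\<close> and cancels from the
  midpoint gap, which leaves the exponential terms computed in \<open>midpoint_gap\<close>.\<close>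

lemma admissible_midpoint:
  assumes [measurable]: "w \<in> borel_measurable C" "V \<in> borel_measurable C" "V' \<in> borel_measurable C"
    and a: "admissible C p w V" "admissible C p w V'"
  shows "admissible C p w (\<lambda>x. (V x + V' x) / 2)"
    and "(\<integral>x. (exp ((- w x - V x) / 2) - exp ((- w x - V' x) / 2))\<^sup>2 \<partial>C) =
      free_energy C p w V + free_energy C p w V' - 2 * free_energy C p w (\<lambda>x. (V x + V' x) / 2)"
    and "integrable C (\<lambda>x. (exp ((- w x - V x) / 2) - exp ((- w x - V' x) / 2))\<^sup>2)"
proof -
  have i1: "integrable C (\<lambda>x. p x * V x)" "integrable C (\<lambda>x. exp (- w x - V x))"
    and i2: "integrable C (\<lambda>x. p x * V' x)" "integrable C (\<lambda>x. exp (- w x - V' x))"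
    using a by (auto simp: admissible_def)
  have "integrable C (\<lambda>x. (p x * V x + p x * V' x) / 2)" using i1 i2 by auto
  then have j1: "integrable C (\<lambda>x. p x * ((V x + V' x) / 2))" by (simp add: distrib_left)
  have j2: "integrable C (\<lambda>x. exp (- w x - (V x + V' x) / 2))"
  proof (rule Bochner_Integration.integrable_bound)
    show "integrable C (\<lambda>x. exp (- w x - V x) + exp (- w x - V' x))" using i1 i2 by auto
    show "AE x in C. norm (exp (- w x - (V x + V' x) / 2)) \<le> norm (exp (- w x - V x) + exp (- w x - V' x))"
    proof (rule AE_I2)
      fix x
      have "2 * exp (- w x - (V x + V' x) / 2) \<le> exp (- w x - V x) + exp (- w x - V' x)"
        using midpoint_gap[of "w x" "V x" "V' x"] zero_le_power2 by (metis diff_ge_0_iff_ge)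
      with exp_gt_zero[of "- w x - (V x + V' x) / 2"]
      have "exp (- w x - (V x + V' x) / 2) \<le> exp (- w x - V x) + exp (- w x - V' x)" by linarith
      then show "norm (exp (- w x - (V x + V' x) / 2)) \<le> norm (exp (- w x - V x) + exp (- w x - V' x))"
        by simp
    qed
  qed measurable
  show "admissible C p w (\<lambda>x. (V x + V' x) / 2)" using j1 j2 by (simp add: admissible_def)
  define H where "H V x = p x * V x + exp (- w x - V x)" for V x
  have H: "integrable C (H V)" "integrable C (H V')" "integrable C (H (\<lambda>x. (V x + V' x) / 2))"
    unfolding H_def[abs_def] using i1 i2 j1 j2 by auto
  have F: "free_energy C p w V = (\<integral>x. H V x \<partial>C)" for V
    by (simp add: free_energy_def H_def)
  have eq: "(exp ((- w x - V x) / 2) - exp ((- w x - V' x) / 2))\<^sup>2 =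
    H V x + H V' x - 2 * H (\<lambda>x. (V x + V' x) / 2) x" for x
    unfolding midpoint_gap[symmetric] H_def by (simp add: field_simps)
  show "integrable C (\<lambda>x. (exp ((- w x - V x) / 2) - exp ((- w x - V' x) / 2))\<^sup>2)"
    unfolding eq using H by auto
  show "(\<integral>x. (exp ((- w x - V x) / 2) - exp ((- w x - V' x) / 2))\<^sup>2 \<partial>C) =
      free_energy C p w V + free_energy C p w V' - 2 * free_energy C p w (\<lambda>x. (V x + V' x) / 2)"
    unfolding eq F using H by simp
qed

text \<open>The inequality \<open>t \<le> 2 ^ (- n) + 2 ^ n * t ^ 2\<close> for nonnegative
  \<open>t\<close> makes the increments absolutely summable.\<close>

lemma convergent_of_summable_weighted_squares:
  fixes a :: "nat \<Rightarrow> real"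
  assumes "summable (\<lambda>n. 2 ^ n * (a n - a (Suc n))\<^sup>2)"
  shows "convergent a"
proof -
  have "summable (\<lambda>n. (1/2) ^ n + 2 ^ n * (a n - a (Suc n))\<^sup>2)"
    using assms by (intro summable_add summable_geometric) auto
  moreover have "norm (a (Suc n) - a n) \<le> (1/2) ^ n + 2 ^ n * (a n - a (Suc n))\<^sup>2" for n
  proof -
    define t where "t = \<bar>a n - a (Suc n)\<bar>"
    define d where "d = (2::real) ^ n"
    have d: "d > 0" by (simp add: d_def)
    have "0 \<le> (1 - d * t)\<^sup>2" by simp
    then have "2 * (d * t) \<le> 1 + (d * t)\<^sup>2" by (simp add: power2_diff)
    moreover have "0 \<le> d * t" using d by (simp add: t_def)
    ultimately have "d * t \<le> 1 + (d * t)\<^sup>2" by linarith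
    then have "t \<le> (1 + (d * t)\<^sup>2) / d" using d by (simp add: pos_le_divide_eq mult.commute)
    also have "\<dots> = 1 / d + d * t\<^sup>2" using d by (simp add: field_simps power2_eq_square)
    finally show ?thesis
      by (simp add: t_def d_def power_one_over abs_minus_commute)
  qed
  ultimately have "summable (\<lambda>n. a (Suc n) - a n)"
    by (rule summable_comparison_test'[where N = 0])
  then have "convergent (\<lambda>n. \<Sum>k<n. a (Suc k) - a k)" by (simp add: summable_iff_convergent)
  then have "convergent (\<lambda>n. a n - a 0)" by (simp add: sum_lessThan_telescope)
  from convergent_add[OF this convergent_const[of "a 0"]] show ?thesis by simp
qed

lemma nn_integral_finite_summable:
  fixes f :: "nat \<Rightarrow> 'b \<Rightarrow> real"
  assumes int: "\<And>n. integrable C (f n)" and pos: "\<And>n x. f n x \<ge> 0"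
    and sm: "summable (\<lambda>n. \<integral>x. f n x \<partial>C)"
  shows "AE x in C. summable (\<lambda>n. f n x)"
proof -
  have [measurable]: "f n \<in> borel_measurable C" for n using int by auto
  have "(\<integral>\<^sup>+x. (\<Sum>n. ennreal (f n x)) \<partial>C) = (\<Sum>n. \<integral>\<^sup>+x. ennreal (f n x) \<partial>C)"
    by (intro nn_integral_suminf) auto
  also have "\<dots> = (\<Sum>n. ennreal (\<integral>x. f n x \<partial>C))"
    using int pos by (intro suminf_cong nn_integral_eq_integral) auto
  also have "\<dots> = ennreal (\<Sum>n. \<integral>x. f n x \<partial>C)"
    using pos by (intro suminf_ennreal2 sm) auto
  finally have "(\<integral>\<^sup>+x. (\<Sum>n. ennreal (f n x)) \<partial>C) \<noteq> \<infinity>" by simp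
  then have "AE x in C. (\<Sum>n. ennreal (f n x)) \<noteq> \<infinity>"
    by (intro nn_integral_PInf_AE) auto
  then show ?thesis
    by eventually_elim (rule summable_suminf_not_top, auto simp: pos)
qed

text \<open>Stated for an abstract class of potentials: stability under midpoints drives the
  Hellinger estimate, and \<open>lim\<close> ensures that the a.e. limit of a minimizing sequence is
  a.e. equal to a member of the class.\<close>

lemma exists_free_energy_minimizer:
  fixes p w :: "'b \<Rightarrow> real"
  assumes [measurable]: "p \<in> borel_measurable C" "w \<in> borel_measurable C"
    and pos: "AE x in C. p x > 0" and int_p: "integrable C p"
    and ent: "integrable C (\<lambda>x. p x * max (w x + ln (p x)) 0)"
    and meas: "\<And>V. V \<in> \<V> \<Longrightarrow> V \<in> borel_measurable C"
    and mid: "\<And>V V'. V \<in> \<V> \<Longrightarrow> V' \<in> \<V> \<Longrightarrow> (\<lambda>x. (V x + V' x) / 2) \<in> \<V>"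
    and lim: "\<And>V. (\<And>n::nat. V n \<in> \<V>) \<Longrightarrow> AE x in C. convergent (\<lambda>n. V n x) \<Longrightarrow>
        \<exists>V'\<in>\<V>. AE x in C. (\<lambda>n. V n x) \<longlonglongrightarrow> V' x"
    and ne: "V0 \<in> \<V>" "admissible C p w V0"
  shows "\<exists>V\<in>\<V>. admissible C p w V \<and>
    (\<forall>V'\<in>\<V>. admissible C p w V' \<longrightarrow> free_energy C p w V \<le> free_energy C p w V')"
proof -
  \<comment> \<open>The pointwise infimum of \<open>p x * V + exp (- w x - V)\<close> over real
    \<open>V\<close>, as in \<open>relative_entropy_bounds\<close>. Subtracting it makes all
    integrands nonnegative a.e.\<close>
  define a where "a x = p x - p x * (w x + ln (p x))" for x
  define h where "h V x = p x * V x + exp (- w x - V x)" for V x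
  have [measurable]: "a \<in> borel_measurable C" unfolding a_def by measurable
  have hm[measurable]: "h V \<in> borel_measurable C" if "V \<in> \<V>" for V
  proof -
    note [measurable] = meas[OF that]
    show ?thesis unfolding h_def[abs_def] by measurable
  qed
  have F: "free_energy C p w V = (\<integral>x. h V x \<partial>C)" for V by (simp add: free_energy_def h_def)
  have ih: "integrable C (h V)" if "admissible C p w V" for V
    using that unfolding admissible_def h_def[abs_def] by auto
  have ha: "AE x in C. a x \<le> h V x" for V
    using pos by eventually_elim (simp add: a_def h_def relative_entropy_bounds)
  \<comment> \<open>Bounded above by the integrand of the admissible \<open>V0\<close>, and below
    through the integrable positive part of the entropy density.\<close>
  have ia: "integrable C a"
  proof (rule Bochner_Integration.integrable_bound)
    show "integrable C (\<lambda>x. norm (h V0 x) + norm (p x) + norm (p x * max (w x + ln (p x)) 0))"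
      using ih[OF ne(2)] int_p ent by auto
    show "AE x in C. norm (a x) \<le> norm (norm (h V0 x) + norm (p x) + norm (p x * max (w x + ln (p x)) 0))"
      using pos ha[of V0]
    proof eventually_elim
      case (elim x)
      have "p x * (w x + ln (p x)) \<le> p x * max (w x + ln (p x)) 0"
        using elim by (intro mult_left_mono) auto
      moreover have "norm (p x * max (w x + ln (p x)) 0) = p x * max (w x + ln (p x)) 0" "norm (p x) = p x"
        using elim by auto
      ultimately have "a x \<ge> - (norm (p x) + norm (p x * max (w x + ln (p x)) 0))"
        using elim unfolding a_def by linarith
      then have "norm (a x) \<le> norm (h V0 x) + norm (p x) + norm (p x * max (w x + ln (p x)) 0)"
        using elim(2) unfolding real_norm_def by linarith
      then show ?case by simp
    qed
  qed measurable
  define S where "S = free_energy C p w ` {V \<in> \<V>. admissible C p w V}"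
  have bdd: "bdd_below S"
    unfolding S_def
  proof (rule bdd_belowI2)
    fix V assume "V \<in> {V \<in> \<V>. admissible C p w V}"
    then show "(\<integral>x. a x \<partial>C) \<le> free_energy C p w V"
      unfolding F by (intro integral_mono_AE ia ih ha) auto
  qed
  have Sne: "S \<noteq> {}" using ne by (auto simp: S_def)
  \<comment> \<open>The excess \<open>(1/4) ^ n\<close> is chosen to leave a geometric factor
    \<open>(1/2) ^ n\<close> after the weights \<open>2 ^ n\<close> of
    \<open>convergent_of_summable_weighted_squares\<close>.\<close>
  have "\<exists>V. V \<in> \<V> \<and> admissible C p w V \<and> free_energy C p w V < Inf S + (1/4) ^ n" for n :: nat
  proof -
    have "Inf S < Inf S + (1/4) ^ n" by simp
    then show ?thesis
      unfolding cInf_less_iff[OF Sne bdd] by (auto simp: S_def)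
  qed
  then obtain V where V: "\<And>n. V n \<in> \<V>" "\<And>n. admissible C p w (V n)"
    "\<And>n::nat. free_energy C p w (V n) < Inf S + (1/4) ^ n"
    by metis
  note [measurable] = meas[OF V(1)]
  have low: "Inf S \<le> free_energy C p w V'" if "V' \<in> \<V>" "admissible C p w V'" for V'
    using that by (intro cInf_lower bdd) (auto simp: S_def)
  \<comment> \<open>Square roots of the Gibbs weights. As midpoints stay in the class, their free
    energy is at least \<open>Inf S\<close>, so the squared distance of consecutive
    \<open>r n\<close> is at most the sum of the two excesses.\<close>
  define r where "r n x = exp ((- w x - V n x) / 2)" for n x
  note gap = admissible_midpoint[OF assms(2) meas meas, OF V(1) V(1) V(2) V(2), folded r_def]
  have small: "(\<integral>x. (r n x - r (Suc n) x)\<^sup>2 \<partial>C) \<le> 2 * (1/4) ^ n" for n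
  proof -
    have "(\<integral>x. (r n x - r (Suc n) x)\<^sup>2 \<partial>C) \<le> (1/4) ^ n + (1/4) ^ Suc n"
      unfolding gap(2) using low[OF mid[OF V(1)[of n] V(1)[of "Suc n"]] gap(1)] V(3)[of n] V(3)[of "Suc n"]
      by linarith
    also have "\<dots> \<le> 2 * (1/4) ^ n" by simp
    finally show ?thesis .
  qed
  have "AE x in C. summable (\<lambda>n. 2 ^ n * (r n x - r (Suc n) x)\<^sup>2)"
  proof (rule nn_integral_finite_summable)
    show "integrable C (\<lambda>x. 2 ^ n * (r n x - r (Suc n) x)\<^sup>2)" for n
      using gap(3) by simp
    show "summable (\<lambda>n. \<integral>x. 2 ^ n * (r n x - r (Suc n) x)\<^sup>2 \<partial>C)"
    proof (rule summable_comparison_test'[where N = 0])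
      show "summable (\<lambda>n. 2 * (1/2) ^ n :: real)" by (intro summable_mult summable_geometric) auto
      show "norm (\<integral>x. 2 ^ n * (r n x - r (Suc n) x)\<^sup>2 \<partial>C) \<le> 2 * (1/2) ^ n" for n
      proof -
        have "norm (\<integral>x. 2 ^ n * (r n x - r (Suc n) x)\<^sup>2 \<partial>C) = 2 ^ n * (\<integral>x. (r n x - r (Suc n) x)\<^sup>2 \<partial>C)"
          by (simp add: abs_mult)
        also have "\<dots> \<le> 2 ^ n * (2 * (1/4) ^ n)"
          using small[of n] by (intro mult_left_mono) auto
        also have "\<dots> = 2 * (2 * (1/4)) ^ n" by (simp only: power_mult_distrib ac_simps)
        finally show ?thesis by simp
      qed
    qed
  qed simp
  then have rconv: "AE x in C. convergent (\<lambda>n. r n x)"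
  proof eventually_elim
    case (elim x)
    then show ?case by (rule convergent_of_summable_weighted_squares)
  qed
  have Fatou: "(\<integral>\<^sup>+x. liminf (\<lambda>n. ennreal (h (V n) x - a x)) \<partial>C) \<le> ennreal (Inf S - (\<integral>x. a x \<partial>C))"
  proof -
    have "(\<integral>\<^sup>+x. liminf (\<lambda>n. ennreal (h (V n) x - a x)) \<partial>C) \<le> liminf (\<lambda>n. \<integral>\<^sup>+x. ennreal (h (V n) x - a x) \<partial>C)"
      using hm[OF V(1)] by (intro nn_integral_liminf) auto
    also have "\<dots> \<le> liminf (\<lambda>n. ennreal (Inf S + (1/4) ^ n - (\<integral>x. a x \<partial>C)))"
    proof (intro Liminf_mono always_eventually allI)
      fix n
      have "(\<integral>\<^sup>+x. ennreal (h (V n) x - a x) \<partial>C) = ennreal (\<integral>x. h (V n) x - a x \<partial>C)"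
        using ih[OF V(2)] ia ha[of "V n"] by (intro nn_integral_eq_integral) auto
      also have "(\<integral>x. h (V n) x - a x \<partial>C) = free_energy C p w (V n) - (\<integral>x. a x \<partial>C)"
        unfolding F using ih[OF V(2)] ia by simp
      also have "ennreal \<dots> \<le> ennreal (Inf S + (1/4) ^ n - (\<integral>x. a x \<partial>C))"
        using V(3)[of n] by (intro ennreal_leI) simp
      finally show "(\<integral>\<^sup>+x. ennreal (h (V n) x - a x) \<partial>C) \<le> ennreal (Inf S + (1/4) ^ n - (\<integral>x. a x \<partial>C))" .
    qed
    also have "\<dots> = ennreal (Inf S - (\<integral>x. a x \<partial>C))"
    proof (rule lim_imp_Liminf)
      have "(\<lambda>n. Inf S + (1/4) ^ n - (\<integral>x. a x \<partial>C)) \<longlonglongrightarrow> Inf S + 0 - (\<integral>x. a x \<partial>C)"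
        by (intro tendsto_intros LIMSEQ_power_zero) auto
      then show "(\<lambda>n. ennreal (Inf S + (1/4) ^ n - (\<integral>x. a x \<partial>C))) \<longlonglongrightarrow> ennreal (Inf S - (\<integral>x. a x \<partial>C))"
        by (intro tendsto_ennrealI) simp
    qed simp
    finally show ?thesis .
  qed
  have "(\<lambda>x. liminf (\<lambda>n. ennreal (h (V n) x - a x))) \<in> borel_measurable C"
    using hm[OF V(1)] by measurable
  then have "AE x in C. liminf (\<lambda>n. ennreal (h (V n) x - a x)) \<noteq> \<infinity>"
    using Fatou by (intro nn_integral_PInf_AE) (auto simp: top_unique)
  then have "AE x in C. convergent (\<lambda>n. V n x)"
    using rconv pos
  proof eventually_elim
    case (elim x)
    then obtain c where c: "(\<lambda>n. r n x) \<longlonglongrightarrow> c" by (auto simp: convergent_def)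
    have Vr: "V n x = - w x - 2 * ln (r n x)" for n by (simp add: r_def field_simps)
    have "c \<ge> 0" using c by (rule LIMSEQ_le_const) (auto simp: r_def)
    \<comment> \<open>A limit zero would mean that \<open>V n x\<close> tends to infinity, and with
      it \<open>p x * V n x\<close>, contradicting the finite liminf obtained from Fatou.
      Convergence of \<open>r n x\<close> to a finite value already excludes divergence to minus
      infinity.\<close>
    moreover have "c \<noteq> 0"
    proof
      assume "c = 0"
      then have "filterlim (\<lambda>n. r n x) (at_right 0) sequentially"
        using c by (auto simp: filterlim_at r_def)
      then have "filterlim (\<lambda>n. ln (r n x)) at_bot sequentially"
        by (rule filterlim_compose[OF ln_at_0])
      then have ln0: "filterlim (\<lambda>n. - ln (r n x)) at_top sequentially"
        by (simp add: filterlim_uminus_at_bot)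
      have "liminf (\<lambda>n. ennreal (h (V n) x - a x)) = \<infinity>"
      proof (rule lim_imp_Liminf)
        show "(\<lambda>n. ennreal (h (V n) x - a x)) \<longlonglongrightarrow> \<infinity>"
          unfolding tendsto_top_iff_ennreal infinity_ennreal_def
        proof (intro allI impI)
          fix l :: real
          assume "l \<ge> 0"
          \<comment> \<open>The threshold is the condition \<open>V n x > (l + a x) / p x\<close>
            rewritten through \<open>V n x = - w x - 2 * ln (r n x)\<close>.\<close>
          have "eventually (\<lambda>n. - ln (r n x) > ((l + a x) / p x + w x) / 2) sequentially"
            using ln0 unfolding filterlim_at_top_dense by blast
          then have "eventually (\<lambda>n. l < h (V n) x - a x) sequentially"
          proof eventually_elim
            case (elim n)
            then have "(l + a x) / p x < V n x" by (simp add: Vr)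
            then have "l + a x < p x * V n x"
              using \<open>p x > 0\<close> by (simp add: pos_divide_less_eq mult.commute)
            also have "\<dots> \<le> h (V n) x" by (simp add: h_def)
            finally show ?case by simp
          qed
          then show "eventually (\<lambda>n. ennreal l < ennreal (h (V n) x - a x)) sequentially"
            using \<open>l \<ge> 0\<close> by (auto elim!: eventually_mono simp: ennreal_lessI)
        qed
      qed simp
      with elim show False by simp
    qed
    ultimately have "(\<lambda>n. - w x - 2 * ln (r n x)) \<longlonglongrightarrow> - w x - 2 * ln c"
      by (intro tendsto_intros c) auto
    then show ?case unfolding Vr[symmetric] by (rule convergentI)
  qed
  from lim[OF V(1) this] obtain V' where V': "V' \<in> \<V>" and VV': "AE x in C. (\<lambda>n. V n x) \<longlonglongrightarrow> V' x"
    by blast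
  note [measurable] = meas[OF V'] hm[OF V']
  have "AE x in C. ennreal (h V' x - a x) = liminf (\<lambda>n. ennreal (h (V n) x - a x))"
    using VV'
  proof eventually_elim
    case (elim x)
    then have "(\<lambda>n. ennreal (h (V n) x - a x)) \<longlonglongrightarrow> ennreal (h V' x - a x)"
      unfolding h_def by (intro tendsto_ennrealI tendsto_intros) auto
    then show ?case by (intro lim_imp_Liminf[symmetric]) auto
  qed
  then have "(\<integral>\<^sup>+x. ennreal (h V' x - a x) \<partial>C) \<le> ennreal (Inf S - (\<integral>x. a x \<partial>C))"
    using Fatou by (simp cong: nn_integral_cong_AE)
  note fat = this
  have ig: "integrable C (\<lambda>x. h V' x - a x)"
    using ha[of V'] fat by (intro integrableI_nonneg) (auto simp: top_unique less_top intro: le_less_trans)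
  have ih': "integrable C (h V')" using Bochner_Integration.integrable_add[OF ig ia] by simp
  \<comment> \<open>Fatou controls only the sum of the two terms of \<open>h V'\<close>. The Gibbs
    weight is bounded by the gap and \<open>p\<close>, after which \<open>p * V'\<close> is
    integrable as a difference.\<close>
  have ie: "integrable C (\<lambda>x. exp (- w x - V' x))"
  proof (rule Bochner_Integration.integrable_bound)
    show "integrable C (\<lambda>x. 2 * (h V' x - a x) + 2 * p x)" by (intro Bochner_Integration.integrable_add integrable_mult_right ig int_p)
    show "AE x in C. norm (exp (- w x - V' x)) \<le> norm (2 * (h V' x - a x) + 2 * p x)"
      using pos
    proof eventually_elim
      case (elim x)
      from relative_entropy_bounds(2)[OF this, of "w x" "V' x"]
      show ?case unfolding h_def a_def by (simp add: abs_of_nonneg)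
    qed
  qed measurable
  have ip: "integrable C (\<lambda>x. p x * V' x)"
    using Bochner_Integration.integrable_diff[OF ih' ie] by (simp add: h_def)
  have adm: "admissible C p w V'" using ip ie by (simp add: admissible_def)
  \<comment> \<open>Since \<open>ennreal\<close> sends negative reals to zero, the bound from Fatou
    returns to the reals only once its right-hand side is known to be nonnegative.\<close>
  have ge: "Inf S - (\<integral>x. a x \<partial>C) \<ge> 0"
    using cInf_greatest[OF Sne] integral_mono_AE[OF ia ih ha] by (auto simp: S_def F)
  have "ennreal (\<integral>x. h V' x - a x \<partial>C) \<le> ennreal (Inf S - (\<integral>x. a x \<partial>C))"
    using fat ig ha[of V'] by (subst (asm) nn_integral_eq_integral) auto
  then have "(\<integral>x. h V' x - a x \<partial>C) \<le> Inf S - (\<integral>x. a x \<partial>C)" using ge by simp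
  then have "free_energy C p w V' \<le> Inf S" unfolding F using ih' ia by simp
  then show ?thesis using V' adm low by force
qed

section \<open>First variation and uniqueness of Gibbs densities\<close>

lemma exp_le_quadratic:
  fixes s :: real
  assumes "\<bar>s\<bar> \<le> 1"
  shows "exp s \<le> 1 + s + s\<^sup>2"
proof (cases "s \<ge> 0")
  case True
  then show ?thesis using assms by (intro exp_bound) auto
next
  case False
  define u where "u = - s"
  have u: "0 < u" "u \<le> 1" using False assms by (auto simp: u_def)
  have "exp s = inverse (exp u)" by (simp add: u_def exp_minus)
  also have "\<dots> \<le> inverse (1 + u)"
    using u exp_ge_add_one_self[of u] by (intro le_imp_inverse_le) auto
  also have "\<dots> \<le> 1 - u + u\<^sup>2"
  proof -
    have "(1 + u) * (1 - u + u\<^sup>2) = 1 + u ^ 3" by (simp add: algebra_simps power2_eq_square power3_eq_cube)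
    then have "1 \<le> (1 + u) * (1 - u + u\<^sup>2)" using u by simp
    then show ?thesis using u by (simp add: field_simps)
  qed
  finally show ?thesis by (simp add: u_def)
qed

text \<open>In place of differentiating under the integral, the quadratic bound on the exponential
  gives \<open>0 \<le> \<epsilon> * \<Delta> + \<epsilon>\<^sup>2 * K\<close> for all small
  \<epsilon> of either sign, where \<Delta> is the difference of the two integrals. This forces
  \<Delta> to vanish. Boundedness of \<phi> keeps the perturbed potentials admissible.\<close>

lemma free_energy_stationary:
  fixes p w V \<phi> :: "'b \<Rightarrow> real"
  assumes [measurable]: "w \<in> borel_measurable C" "V \<in> borel_measurable C" "\<phi> \<in> borel_measurable C"
    and p: "integrable C p" and adm: "admissible C p w V"
    and bd: "\<And>x. \<bar>\<phi> x\<bar> \<le> c"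
    and minimal: "\<And>\<epsilon>. admissible C p w (\<lambda>x. V x + \<epsilon> * \<phi> x) \<Longrightarrow>
      free_energy C p w V \<le> free_energy C p w (\<lambda>x. V x + \<epsilon> * \<phi> x)"
  shows "(\<integral>x. p x * \<phi> x \<partial>C) = (\<integral>x. exp (- w x - V x) * \<phi> x \<partial>C)"
proof -
  have c0: "c \<ge> 0" using bd[of undefined] by linarith
  define Q where "Q x = exp (- w x - V x)" for x
  have Q: "integrable C Q" and pV: "integrable C (\<lambda>x. p x * V x)"
    using adm by (auto simp: admissible_def Q_def[abs_def])
  have [measurable]: "Q \<in> borel_measurable C" "p \<in> borel_measurable C" using Q p by auto
  have Q0: "Q x > 0" for x by (simp add: Q_def)
  have bdi: "integrable C (\<lambda>x. f x * \<phi> x)" if "integrable C f" for f :: "'b \<Rightarrow> real"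
  proof (rule Bochner_Integration.integrable_bound)
    show "integrable C (\<lambda>x. c * f x)" using that by simp
    have [measurable]: "f \<in> borel_measurable C" using that by auto
    show "(\<lambda>x. f x * \<phi> x) \<in> borel_measurable C" by measurable
    show "AE x in C. norm (f x * \<phi> x) \<le> norm (c * f x)"
    proof (rule AE_I2)
      fix x
      have "\<bar>f x\<bar> * \<bar>\<phi> x\<bar> \<le> \<bar>f x\<bar> * c" using bd[of x] by (intro mult_left_mono) auto
      then show "norm (f x * \<phi> x) \<le> norm (c * f x)" using c0 by (simp add: abs_mult mult.commute)
    qed
  qed
  note p\<phi> = bdi[OF p] and Q\<phi> = bdi[OF Q] 
  note Q\<phi>\<phi> = bdi[OF Q\<phi>]
  define \<Delta> where "\<Delta> = (\<integral>x. p x * \<phi> x \<partial>C) - (\<integral>x. Q x * \<phi> x \<partial>C)"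
  define K where "K = (\<integral>x. Q x * \<phi> x * \<phi> x \<partial>C)"
  have K0: "K \<ge> 0"
    unfolding K_def using Q0 by (intro integral_nonneg_AE AE_I2) (auto simp: mult.assoc less_imp_le)
  have var: "0 \<le> \<epsilon> * \<Delta> + \<epsilon>\<^sup>2 * K" if e: "\<bar>\<epsilon>\<bar> * c \<le> 1" for \<epsilon>
  proof -
    have exp_le: "exp (- w x - (V x + \<epsilon> * \<phi> x)) \<le> Q x - \<epsilon> * (Q x * \<phi> x) + \<epsilon>\<^sup>2 * (Q x * \<phi> x * \<phi> x)" for x
    proof -
      have "\<bar>- (\<epsilon> * \<phi> x)\<bar> \<le> 1"
        using e mult_left_mono[OF bd[of x], of "\<bar>\<epsilon>\<bar>"] by (simp add: abs_mult)
      from exp_le_quadratic[OF this]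
      have "Q x * exp (- (\<epsilon> * \<phi> x)) \<le> Q x * (1 - \<epsilon> * \<phi> x + (\<epsilon> * \<phi> x)\<^sup>2)"
        using Q0[of x] by (intro mult_left_mono) auto
      moreover have "exp (- w x - (V x + \<epsilon> * \<phi> x)) = Q x * exp (- (\<epsilon> * \<phi> x))"
        by (simp add: Q_def algebra_simps flip: exp_add)
      ultimately show ?thesis by (simp add: algebra_simps power2_eq_square)
    qed
    have ub: "integrable C (\<lambda>x. Q x - \<epsilon> * (Q x * \<phi> x) + \<epsilon>\<^sup>2 * (Q x * \<phi> x * \<phi> x))"
      using Q Q\<phi> Q\<phi>\<phi> by auto
    have ie: "integrable C (\<lambda>x. exp (- w x - (V x + \<epsilon> * \<phi> x)))"
    proof (rule Bochner_Integration.integrable_bound[OF ub])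
      show "AE x in C. norm (exp (- w x - (V x + \<epsilon> * \<phi> x))) \<le> norm (Q x - \<epsilon> * (Q x * \<phi> x) + \<epsilon>\<^sup>2 * (Q x * \<phi> x * \<phi> x))"
        using exp_le by (intro AE_I2) (metis abs_exp_cancel order_trans abs_ge_self real_norm_def)
    qed measurable
    have ipe: "integrable C (\<lambda>x. p x * (V x + \<epsilon> * \<phi> x))"
      using pV p\<phi> by (auto simp: distrib_left mult.left_commute)
    have adm': "admissible C p w (\<lambda>x. V x + \<epsilon> * \<phi> x)"
      using ie ipe by (simp add: admissible_def)
    have "free_energy C p w V = (\<integral>x. p x * V x \<partial>C) + (\<integral>x. Q x \<partial>C)"
      unfolding free_energy_def Q_def using pV Q by (simp add: Q_def[abs_def])
    moreover have "free_energy C p w (\<lambda>x. V x + \<epsilon> * \<phi> x) =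
       (\<integral>x. p x * V x \<partial>C) + \<epsilon> * (\<integral>x. p x * \<phi> x \<partial>C) + (\<integral>x. exp (- w x - (V x + \<epsilon> * \<phi> x)) \<partial>C)"
      unfolding free_energy_def using pV p\<phi> ie ipe by (simp add: distrib_left mult.left_commute[of _ \<epsilon>])
    moreover have "(\<integral>x. exp (- w x - (V x + \<epsilon> * \<phi> x)) \<partial>C) \<le>
       (\<integral>x. Q x - \<epsilon> * (Q x * \<phi> x) + \<epsilon>\<^sup>2 * (Q x * \<phi> x * \<phi> x) \<partial>C)"
      by (intro integral_mono ie ub exp_le)
    moreover have "(\<integral>x. Q x - \<epsilon> * (Q x * \<phi> x) + \<epsilon>\<^sup>2 * (Q x * \<phi> x * \<phi> x) \<partial>C) =
       (\<integral>x. Q x \<partial>C) - \<epsilon> * (\<integral>x. Q x * \<phi> x \<partial>C) + \<epsilon>\<^sup>2 * K"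
      unfolding K_def using Q Q\<phi> Q\<phi>\<phi> by simp
    ultimately show ?thesis
      using minimal[OF adm'] by (simp add: \<Delta>_def algebra_simps)
  qed
  have "\<Delta> = 0"
  proof (rule ccontr)
    assume "\<Delta> \<noteq> 0"
    \<comment> \<open>The first bound puts the perturbation into the range of
      \<open>exp_le_quadratic\<close>. The second makes the quadratic term smaller than the linear
      one, whose sign is made negative by \<open>- sgn \<Delta>\<close>.\<close>
    define \<delta> where "\<delta> = min (1 / (c + 1)) (\<bar>\<Delta>\<bar> / (2 * (K + 1)))"
    have d: "\<delta> > 0" "\<delta> \<le> 1 / (c + 1)" "\<delta> \<le> \<bar>\<Delta>\<bar> / (2 * (K + 1))"
      using \<open>\<Delta> \<noteq> 0\<close> c0 K0 by (auto simp: \<delta>_def)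
    have "\<delta> * c \<le> 1"
      using d(1,2) c0 by (simp add: field_simps)
    then have "0 \<le> (- sgn \<Delta> * \<delta>) * \<Delta> + (- sgn \<Delta> * \<delta>)\<^sup>2 * K"
      using d(1) \<open>\<Delta> \<noteq> 0\<close> by (intro var) (simp add: abs_mult abs_sgn_eq)
    also have "\<dots> = \<delta> * (\<delta> * K - \<bar>\<Delta>\<bar>)"
      using \<open>\<Delta> \<noteq> 0\<close> by (simp add: sgn_if power2_eq_square algebra_simps)
    finally have "\<bar>\<Delta>\<bar> \<le> \<delta> * K" using d(1) by (simp add: zero_le_mult_iff)
    moreover have "\<delta> * (2 * (K + 1)) \<le> \<bar>\<Delta>\<bar>" using d(3) K0 by (simp add: pos_le_divide_eq)
    ultimately show False using d(1) K0 by (simp add: algebra_simps)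
  qed
  then show ?thesis by (simp add: \<Delta>_def Q_def)
qed

text \<open>The logarithm is increasing, so \<open>(q0 - q1) * (ln q0 - ln q1)\<close> is
  nonnegative and vanishes only where \<open>q0 = q1\<close>. Passing from the potentials to the
  logarithms adds a multiple of \<open>q0 - q1\<close>, which has integral zero because both
  densities are normalized.\<close>

lemma gibbs_unique:
  fixes w V0 V1 :: "'b \<Rightarrow> real"
  assumes Q: "integrable C (\<lambda>x. exp (- w x - V0 x))" "integrable C (\<lambda>x. exp (- w x - V1 x))"
    and Z: "Z0 = (\<integral>x. exp (- w x - V0 x) \<partial>C)" "Z1 = (\<integral>x. exp (- w x - V1 x) \<partial>C)" "Z0 > 0" "Z1 > 0"
    and int: "integrable C (\<lambda>x. (exp (- w x - V0 x) / Z0 - exp (- w x - V1 x) / Z1) * (V1 x - V0 x))"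
    and zero: "(\<integral>x. (exp (- w x - V0 x) / Z0 - exp (- w x - V1 x) / Z1) * (V1 x - V0 x) \<partial>C) = 0"
  shows "AE x in C. V1 x - V0 x = ln Z0 - ln Z1"
proof -
  define q0 q1 where "q0 x = exp (- w x - V0 x) / Z0" and "q1 x = exp (- w x - V1 x) / Z1" for x
  have i: "integrable C q0" "integrable C q1" "(\<integral>x. q0 x \<partial>C) = 1" "(\<integral>x. q1 x \<partial>C) = 1"
    using Q Z by (auto simp: q0_def[abs_def] q1_def[abs_def])
  have ln: "ln (q0 x) = - w x - V0 x - ln Z0" "ln (q1 x) = - w x - V1 x - ln Z1" for x
    using Z by (auto simp: q0_def q1_def ln_div)
  have qpos: "q0 x > 0" "q1 x > 0" for x using Z by (auto simp: q0_def q1_def)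
  have eq: "(q0 x - q1 x) * (ln (q0 x) - ln (q1 x)) = (q0 x - q1 x) * (V1 x - V0 x) + (ln Z1 - ln Z0) * (q0 x - q1 x)" for x
    unfolding ln by (simp add: algebra_simps)
  have int': "integrable C (\<lambda>x. (q0 x - q1 x) * (ln (q0 x) - ln (q1 x)))"
    unfolding eq using int[folded q0_def q1_def] i by auto
  have "(\<integral>x. (q0 x - q1 x) * (ln (q0 x) - ln (q1 x)) \<partial>C) = 0"
    unfolding eq using int[folded q0_def q1_def] zero[folded q0_def q1_def] i by simp
  moreover have nn: "(q0 x - q1 x) * (ln (q0 x) - ln (q1 x)) \<ge> 0" for x
  proof (cases "q0 x \<le> q1 x")
    case True
    then have "ln (q0 x) \<le> ln (q1 x)" using qpos by simp
    with True show ?thesis by (simp add: mult_nonpos_nonpos)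
  next
    case False
    then have "ln (q1 x) \<le> ln (q0 x)" using qpos by simp
    with False show ?thesis by simp
  qed
  ultimately have "AE x in C. (q0 x - q1 x) * (ln (q0 x) - ln (q1 x)) = 0"
    using integral_nonneg_eq_0_iff_AE[OF int'] by auto
  then show ?thesis
  proof eventually_elim
    case (elim x)
    then have "ln (q0 x) = ln (q1 x)" using qpos by auto
    then show ?case unfolding ln by simp
  qed
qed

section \<open>Marginals\<close>

lemma finite_strict_mono_maps: "finite {i \<in> {..<m} \<rightarrow>\<^sub>E {..<N}. strict_mono_on {..<m} i}"
  for m N :: nat
  by (rule finite_subset[of _ "{..<m} \<rightarrow>\<^sub>E {..<N}"]) (auto intro: finite_PiE)

lemma strict_mono_mapsD:
  fixes m N :: nat
  assumes "i \<in> {i \<in> {..<m} \<rightarrow>\<^sub>E {..<N}. strict_mono_on {..<m} i}"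
  shows "inj_on i {..<m}" "i ` {..<m} \<subseteq> {..<N}"
  using assms strict_mono_on_imp_inj_on by auto

lemma card_strict_mono_maps_pos:
  fixes m N :: nat
  assumes "m \<le> N"
  shows "card {i \<in> {..<m} \<rightarrow>\<^sub>E {..<N}. strict_mono_on {..<m} i} > 0"
proof -
  have "restrict id {..<m} \<in> {i \<in> {..<m} \<rightarrow>\<^sub>E {..<N}. strict_mono_on {..<m} i}"
    using assms by (auto simp: strict_mono_on_def)
  then show ?thesis using finite_strict_mono_maps[of m N] unfolding card_gt_0_iff by blast
qed

abbreviation marginal :: "'a measure \<Rightarrow> nat \<Rightarrow> nat \<Rightarrow> ((nat \<Rightarrow> 'a) \<Rightarrow> ennreal) \<Rightarrow> (nat \<Rightarrow> 'a) \<Rightarrow> ennreal" where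
  "marginal M N m Q x \<equiv> \<integral>\<^sup>+y. Q (merge {..<m} {m..<N} (x, y)) \<partial>pow_measure M {m..<N}"

context sigma_finite_measure
begin

lemma lessThan_split: "m \<le> N \<Longrightarrow> {..<m} \<union> {m..<N} = {..<N}" for m N :: nat
  by auto

lemma measurable_body_sum_pow:
  assumes v: "v \<in> borel_measurable (pow_measure M {..<m})"
  shows "body_sum N m v \<in> borel_measurable (pow_measure M {..<N})"
  unfolding body_sum_def[abs_def]
proof (rule borel_measurable_sum)
  fix i assume i: "i \<in> {i \<in> {..<m} \<rightarrow>\<^sub>E {..<N}. strict_mono_on {..<m} i}"
  show "(\<lambda>x. v (\<lambda>j\<in>{..<m}. x (i j))) \<in> borel_measurable (pow_measure M {..<N})"
    by (rule measurable_compose[OF measurable_pow_measure_reindex[OF finite_lessThan strict_mono_mapsD[OF i]] v])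
qed

lemma AE_body_sum_cong:
  assumes "AE x in pow_measure M {..<m}. u x = v x"
  shows "AE x in pow_measure M {..<N}. body_sum N m u x = body_sum N m v x"
proof -
  have "AE x in pow_measure M {..<N}. \<forall>i\<in>{i \<in> {..<m} \<rightarrow>\<^sub>E {..<N}. strict_mono_on {..<m} i}.
      u (\<lambda>j\<in>{..<m}. x (i j)) = v (\<lambda>j\<in>{..<m}. x (i j))"
    using finite_strict_mono_maps strict_mono_mapsD
    by (intro AE_finite_allI AE_pow_measure_reindex[OF assms]) auto
  then show ?thesis unfolding body_sum_def by eventually_elim (rule sum.cong, auto)
qed

lemma measurable_marginal_pow:
  assumes "Q \<in> borel_measurable (pow_measure M {..<N})" "m \<le> N"
  shows "marginal M N m Q \<in> borel_measurable (pow_measure M {..<m})"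
  using measurable_marginal[of Q "{..<m}" "{m..<N}"] assms(1)
  unfolding lessThan_split[OF assms(2)] by (simp add: ivl_disj_int)

lemma marginal_AE_cong:
  assumes "AE x in pow_measure M {..<N}. Q x = Q' x" "m \<le> N"
  shows "AE x in pow_measure M {..<m}. marginal M N m Q x = marginal M N m Q' x"
proof -
  have "AE z in PiM ({..<m} \<union> {m..<N}) (\<lambda>_. M). Q z = Q' z"
    using assms(1) unfolding lessThan_split[OF assms(2)] pow_measure_def AE_completion_iff .
  from AE_PiM_merge[OF this] have "AE x in PiM {..<m} (\<lambda>_. M). AE y in PiM {m..<N} (\<lambda>_. M).
      Q (merge {..<m} {m..<N} (x, y)) = Q' (merge {..<m} {m..<N} (x, y))"
    by (simp add: ivl_disj_int)
  then have "AE x in PiM {..<m} (\<lambda>_. M). marginal M N m Q x = marginal M N m Q' x"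
    by eventually_elim (auto simp: pow_measure_def AE_completion intro!: nn_integral_cong_AE)
  then show ?thesis unfolding pow_measure_def[of M "{..<m}"] by (rule AE_completion)
qed

text \<open>The right-hand side depends on \<open>q\<close> only through \<open>Z\<close>: weights
  whose marginals are multiples of the same \<open>r\<close> give proportional integrals. The
  integral against \<open>r\<close> is split into positive and negative parts because
  \<open>r\<close> takes values in \<open>ennreal\<close>.\<close>

lemma integral_reindex_weight:
  fixes q :: "(nat \<Rightarrow> 'a) \<Rightarrow> real"
  assumes q: "q \<in> borel_measurable (pow_measure M {..<N})" "\<And>x. q x \<ge> 0" "ae_symmetric M N q"
    and r: "r \<in> borel_measurable (pow_measure M {..<m})" "Z \<ge> 0"
      "AE x in pow_measure M {..<m}. marginal M N m (\<lambda>z. ennreal (q z)) x = ennreal Z * r x"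
    and i: "inj_on i {..<m}" "i ` {..<m} \<subseteq> {..<N}" and "m \<le> N"
    and v: "v \<in> borel_measurable (pow_measure M {..<m})"
    and fin: "(\<integral>\<^sup>+x. ennreal \<bar>v x\<bar> * r x \<partial>pow_measure M {..<m}) < \<infinity>"
  shows "integrable (pow_measure M {..<N}) (\<lambda>x. q x * v (\<lambda>j\<in>{..<m}. x (i j)))" (is ?int)
    and "(\<integral>x. q x * v (\<lambda>j\<in>{..<m}. x (i j)) \<partial>pow_measure M {..<N}) =
      Z * (enn2real (\<integral>\<^sup>+x. ennreal (v x) * r x \<partial>pow_measure M {..<m}) -
           enn2real (\<integral>\<^sup>+x. ennreal (- v x) * r x \<partial>pow_measure M {..<m}))"
proof -
  note [measurable] = q(1) r(1) v
  have [measurable]: "(\<lambda>x. \<lambda>j\<in>{..<m}. x (i j)) \<in> pow_measure M {..<N} \<rightarrow>\<^sub>M pow_measure M {..<m}"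
    by (rule measurable_pow_measure_reindex[OF _ i]) simp
  have sym: "ae_symmetric M N (\<lambda>x. ennreal (q x))"
    using q(3) unfolding ae_symmetric_def by (auto elim!: eventually_mono)
  have key: "(\<integral>\<^sup>+x. ennreal (q x * g (\<lambda>j\<in>{..<m}. x (i j))) \<partial>pow_measure M {..<N}) =
      ennreal Z * (\<integral>\<^sup>+x. ennreal (g x) * r x \<partial>pow_measure M {..<m})"
    if g[measurable]: "g \<in> borel_measurable (pow_measure M {..<m})" for g :: "(nat \<Rightarrow> 'a) \<Rightarrow> real"
  proof -
    have "(\<integral>\<^sup>+x. ennreal (q x * g (\<lambda>j\<in>{..<m}. x (i j))) \<partial>pow_measure M {..<N}) =
        (\<integral>\<^sup>+x. ennreal (g (\<lambda>j\<in>{..<m}. x (i j))) * ennreal (q x) \<partial>pow_measure M {..<N})"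
      using q(2) by (intro nn_integral_cong) (simp add: ennreal_mult' mult.commute)
    also have "\<dots> = (\<integral>\<^sup>+x. ennreal (g x) * marginal M N m (\<lambda>z. ennreal (q z)) x \<partial>pow_measure M {..<m})"
      by (rule nn_integral_marginal_reindex[OF _ sym i \<open>m \<le> N\<close>, where g = "\<lambda>x. ennreal (g x)"]) auto
    also have "\<dots> = (\<integral>\<^sup>+x. ennreal Z * (ennreal (g x) * r x) \<partial>pow_measure M {..<m})"
    proof (rule nn_integral_cong_AE)
      show "AE x in pow_measure M {..<m}. ennreal (g x) * marginal M N m (\<lambda>z. ennreal (q z)) x = ennreal Z * (ennreal (g x) * r x)"
        using r(3) by eventually_elim (simp add: mult.left_commute)
    qed
    also have "\<dots> = ennreal Z * (\<integral>\<^sup>+x. ennreal (g x) * r x \<partial>pow_measure M {..<m})"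
      by (rule nn_integral_cmult) auto
    finally show ?thesis .
  qed
  have "(\<integral>\<^sup>+x. ennreal (norm (q x * v (\<lambda>j\<in>{..<m}. x (i j)))) \<partial>pow_measure M {..<N}) < \<infinity>"
    using key[of "\<lambda>x. \<bar>v x\<bar>"] fin q(2) by (simp add: abs_mult ennreal_mult_less_top)
  then show int: ?int by (intro integrableI_bounded) auto
  have "ennreal (- (q x * v y)) = ennreal (q x * - v y)" for x y by simp
  then show "(\<integral>x. q x * v (\<lambda>j\<in>{..<m}. x (i j)) \<partial>pow_measure M {..<N}) =
      Z * (enn2real (\<integral>\<^sup>+x. ennreal (v x) * r x \<partial>pow_measure M {..<m}) -
           enn2real (\<integral>\<^sup>+x. ennreal (- v x) * r x \<partial>pow_measure M {..<m}))"
    using key[of v] key[of "\<lambda>x. - v x"] r(2)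
    by (subst real_lebesgue_integral_def[OF int]) (simp add: enn2real_mult right_diff_distrib)
qed

lemma integral_body_sum_weight:
  fixes q :: "(nat \<Rightarrow> 'a) \<Rightarrow> real"
  assumes q: "q \<in> borel_measurable (pow_measure M {..<N})" "\<And>x. q x \<ge> 0" "ae_symmetric M N q"
    and r: "r \<in> borel_measurable (pow_measure M {..<m})" "Z \<ge> 0"
      "AE x in pow_measure M {..<m}. marginal M N m (\<lambda>z. ennreal (q z)) x = ennreal Z * r x"
    and "m \<le> N"
    and v: "v \<in> borel_measurable (pow_measure M {..<m})"
    and fin: "(\<integral>\<^sup>+x. ennreal \<bar>v x\<bar> * r x \<partial>pow_measure M {..<m}) < \<infinity>"
  shows "integrable (pow_measure M {..<N}) (\<lambda>x. q x * body_sum N m v x)"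
    and "(\<integral>x. q x * body_sum N m v x \<partial>pow_measure M {..<N}) =
      card {i \<in> {..<m} \<rightarrow>\<^sub>E {..<N}. strict_mono_on {..<m} i} *
      (Z * (enn2real (\<integral>\<^sup>+x. ennreal (v x) * r x \<partial>pow_measure M {..<m}) -
           enn2real (\<integral>\<^sup>+x. ennreal (- v x) * r x \<partial>pow_measure M {..<m})))"
proof -
  define S where "S = {i \<in> {..<m} \<rightarrow>\<^sub>E {..<N}. strict_mono_on {..<m} i}"
  have *: "integrable (pow_measure M {..<N}) (\<lambda>x. q x * v (\<lambda>j\<in>{..<m}. x (i j)))"
    "(\<integral>x. q x * v (\<lambda>j\<in>{..<m}. x (i j)) \<partial>pow_measure M {..<N}) =
      Z * (enn2real (\<integral>\<^sup>+x. ennreal (v x) * r x \<partial>pow_measure M {..<m}) -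
           enn2real (\<integral>\<^sup>+x. ennreal (- v x) * r x \<partial>pow_measure M {..<m}))"
    if "i \<in> S" for i
    using integral_reindex_weight[OF q r strict_mono_mapsD[OF that[unfolded S_def]] \<open>m \<le> N\<close> v fin] by auto
  show "integrable (pow_measure M {..<N}) (\<lambda>x. q x * body_sum N m v x)"
    unfolding body_sum_def sum_distrib_left S_def[symmetric]
    by (rule Bochner_Integration.integrable_sum) (rule *(1))
  show "(\<integral>x. q x * body_sum N m v x \<partial>pow_measure M {..<N}) =
      card {i \<in> {..<m} \<rightarrow>\<^sub>E {..<N}. strict_mono_on {..<m} i} *
      (Z * (enn2real (\<integral>\<^sup>+x. ennreal (v x) * r x \<partial>pow_measure M {..<m}) -
           enn2real (\<integral>\<^sup>+x. ennreal (- v x) * r x \<partial>pow_measure M {..<m})))"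
    unfolding body_sum_def sum_distrib_left S_def[symmetric]
    by (subst Bochner_Integration.integral_sum) (use * in auto)
qed

end

section \<open>The linear space of body sums and its closedness\<close>

lemma body_sum_lincomb:
  "body_sum N m (\<lambda>x. a * u x + b * v x) x = a * body_sum N m u x + b * body_sum N m v x"
  unfolding body_sum_def by (simp add: sum.distrib sum_distrib_left)

lemma symmetric_fun_lincomb:
  fixes u v :: "(nat \<Rightarrow> 'a) \<Rightarrow> real"
  shows "symmetric_fun M m u \<Longrightarrow> symmetric_fun M m v \<Longrightarrow> symmetric_fun M m (\<lambda>x. a * u x + b * v x)"
  unfolding symmetric_fun_def by auto

text \<open>Real functions that are body sums everywhere. The variational argument runs in this
  space, whereas members of \<open>V_P\<close> may differ from a body sum on a null set and be
  infinite there.\<close>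

definition potentials :: "'a measure \<Rightarrow> nat \<Rightarrow> nat \<Rightarrow> ((nat \<Rightarrow> 'a) \<Rightarrow> real) set" where
  "potentials M N m = {body_sum N m v | v. v \<in> borel_measurable (pow_measure M {..<m}) \<and> symmetric_fun M m v}"

lemma potentials_lincomb:
  assumes "V \<in> potentials M N m" "V' \<in> potentials M N m"
  shows "(\<lambda>x. a * V x + b * V' x) \<in> potentials M N m"
proof -
  obtain v v' where v: "V = body_sum N m v" "V' = body_sum N m v'"
    "v \<in> borel_measurable (pow_measure M {..<m})" "symmetric_fun M m v"
    "v' \<in> borel_measurable (pow_measure M {..<m})" "symmetric_fun M m v'"
    using assms by (auto simp: potentials_def)
  note [measurable] = v(3,5)
  have "(\<lambda>x. a * V x + b * V' x) = body_sum N m (\<lambda>x. a * v x + b * v' x)"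
    by (auto simp: v(1,2) body_sum_lincomb)
  moreover have "(\<lambda>x. a * v x + b * v' x) \<in> borel_measurable (pow_measure M {..<m})" by measurable
  ultimately show ?thesis
    using symmetric_fun_lincomb[OF v(4,6)] unfolding potentials_def by blast
qed

context sigma_finite_measure
begin

lemma potentials_measurable: "V \<in> potentials M N m \<Longrightarrow> V \<in> borel_measurable (pow_measure M {..<N})"
  by (auto simp: potentials_def intro: measurable_body_sum_pow)

lemma potentials_AE_limit:
  fixes V :: "nat \<Rightarrow> (nat \<Rightarrow> 'a) \<Rightarrow> real"
  assumes V: "\<And>n. V n \<in> potentials M N m" and conv: "AE x in pow_measure M {..<N}. convergent (\<lambda>n. V n x)"
    and "m \<le> N" "emeasure M (space M) \<noteq> 0"
  shows "\<exists>V'\<in>potentials M N m. AE x in pow_measure M {..<N}. (\<lambda>n. V n x) \<longlonglongrightarrow> V' x"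
proof -
  have "\<exists>v. V n = body_sum N m v \<and> v \<in> borel_measurable (pow_measure M {..<m}) \<and> symmetric_fun M m v" for n
    using V[of n] by (auto simp: potentials_def)
  then obtain v where v: "\<And>n. V n = body_sum N m (v n)"
    "\<And>n. v n \<in> borel_measurable (pow_measure M {..<m})" "\<And>n. symmetric_fun M m (v n)"
    by metis
  \<comment> \<open>Off the convergence set \<open>lim\<close> gives some fixed value. Symmetry
    nevertheless holds at every point, since permuting the variables leaves the whole sequence
    \<open>v n x\<close> unchanged.\<close>
  define v' where "v' x = lim (\<lambda>n. v n x)" for x
  have "v' \<in> borel_measurable (pow_measure M {..<m})"
    unfolding v'_def[abs_def] by (rule borel_measurable_lim_metric) (rule v)
  moreover have "symmetric_fun M m v'"
    using v(3) by (simp add: symmetric_fun_def v'_def)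
  ultimately have V': "body_sum N m v' \<in> potentials M N m" by (auto simp: potentials_def)
  have "AE x in PiM {..<N} (\<lambda>_. M). convergent (\<lambda>n. body_sum N m (v n) x)"
    using conv unfolding v(1) pow_measure_def AE_completion_iff .
  from potential_AE_convergent[OF this assms(3,4)]
  have "AE x in pow_measure M {..<m}. convergent (\<lambda>n. v n x)"
    unfolding pow_measure_def by (rule AE_completion)
  then have *: "AE x in pow_measure M {..<m}. (\<lambda>n. v n x) \<longlonglongrightarrow> v' x"
    by eventually_elim (simp add: v'_def convergent_LIMSEQ_iff)
  have "AE x in pow_measure M {..<N}. \<forall>i\<in>{i \<in> {..<m} \<rightarrow>\<^sub>E {..<N}. strict_mono_on {..<m} i}.
      (\<lambda>n. v n (\<lambda>j\<in>{..<m}. x (i j))) \<longlonglongrightarrow> v' (\<lambda>j\<in>{..<m}. x (i j))"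
    using finite_strict_mono_maps strict_mono_mapsD
    by (intro AE_finite_allI AE_pow_measure_reindex[OF *]) auto
  then have "AE x in pow_measure M {..<N}. (\<lambda>n. V n x) \<longlonglongrightarrow> body_sum N m v' x"
    unfolding v(1) body_sum_def by eventually_elim (rule tendsto_sum, blast)
  with V' show ?thesis by blast
qed

end

section \<open>From extended-real functions to real representatives\<close>

lemma exp_ereal_ereal [simp]: "exp_ereal (ereal r) = ereal (exp r)"
  by (simp add: exp_ereal_def)

lemma ln_ereal_ereal [simp]: "r > 0 \<Longrightarrow> ln_ereal (ereal r) = ereal (ln r)"
  by (simp add: ln_ereal_def)

text \<open>Completeness makes \<open>D\<close> and \<open>f\<close> measurable because they agree
  a.e. with measurable real functions, so membership becomes Bochner integrability of the product of
  the representatives.\<close>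

lemma (in complete_measure) L1_density_iff:
  fixes f :: "'a \<Rightarrow> ereal" and d g :: "'a \<Rightarrow> real"
  assumes D: "AE x in M. D x = ennreal (d x)" "d \<in> borel_measurable M" "\<And>x. d x \<ge> 0"
    and f: "AE x in M. f x = ereal (g x)" "g \<in> borel_measurable M"
  shows "f \<in> L1 (density M D) \<longleftrightarrow> integrable M (\<lambda>x. d x * g x)"
proof -
  note [measurable] = D(2) f(2)
  have [measurable]: "D \<in> borel_measurable M"
    by (rule measurable_AE_cong[OF _ D(1)]) auto
  have [measurable]: "f \<in> borel_measurable M"
    by (rule measurable_AE_cong[OF _ f(1)]) auto
  have "(\<integral>\<^sup>+x. e2ennreal \<bar>f x\<bar> \<partial>density M D) = (\<integral>\<^sup>+x. D x * e2ennreal \<bar>f x\<bar> \<partial>M)"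
    by (rule nn_integral_density) auto
  also have "\<dots> = (\<integral>\<^sup>+x. ennreal (norm (d x * g x)) \<partial>M)"
  proof (rule nn_integral_cong_AE)
    show "AE x in M. D x * e2ennreal \<bar>f x\<bar> = ennreal (norm (d x * g x))"
      using D(1) f(1) by eventually_elim (simp add: D(3) abs_mult ennreal_mult)
  qed
  finally show ?thesis
    by (simp add: L1_def integrable_iff_bounded)
qed

locale reduced_density = sigma_finite_measure M for M :: "'a measure" +
  fixes N m :: nat and P W :: "(nat \<Rightarrow> 'a) \<Rightarrow> ereal"
  assumes nonnull: "emeasure M (space M) \<noteq> 0" and mN: "m \<le> N"
    and P: "prob_density M N P" "AE x in pow_measure M {..<N}. P x > 0" "ae_symmetric M N P"
    and W: "W \<in> borel_measurable (pow_measure M {..<N})" "AE x in pow_measure M {..<N}. \<bar>W x\<bar> \<noteq> \<infinity>"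
      "ae_symmetric M N W"
begin

abbreviation "C \<equiv> pow_measure M {..<N}"
abbreviation "Cm \<equiv> pow_measure M {..<m}"

text \<open>The maximum makes the representative nonnegative everywhere. It agrees with
  \<open>P\<close> a.e., as \<open>P\<close> is a.e. positive and, having integral one, a.e.
  finite.\<close>

definition "P_real x = max 0 (real_of_ereal (P x))"
definition "w x = real_of_ereal (W x)"

lemma complete_pow: "complete_measure (pow_measure M I)"
  unfolding pow_measure_def ..

lemma P_meas [measurable]: "P \<in> borel_measurable C"
  using P by (simp add: prob_density_def)

lemma P_real_meas [measurable]: "P_real \<in> borel_measurable C"
  unfolding P_real_def[abs_def] by measurable

lemma w_meas [measurable]: "w \<in> borel_measurable C"
  using W(1) unfolding w_def[abs_def] by measurable

lemma P_real_nonneg: "P_real x \<ge> 0"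
  by (simp add: P_real_def)

lemma P_eq: "AE x in C. P x = ereal (P_real x) \<and> P_real x > 0"
proof -
  have "(\<integral>\<^sup>+x. e2ennreal (P x) \<partial>C) \<noteq> \<infinity>" using P by (simp add: prob_density_def)
  then have "AE x in C. e2ennreal (P x) \<noteq> \<infinity>"
    by (intro nn_integral_PInf_AE) auto
  with P(2) show ?thesis
  proof eventually_elim
    case (elim x)
    then show ?case by (cases "P x") (auto simp: P_real_def)
  qed
qed

lemma P_eq_ennreal: "AE x in C. e2ennreal (P x) = ennreal (P_real x)"
  using P_eq by eventually_elim simp

lemma P_real_pos: "AE x in C. P_real x > 0"
  using P_eq by eventually_elim simp

lemma W_eq: "AE x in C. W x = ereal (w x)"
  using W(2) by eventually_elim (simp add: w_def ereal_real)

lemma nn_integral_P_real: "(\<integral>\<^sup>+x. ennreal (P_real x) \<partial>C) = 1"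
  using nn_integral_cong_AE[OF P_eq_ennreal] P(1) by (simp add: prob_density_def)

lemma integrable_P_real: "integrable C P_real"
  by (rule integrableI_nonneg) (auto simp: nn_integral_P_real P_real_nonneg)

lemma integral_P_real: "(\<integral>x. P_real x \<partial>C) = 1"
  using nn_integral_P_real P_real_nonneg by (simp add: integral_eq_nn_integral)

lemma P_real_sym: "ae_symmetric M N P_real"
  using P(3) unfolding ae_symmetric_def P_real_def by (auto elim!: eventually_mono)

lemma w_sym: "ae_symmetric M N w"
  using W(3) unfolding ae_symmetric_def w_def by (auto elim!: eventually_mono)

lemma reduction_eq_marginal: "reduction M N k F = marginal M N k (\<lambda>z. e2ennreal (F z))"
  by (simp add: reduction_def fun_eq_iff)

definition "rho_P = reduction M N m P"

lemma rho_P_meas [measurable]: "rho_P \<in> borel_measurable Cm"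
  unfolding rho_P_def reduction_eq_marginal by (rule measurable_marginal_pow[OF _ mN]) measurable

lemma rho_P_eq: "AE x in Cm. marginal M N m (\<lambda>z. ennreal (P_real z)) x = ennreal 1 * rho_P x"
  using marginal_AE_cong[OF P_eq_ennreal mN] unfolding rho_P_def reduction_eq_marginal
  by eventually_elim simp

lemma space_C_nonnull: "emeasure C (space C) \<noteq> 0"
  using emeasure_PiM_space_nonzero[OF nonnull, of "{..<N}"] by (simp add: pow_measure_def)

context
  fixes v V
  assumes gen: "generates M N m v V"
begin

lemma gen_meas [measurable]: "v \<in> borel_measurable Cm" "body_sum N m v \<in> borel_measurable C"
  using gen measurable_body_sum_pow by (auto simp: generates_def)

lemma gen_eq: "AE x in C. V x = ereal (body_sum N m v x)"
  using gen by (simp add: generates_def)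

lemma gen_potential: "body_sum N m v \<in> potentials M N m"
  using gen by (auto simp: generates_def potentials_def)

lemma L1_P_iff:
  "V \<in> L1 (density C (\<lambda>x. e2ennreal (P x))) \<longleftrightarrow> integrable C (\<lambda>x. P_real x * body_sum N m v x)"
  by (rule complete_measure.L1_density_iff[OF complete_pow P_eq_ennreal P_real_meas P_real_nonneg gen_eq gen_meas(2)])

lemma exp_integrable_iff:
  "exp_integrable M N W V \<longleftrightarrow> integrable C (\<lambda>x. exp (- w x - body_sum N m v x))"
proof -
  have "AE x in C. e2ennreal (exp_ereal (- W x)) = ennreal (exp (- w x))"
    using W_eq by eventually_elim simp
  moreover have "AE x in C. exp_ereal (- V x) = ereal (exp (- body_sum N m v x))"
    using gen_eq by eventually_elim simp
  ultimately have "exp_integrable M N W V \<longleftrightarrow> integrable C (\<lambda>x. exp (- w x) * exp (- body_sum N m v x))"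
    unfolding exp_integrable_def by (intro complete_measure.L1_density_iff[OF complete_pow]) auto
  then show ?thesis by (simp flip: exp_add)
qed

lemma V_P_iff: "V \<in> V_P M N m W P \<longleftrightarrow> admissible C P_real w (body_sum N m v)"
  using gen by (auto simp: V_P_def admissible_def L1_P_iff exp_integrable_iff)

lemma L1_rho_iff:
  "(\<lambda>x. ereal (v x)) \<in> L1 (density Cm (reduction M N m P)) \<longleftrightarrow> (\<integral>\<^sup>+x. ennreal \<bar>v x\<bar> * rho_P x \<partial>Cm) < \<infinity>"
proof -
  have "(\<integral>\<^sup>+x. e2ennreal \<bar>ereal (v x)\<bar> \<partial>density Cm rho_P) = (\<integral>\<^sup>+x. rho_P x * e2ennreal \<bar>ereal (v x)\<bar> \<partial>Cm)"
    by (rule nn_integral_density) auto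
  then show ?thesis
    by (simp add: L1_def mult.commute flip: rho_P_def)
qed

lemma integrable_of_rho:
  assumes "(\<integral>\<^sup>+x. ennreal \<bar>v x\<bar> * rho_P x \<partial>Cm) < \<infinity>"
  shows "integrable C (\<lambda>x. P_real x * body_sum N m v x)"
  by (rule integral_body_sum_weight(1)[OF P_real_meas P_real_nonneg P_real_sym rho_P_meas _ rho_P_eq mN gen_meas(1) assms]) simp

definition "gibbs_weight x = exp (- w x - body_sum N m v x)"

lemma gibbs_weight_meas [measurable]: "gibbs_weight \<in> borel_measurable C"
  unfolding gibbs_weight_def[abs_def] by measurable

lemma gibbs_weight_sym: "ae_symmetric M N gibbs_weight"
  unfolding ae_symmetric_def
proof (intro allI impI)
  fix p assume p: "p permutes {..<N}"
  have "AE x in C. w (x \<circ> p) = w x" using w_sym p by (auto simp: ae_symmetric_def)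
  with AE_space show "AE x in C. gibbs_weight (x \<circ> p) = gibbs_weight x"
  proof eventually_elim
    case (elim x)
    have "symmetric_fun M m v" using gen by (simp add: generates_def)
    from body_sum_permute[OF this p elim(1)] elim(2) show ?case by (simp add: gibbs_weight_def)
  qed
qed

lemma rho_U_eq:
  assumes "integrable C gibbs_weight"
  shows "AE x in Cm. rho_U M N m W V x = marginal M N m (\<lambda>z. ennreal (gibbs_weight z)) x / ennreal (\<integral>x. gibbs_weight x \<partial>C)"
proof -
  have eq: "AE x in C. e2ennreal (exp_ereal (- W x - V x)) = ennreal (gibbs_weight x)"
    using W_eq gen_eq by eventually_elim (simp add: gibbs_weight_def)
  have "partition_fun M N W V = (\<integral>\<^sup>+x. ennreal (gibbs_weight x) \<partial>C)"
    unfolding partition_fun_def by (rule nn_integral_cong_AE[OF eq])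
  also have "\<dots> = ennreal (\<integral>x. gibbs_weight x \<partial>C)"
    by (rule nn_integral_eq_integral[OF assms]) (simp add: gibbs_weight_def)
  finally have Z: "partition_fun M N W V = ennreal (\<integral>x. gibbs_weight x \<partial>C)" .
  show ?thesis
    using marginal_AE_cong[OF eq mN] unfolding rho_U_def reduction_eq_marginal Z
    by eventually_elim simp
qed

lemma partition_pos:
  assumes "integrable C gibbs_weight"
  shows "(\<integral>x. gibbs_weight x \<partial>C) > 0"
proof -
  have "\<not> (AE x in C. gibbs_weight x = 0)"
  proof
    assume "AE x in C. gibbs_weight x = 0"
    then have "AE x in C. False" by eventually_elim (simp add: gibbs_weight_def)
    then show False using space_C_nonnull by (simp add: ae_filter_eq_bot_iff[symmetric] eventually_False)
  qed
  moreover have nn: "AE x in C. gibbs_weight x \<ge> 0" by (simp add: gibbs_weight_def)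
  ultimately show ?thesis
    using integral_nonneg_eq_0_iff_AE[OF assms nn] integral_nonneg_AE[OF nn] by linarith
qed

lemma marginal_gibbs_weight:
  assumes adm: "V \<in> V_P M N m W P" and rho: "AE x in Cm. rho_U M N m W V x = reduction M N m P x"
  shows "AE x in Cm. marginal M N m (\<lambda>z. ennreal (gibbs_weight z)) x = ennreal (\<integral>x. gibbs_weight x \<partial>C) * rho_P x"
proof -
  have i: "integrable C gibbs_weight" using adm by (simp add: V_P_iff admissible_def gibbs_weight_def[abs_def])
  note Z = partition_pos[OF i]
  show ?thesis
    using rho rho_U_eq[OF i]
  proof eventually_elim
    case (elim x)
    then have "rho_P x = marginal M N m (\<lambda>z. ennreal (gibbs_weight z)) x / ennreal (\<integral>x. gibbs_weight x \<partial>C)"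
      by (simp add: rho_P_def)
    then show ?case
      using Z ennreal_mult_divide_eq[of "ennreal (\<integral>x. gibbs_weight x \<partial>C)" "marginal M N m (\<lambda>z. ennreal (gibbs_weight z)) x"]
      by (simp add: ennreal_times_divide mult.commute[of "ennreal (\<integral>x. gibbs_weight x \<partial>C)"])
  qed
qed

end

text \<open>Carries \<open>potential_integrable_of_body_sum\<close> over to the completed measures:
  \<open>v\<close> and \<open>P\<close> are replaced by representatives \<open>u\<close> and
  \<open>p\<close> measurable for the uncompleted products, and symmetry, the lower bound and
  integrability are transferred to them.\<close>

lemma v_L1_rho:
  assumes gen: "generates M N m v V" and adm: "V \<in> V_P M N m W P"
    and N: "N = Suc n" and B: "B \<in> sets M" "emeasure M B > 0"
    and dom: "AE t in M. t \<in> B \<longrightarrow>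
           (\<exists>\<gamma>::real. \<gamma> > 0 \<and>
              (AE y in pow_measure M {..<n}.
                 P (y(n := t)) \<ge> ereal \<gamma> * enn2ereal (reduction M N n P y)))"
  shows "(\<integral>\<^sup>+x. ennreal \<bar>v x\<bar> * rho_P x \<partial>Cm) < \<infinity>"
proof -
  interpret product_sigma_finite "\<lambda>_::nat. M" by (rule product_sigma_finite_const)
  let ?A = "PiM {..<Suc n} (\<lambda>_. M)"
  have C: "C = completion ?A" by (simp add: pow_measure_def N)
  note [measurable] = gen_meas[OF gen]
  obtain u where u: "u \<in> borel_measurable (PiM {..<m} (\<lambda>_. M))" "AE x in PiM {..<m} (\<lambda>_. M). v x = u x"
    using gen_meas(1)[OF gen] unfolding pow_measure_def by (rule bexE[OF completion_ex_borel_measurable_real])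
  have "(\<lambda>x. e2ennreal (P x)) \<in> borel_measurable (completion ?A)" unfolding C[symmetric] by measurable
  then obtain p where p: "p \<in> borel_measurable ?A" "AE x in ?A. e2ennreal (P x) = p x"
    by (rule bexE[OF completion_ex_borel_measurable])
  have uv: "AE x in Cm. v x = u x" using u(2) unfolding pow_measure_def by (rule AE_completion)
  have pC: "AE x in C. e2ennreal (P x) = p x" unfolding C using p(2) by (rule AE_completion)
  have fin: "(\<integral>\<^sup>+y. ennreal \<bar>body_sum (Suc n) m u y\<bar> * p y \<partial>?A) < \<infinity>"
  proof -
    have "(\<integral>\<^sup>+y. ennreal \<bar>body_sum (Suc n) m u y\<bar> * p y \<partial>C) = (\<integral>\<^sup>+x. ennreal (norm (P_real x * body_sum N m v x)) \<partial>C)"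
    proof (rule nn_integral_cong_AE)
      show "AE x in C. ennreal \<bar>body_sum (Suc n) m u x\<bar> * p x = ennreal (norm (P_real x * body_sum N m v x))"
        using AE_body_sum_cong[OF uv, of N] pC P_eq_ennreal
        by eventually_elim (simp add: N abs_mult ennreal_mult P_real_nonneg mult.commute)
    qed
    also have "\<dots> < \<infinity>"
      using adm unfolding V_P_iff[OF gen] by (simp add: admissible_def integrable_iff_bounded)
    finally show ?thesis by (simp add: C nn_integral_completion)
  qed
  \<comment> \<open>The representative agrees with the density a.e., and at permuted points too,
    because permuting variables preserves null sets.\<close>
  have sym: "AE x in ?A. p (x \<circ> q) = p x" if q: "q permutes {..<Suc n}" for q
  proof -
    have "AE x in C. P (x \<circ> q) = P x" using P(3) q unfolding ae_symmetric_def N by blast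
    then have 1: "AE x in ?A. P (x \<circ> q) = P x" unfolding C AE_completion_iff .
    have 2: "AE x in ?A. e2ennreal (P (\<lambda>j\<in>{..<Suc n}. x (q j))) = p (\<lambda>j\<in>{..<Suc n}. x (q j))"
      by (rule AE_PiM_reindex[OF p(2)]) (use q permutes_image[OF q] permutes_inj_on[OF q] in auto)
    show ?thesis
      using 1 2 p(2) AE_space
    proof eventually_elim
      case (elim x)
      have "x \<circ> q = (\<lambda>j\<in>{..<Suc n}. x (q j))"
        using elim(4) permutes_not_in[OF q] by (auto simp: space_PiM PiE_iff extensional_def restrict_def)
      with elim show ?case by simp
    qed
  qed
  have ins: "{..<Suc n} = insert n {..<n}" "{..<Suc n} = {..<n} \<union> {n}" "{n..<Suc n} = {n}" by auto
  \<comment> \<open>A product over the single index \<open>n\<close> is the measure itself, and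
    merging in its coordinate is an update at \<open>n\<close>. This identifies the reduction to
    \<open>N - 1\<close> variables with the integral used in \<open>decouple_last\<close>.\<close>
  have red: "AE y in PiM {..<n} (\<lambda>_. M). reduction M N n P y = (\<integral>\<^sup>+s. p (y(n := s)) \<partial>M)"
  proof -
    have "AE y in PiM {..<n} (\<lambda>_. M). AE z in PiM {n} (\<lambda>_. M).
        e2ennreal (P (merge {..<n} {n} (y, z))) = p (merge {..<n} {n} (y, z))"
      using p(2) unfolding ins(2) by (rule AE_PiM_merge) auto
    with AE_space show ?thesis
    proof eventually_elim
      case (elim y)
      have "(\<lambda>s. p (y(n := s))) \<in> borel_measurable M"
        by (rule measurable_compose[OF measurable_component_update[OF elim(1)] p(1)[unfolded ins(1)]]) simp
      from product_nn_integral_singleton[OF this, of n]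
      have "(\<integral>\<^sup>+z. p (y(n := z n)) \<partial>PiM {n} (\<lambda>_. M)) = (\<integral>\<^sup>+s. p (y(n := s)) \<partial>M)" .
      moreover have "reduction M N n P y = (\<integral>\<^sup>+z. p (merge {..<n} {n} (y, z)) \<partial>PiM {n} (\<lambda>_. M))"
        unfolding reduction_def N ins(3) pow_measure_def nn_integral_completion
        by (rule nn_integral_cong_AE[OF elim(2)])
      moreover have "merge {..<n} {n} (y, z) = y(n := z n)" for z
        using elim(1) by (auto simp: merge_def space_PiM PiE_iff extensional_def)
      ultimately show ?case by simp
    qed
  qed
  have "AE t in M. AE y in PiM {..<n} (\<lambda>_. M). e2ennreal (P (y(n := t))) = p (y(n := t))"
    using p(2) unfolding ins(1) by (rule AE_PiM_fun_upd) auto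
  with dom have dom': "AE t in M. t \<in> B \<longrightarrow> (\<exists>\<gamma>::real. \<gamma> > 0 \<and>
      (AE y in PiM {..<n} (\<lambda>_. M). ennreal \<gamma> * (\<integral>\<^sup>+s. p (y(n := s)) \<partial>M) \<le> p (y(n := t))))"
  proof eventually_elim
    case (elim t)
    show ?case
    proof
      assume "t \<in> B"
      then obtain \<gamma> :: real where g: "\<gamma> > 0"
        "AE y in PiM {..<n} (\<lambda>_. M). P (y(n := t)) \<ge> ereal \<gamma> * enn2ereal (reduction M N n P y)"
        using elim(1) unfolding pow_measure_def AE_completion_iff by blast
      have "AE y in PiM {..<n} (\<lambda>_. M). ennreal \<gamma> * (\<integral>\<^sup>+s. p (y(n := s)) \<partial>M) \<le> p (y(n := t))"
        using g(2) elim(2) red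
      proof eventually_elim
        case (elim y)
        have "ereal \<gamma> * enn2ereal (reduction M N n P y) = enn2ereal (ennreal \<gamma> * reduction M N n P y)"
          using g(1) by (simp add: times_ennreal.rep_eq enn2ereal_ennreal)
        then have "ennreal \<gamma> * reduction M N n P y \<le> e2ennreal (P (y(n := t)))"
          using e2ennreal_mono[OF elim(1)] by simp
        then show ?case using elim by simp
      qed
      with g(1) show "\<exists>\<gamma>::real. \<gamma> > 0 \<and>
        (AE y in PiM {..<n} (\<lambda>_. M). ennreal \<gamma> * (\<integral>\<^sup>+s. p (y(n := s)) \<partial>M) \<le> p (y(n := t)))" by blast
    qed
  qed
  have bnd: "(\<integral>\<^sup>+y. ennreal \<bar>u (restrict y {..<m})\<bar> * p y \<partial>?A) < \<infinity>"
    using mN by (intro potential_integrable_of_body_sum[OF u(1) p(1) sym dom' fin B]) (simp_all add: N)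
  \<comment> \<open>The identity selection reads off the first \<open>m\<close> variables, turning
    the integral against the reduction into one against the full density.\<close>
  have eq1: "(\<integral>\<^sup>+x. ennreal \<bar>v x\<bar> * rho_P x \<partial>Cm) = (\<integral>\<^sup>+x. ennreal \<bar>v (\<lambda>j\<in>{..<m}. x (id j))\<bar> * e2ennreal (P x) \<partial>C)"
    unfolding rho_P_def reduction_eq_marginal
  proof (rule nn_integral_marginal_reindex[symmetric, where g = "\<lambda>x. ennreal \<bar>v x\<bar>"])
    show "ae_symmetric M N (\<lambda>x. e2ennreal (P x))"
      using P(3) unfolding ae_symmetric_def by (auto elim!: eventually_mono)
  qed (use mN in auto)
  also have "\<dots> = (\<integral>\<^sup>+y. ennreal \<bar>u (restrict y {..<m})\<bar> * p y \<partial>C)"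
  proof (rule nn_integral_cong_AE)
    have "AE x in C. v (\<lambda>j\<in>{..<m}. x (id j)) = u (\<lambda>j\<in>{..<m}. x (id j))"
      by (rule AE_pow_measure_reindex[OF uv]) (use mN in auto)
    then show "AE x in C. ennreal \<bar>v (\<lambda>j\<in>{..<m}. x (id j))\<bar> * e2ennreal (P x) = ennreal \<bar>u (restrict x {..<m})\<bar> * p x"
      using pC by eventually_elim (simp add: restrict_def)
  qed
  also have "\<dots> < \<infinity>" using bnd by (simp add: C nn_integral_completion)
  finally show ?thesis .
qed

end

section \<open>Existence and uniqueness\<close>

text \<open>Test functions for identifying the marginals. Variations of the potential have to be
  symmetric, so indicators are summed over all permutations; the factor \<open>m!\<close> left by
  not averaging cancels later.\<close>

definition symmetrized_indicator :: "nat \<Rightarrow> (nat \<Rightarrow> 'a) set \<Rightarrow> (nat \<Rightarrow> 'a) \<Rightarrow> real" where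
  "symmetrized_indicator m A y = (\<Sum>q | q permutes {..<m}. indicator A (\<lambda>j\<in>{..<m}. y (q j)))"

lemma symmetric_fun_symmetrized_indicator: "symmetric_fun M m (symmetrized_indicator m A)"
  unfolding symmetric_fun_def
proof (intro allI impI ballI)
  fix p and x :: "nat \<Rightarrow> 'a"
  assume p: "p permutes {..<m}"
  show "symmetrized_indicator m A (x \<circ> p) = symmetrized_indicator m A x"
    unfolding symmetrized_indicator_def
    by (subst (2) setum_permutations_compose_left[OF p]) (simp add: comp_def)
qed

lemma body_sum_bounded:
  fixes c :: real
  assumes "\<And>y. \<bar>f y\<bar> \<le> c"
  shows "\<bar>body_sum N m f x\<bar> \<le> card {i \<in> {..<m} \<rightarrow>\<^sub>E {..<N}. strict_mono_on {..<m} i} * c"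
  unfolding body_sum_def using assms by (intro order_trans[OF sum_abs] sum_bounded_above)

context sigma_finite_measure
begin

lemma measurable_symmetrized_indicator:
  assumes [measurable]: "A \<in> sets (pow_measure M {..<m})"
  shows "symmetrized_indicator m A \<in> borel_measurable (pow_measure M {..<m})"
  unfolding symmetrized_indicator_def[abs_def]
proof (rule borel_measurable_sum)
  fix q assume "q \<in> {q. q permutes {..<m}}"
  then have "(\<lambda>y. \<lambda>j\<in>{..<m}. y (q j)) \<in> pow_measure M {..<m} \<rightarrow>\<^sub>M pow_measure M {..<m}"
    by (intro measurable_pow_measure_reindex) (auto simp: permutes_inj_on permutes_image)
  then show "(\<lambda>y. indicator A (\<lambda>j\<in>{..<m}. y (q j)) :: real) \<in> borel_measurable (pow_measure M {..<m})"
    by (rule measurable_compose) simp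
qed

lemma nn_integral_marginal_density:
  assumes "Q \<in> borel_measurable (pow_measure M {..<N})" "m \<le> N"
  shows "(\<integral>\<^sup>+x. marginal M N m Q x \<partial>pow_measure M {..<m}) = (\<integral>\<^sup>+x. Q x \<partial>pow_measure M {..<N})"
  using nn_integral_marginal[of Q "{..<m}" "{m..<N}" "\<lambda>_. 1"] assms(1)
  unfolding lessThan_split[OF assms(2)] by (simp add: ivl_disj_int)

text \<open>By symmetry of \<open>d\<close>, every index sequence followed by every permutation
  contributes the same integral of the indicator against the marginal, so only the numbers of
  sequences and permutations remain as factors.\<close>

lemma integral_symmetrized_indicator:
  fixes d :: "(nat \<Rightarrow> 'a) \<Rightarrow> real"
  assumes d: "d \<in> borel_measurable (pow_measure M {..<N})" "\<And>x. d x \<ge> 0" "ae_symmetric M N d"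
    and fin: "(\<integral>\<^sup>+x. ennreal (d x) \<partial>pow_measure M {..<N}) < \<infinity>"
    and mN: "m \<le> N" and A: "A \<in> sets (pow_measure M {..<m})"
  shows "(\<integral>x. d x * body_sum N m (symmetrized_indicator m A) x \<partial>pow_measure M {..<N}) =
    card {i \<in> {..<m} \<rightarrow>\<^sub>E {..<N}. strict_mono_on {..<m} i} * (card {q. q permutes {..<m}} *
      enn2real (\<integral>\<^sup>+x. indicator A x * marginal M N m (\<lambda>z. ennreal (d z)) x \<partial>pow_measure M {..<m}))"
proof -
  define r where "r = marginal M N m (\<lambda>z. ennreal (d z))"
  define S where "S = {i \<in> {..<m} \<rightarrow>\<^sub>E {..<N}. strict_mono_on {..<m} i}"
  define J where "J = enn2real (\<integral>\<^sup>+x. indicator A x * r x \<partial>pow_measure M {..<m})"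
  note [measurable] = d(1) A
  have [measurable]: "r \<in> borel_measurable (pow_measure M {..<m})"
    unfolding r_def by (rule measurable_marginal_pow[OF _ mN]) measurable
  have "(\<integral>\<^sup>+x. ennreal \<bar>indicator A x\<bar> * r x \<partial>pow_measure M {..<m}) \<le> (\<integral>\<^sup>+x. r x \<partial>pow_measure M {..<m})"
    by (intro nn_integral_mono) (auto simp: indicator_def)
  also have "\<dots> < \<infinity>"
    using fin unfolding r_def by (subst nn_integral_marginal_density[OF _ mN]) auto
  finally have fA: "(\<integral>\<^sup>+x. ennreal \<bar>indicator A x\<bar> * r x \<partial>pow_measure M {..<m}) < \<infinity>" .
  have trm: "integrable (pow_measure M {..<N}) (\<lambda>x. d x * indicator A (\<lambda>j\<in>{..<m}. x (i (q j))))"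
    "(\<integral>x. d x * indicator A (\<lambda>j\<in>{..<m}. x (i (q j))) \<partial>pow_measure M {..<N}) = J"
    if i: "i \<in> S" and q: "q permutes {..<m}" for i q
  proof -
    have iS: "inj_on i {..<m}" "i ` {..<m} \<subseteq> {..<N}" using strict_mono_mapsD i unfolding S_def by blast+
    have iq: "inj_on (i \<circ> q) {..<m}"
      using iS(1) q by (intro comp_inj_on permutes_inj_on[OF q]) (simp add: permutes_image)
    have im: "(i \<circ> q) ` {..<m} \<subseteq> {..<N}"
      using iS(2) permutes_image[OF q] by (metis image_comp)
    have r1: "AE x in pow_measure M {..<m}. marginal M N m (\<lambda>z. ennreal (d z)) x = ennreal 1 * r x"
      by (simp add: r_def)
    have neg: "ennreal (- indicator A x) = 0" for x :: "nat \<Rightarrow> 'a"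
      by (simp add: indicator_def ennreal_neg)
    note * = integral_reindex_weight[OF d _ _ r1 iq im mN _ fA]
    show "integrable (pow_measure M {..<N}) (\<lambda>x. d x * indicator A (\<lambda>j\<in>{..<m}. x (i (q j))))"
      using *(1) by simp
    show "(\<integral>x. d x * indicator A (\<lambda>j\<in>{..<m}. x (i (q j))) \<partial>pow_measure M {..<N}) = J"
      using *(2) by (simp add: neg J_def ennreal_indicator)
  qed
  have "(\<integral>x. d x * body_sum N m (symmetrized_indicator m A) x \<partial>pow_measure M {..<N}) =
      (\<integral>x. (\<Sum>i\<in>S. \<Sum>q | q permutes {..<m}. d x * indicator A (\<lambda>j\<in>{..<m}. x (i (q j)))) \<partial>pow_measure M {..<N})"
  proof (rule Bochner_Integration.integral_cong[OF refl])
    fix x :: "nat \<Rightarrow> 'a"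
    have "(\<lambda>j\<in>{..<m}. (\<lambda>j\<in>{..<m}. x (i j)) (q j)) = (\<lambda>j\<in>{..<m}. x (i (q j)))" if "q permutes {..<m}" for i q
    proof (rule restrict_ext)
      fix j assume "j \<in> {..<m}"
      then have "q j \<in> {..<m}" using permutes_in_image[OF that] by blast
      then show "(\<lambda>j\<in>{..<m}. x (i j)) (q j) = x (i (q j))" by simp
    qed
    then show "d x * body_sum N m (symmetrized_indicator m A) x =
        (\<Sum>i\<in>S. \<Sum>q | q permutes {..<m}. d x * indicator A (\<lambda>j\<in>{..<m}. x (i (q j))))"
      unfolding body_sum_def symmetrized_indicator_def S_def sum_distrib_left
      by (intro sum.cong refl) auto
  qed
  also have "\<dots> = (\<Sum>i\<in>S. \<Sum>q | q permutes {..<m}. J)"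
  proof -
    have "(\<integral>x. (\<Sum>q | q permutes {..<m}. d x * indicator A (\<lambda>j\<in>{..<m}. x (i (q j)))) \<partial>pow_measure M {..<N}) =
        (\<Sum>q | q permutes {..<m}. J)" if "i \<in> S" for i
      using trm[OF that] by (subst Bochner_Integration.integral_sum) auto
    moreover have "integrable (pow_measure M {..<N}) (\<lambda>x. \<Sum>q | q permutes {..<m}. d x * indicator A (\<lambda>j\<in>{..<m}. x (i (q j))))"
      if "i \<in> S" for i
      using trm(1)[OF that] by (intro Bochner_Integration.integrable_sum) auto
    ultimately show ?thesis
      by (subst Bochner_Integration.integral_sum) auto
  qed
  also have "\<dots> = card S * (card {q. q permutes {..<m}} * J)" by simp
  finally show ?thesis unfolding S_def J_def r_def .
qed

end

context reduced_density
begin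

lemma exists_reduced_potential:
  assumes ne: "V_P M N m W P \<noteq> {}"
    and ent: "(\<lambda>x. max (W x + ln_ereal (P x)) 0) \<in> L1 (density C (\<lambda>x. e2ennreal (P x)))"
  shows "\<exists>U\<in>V_P M N m W P. \<exists>u. generates M N m u U \<and>
    (AE x in Cm. rho_U M N m W U x = reduction M N m P x)"
proof -
  obtain V0 v0 where V0: "V0 \<in> V_P M N m W P" "generates M N m v0 V0"
    using ne by (auto simp: V_P_def)
  have "AE x in C. max (W x + ln_ereal (P x)) 0 = ereal (max (w x + ln (P_real x)) 0)"
    using W_eq P_eq by eventually_elim (auto simp: max_def zero_ereal_def)
  then have ent': "integrable C (\<lambda>x. P_real x * max (w x + ln (P_real x)) 0)"
    using ent by (subst (asm) complete_measure.L1_density_iff[OF complete_pow P_eq_ennreal P_real_meas P_real_nonneg]) auto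
  have mid: "(\<lambda>x. (V x + V' x) / 2) \<in> potentials M N m"
    if "V \<in> potentials M N m" "V' \<in> potentials M N m" for V V'
    using potentials_lincomb[OF that, of "1/2" "1/2"] by (simp add: field_simps)
  have "\<exists>V\<in>potentials M N m. admissible C P_real w V \<and>
    (\<forall>V'\<in>potentials M N m. admissible C P_real w V' \<longrightarrow> free_energy C P_real w V \<le> free_energy C P_real w V')"
    by (rule exists_free_energy_minimizer[OF P_real_meas w_meas P_real_pos integrable_P_real ent' potentials_measurable mid
          potentials_AE_limit[OF _ _ mN nonnull] gen_potential[OF V0(2)] V0(1)[unfolded V_P_iff[OF V0(2)]]])
  then obtain V where V: "V \<in> potentials M N m" "admissible C P_real w V"
    "\<forall>V'\<in>potentials M N m. admissible C P_real w V' \<longrightarrow> free_energy C P_real w V \<le> free_energy C P_real w V'"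
    by blast
  then obtain u where u: "u \<in> borel_measurable Cm" "symmetric_fun M m u" and Vu: "V = body_sum N m u"
    unfolding potentials_def by blast
  note adm = V(2)[unfolded Vu]
  have minimal: "free_energy C P_real w (body_sum N m u) \<le> free_energy C P_real w V'"
    if "V' \<in> potentials M N m" "admissible C P_real w V'" for V'
    using V(3) that unfolding Vu by blast
  define U where "U x = ereal (body_sum N m u x)" for x
  have gen: "generates M N m u U" unfolding generates_def U_def by (intro conjI u AE_I2 refl)
  note [measurable] = gen_meas[OF gen] gibbs_weight_meas[OF gen]
  have iq: "integrable C (gibbs_weight u)" using adm by (simp add: admissible_def gibbs_weight_def[OF gen, abs_def])
  have q0: "gibbs_weight u x \<ge> 0" for x by (simp add: gibbs_weight_def[OF gen])
  have EL: "(\<integral>x. P_real x * body_sum N m f x \<partial>C) = (\<integral>x. gibbs_weight u x * body_sum N m f x \<partial>C)"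
    if f: "f \<in> borel_measurable Cm" "symmetric_fun M m f" and bd: "\<And>y. \<bar>f y\<bar> \<le> c" for f c
    unfolding gibbs_weight_def[OF gen]
  proof (rule free_energy_stationary[OF w_meas gen_meas(2)[OF gen] measurable_body_sum_pow[OF f(1)]
        integrable_P_real adm body_sum_bounded[OF bd]])
    fix \<epsilon>
    have "body_sum N m f \<in> potentials M N m" using f by (auto simp: potentials_def)
    from potentials_lincomb[OF gen_potential[OF gen] this, of 1 \<epsilon>]
    have "(\<lambda>x. body_sum N m u x + \<epsilon> * body_sum N m f x) \<in> potentials M N m" by simp
    then show "admissible C P_real w (\<lambda>x. body_sum N m u x + \<epsilon> * body_sum N m f x) \<Longrightarrow>
      free_energy C P_real w (body_sum N m u) \<le> free_energy C P_real w (\<lambda>x. body_sum N m u x + \<epsilon> * body_sum N m f x)"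
      by (rule minimal)
  qed
  have k0: "card {i \<in> {..<m} \<rightarrow>\<^sub>E {..<N}. strict_mono_on {..<m} i} > 0"
    by (rule card_strict_mono_maps_pos[OF mN])
  \<comment> \<open>Testing with the constant potential, whose body sum is a nonzero constant, shows
    that the minimizer is normalized.\<close>
  have "(\<integral>x. P_real x * body_sum N m (\<lambda>_. 1) x \<partial>C) = (\<integral>x. gibbs_weight u x * body_sum N m (\<lambda>_. 1) x \<partial>C)"
    by (rule EL[of _ 1]) (auto simp: symmetric_fun_def)
  then have Z: "(\<integral>x. gibbs_weight u x \<partial>C) = 1"
    using k0 integral_P_real by (simp add: body_sum_def)
  have nnq: "(\<integral>\<^sup>+x. ennreal (gibbs_weight u x) \<partial>C) = 1"
    using Z q0 iq by (subst nn_integral_eq_integral) auto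
  define rU where "rU = marginal M N m (\<lambda>z. ennreal (gibbs_weight u z))"
  define rP where "rP = marginal M N m (\<lambda>z. ennreal (P_real z))"
  have [measurable]: "rU \<in> borel_measurable Cm" "rP \<in> borel_measurable Cm"
    unfolding rU_def rP_def by (auto intro!: measurable_marginal_pow[OF _ mN])
  have tot: "(\<integral>\<^sup>+x. rU x \<partial>Cm) = 1" "(\<integral>\<^sup>+x. rP x \<partial>Cm) = 1"
    unfolding rU_def rP_def
    by (subst nn_integral_marginal_density[OF _ mN]; simp add: nnq nn_integral_P_real)+
  \<comment> \<open>Stationarity against the symmetrized indicator of each measurable set identifies
    the two marginal measures; equality a.e. of their densities follows because they are
    finite.\<close>
  have "density Cm rP = density Cm rU"
  proof (rule measure_eqI)
    fix A assume "A \<in> sets (density Cm rP)"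
    then have A[measurable]: "A \<in> sets Cm" by simp
    define c where "c = real (card {q. q permutes {..<m}})"
    have c: "c > 0"
      using card_permutations[of "{..<m}" m] by (simp add: c_def)
    have "\<bar>symmetrized_indicator m A y\<bar> \<le> c" for y
    proof -
      have "\<bar>symmetrized_indicator m A y\<bar> \<le> (\<Sum>q | q permutes {..<m}. 1)"
        unfolding symmetrized_indicator_def by (rule order_trans[OF sum_abs], rule sum_mono) (simp add: indicator_def)
      then show ?thesis by (simp add: c_def)
    qed
    from EL[OF measurable_symmetrized_indicator[OF A] symmetric_fun_symmetrized_indicator this]
    have "enn2real (\<integral>\<^sup>+x. indicator A x * rP x \<partial>Cm) = enn2real (\<integral>\<^sup>+x. indicator A x * rU x \<partial>Cm)"
      using k0 c nnq nn_integral_P_real unfolding rU_def rP_def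
      by (simp add: integral_symmetrized_indicator[OF P_real_meas P_real_nonneg P_real_sym _ mN A] 
          integral_symmetrized_indicator[OF gibbs_weight_meas[OF gen] q0 gibbs_weight_sym[OF gen] _ mN A] flip: c_def)
    moreover have "(\<integral>\<^sup>+x. indicator A x * r x \<partial>Cm) < \<infinity>" if "(\<integral>\<^sup>+x. r x \<partial>Cm) = 1" for r
    proof -
      have "(\<integral>\<^sup>+x. indicator A x * r x \<partial>Cm) \<le> (\<integral>\<^sup>+x. r x \<partial>Cm)"
        by (intro nn_integral_mono) (auto simp: indicator_def)
      then show ?thesis using that by (auto intro: le_less_trans)
    qed
    \<comment> \<open>Both integrals are bounded by the total mass one, so \<open>enn2real\<close>
      loses no information.\<close>
    ultimately have "(\<integral>\<^sup>+x. indicator A x * rP x \<partial>Cm) = (\<integral>\<^sup>+x. indicator A x * rU x \<partial>Cm)"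
      using tot by (metis ennreal_enn2real infinity_ennreal_def)
    then show "emeasure (density Cm rP) A = emeasure (density Cm rU) A"
      by (simp add: emeasure_density mult.commute)
  qed simp
  then have "AE x in Cm. rP x = rU x"
    using tot by (subst (asm) finite_density_unique) auto
  then have "AE x in Cm. rho_U M N m W U x = reduction M N m P x"
    using rho_U_eq[OF gen iq] rho_P_eq
    by eventually_elim (simp add: rU_def rP_def Z rho_P_def divide_ennreal_def)
  moreover have "U \<in> V_P M N m W P" using adm V_P_iff[OF gen] by simp
  ultimately show ?thesis using gen by blast
qed

lemma reduced_potential_unique:
  assumes U: "U0 \<in> V_P M N m W P" "U1 \<in> V_P M N m W P"
    and gen: "generates M N m u0 U0" "generates M N m u1 U1"
    and rho: "AE x in Cm. rho_U M N m W U0 x = reduction M N m P x"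
      "AE x in Cm. rho_U M N m W U1 x = reduction M N m P x"
    and fin: "(\<integral>\<^sup>+x. ennreal \<bar>u0 x\<bar> * rho_P x \<partial>Cm) < \<infinity>" "(\<integral>\<^sup>+x. ennreal \<bar>u1 x\<bar> * rho_P x \<partial>Cm) < \<infinity>"
  shows "(\<exists>c::real. AE x in C. U1 x - U0 x = ereal c) \<and> (\<exists>c::real. AE x in Cm. u1 x - u0 x = c)"
proof -
  have i: "integrable C (gibbs_weight u0)" "integrable C (gibbs_weight u1)"
    using U gen by (simp_all add: V_P_iff admissible_def gibbs_weight_def[OF gen(1), abs_def] gibbs_weight_def[OF gen(2), abs_def])
  define Z0 Z1 where "Z0 = (\<integral>x. gibbs_weight u0 x \<partial>C)" and "Z1 = (\<integral>x. gibbs_weight u1 x \<partial>C)"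
  have Z: "Z0 > 0" "Z1 > 0"
    using partition_pos[OF gen(1) i(1)] partition_pos[OF gen(2) i(2)] by (simp_all add: Z0_def Z1_def)
  have q0: "gibbs_weight u0 x \<ge> 0" "gibbs_weight u1 x \<ge> 0" for x
    by (simp_all add: gibbs_weight_def[OF gen(1)] gibbs_weight_def[OF gen(2)])
  define k where "k = real (card {i \<in> {..<m} \<rightarrow>\<^sub>E {..<N}. strict_mono_on {..<m} i})"
  define F where "F v = enn2real (\<integral>\<^sup>+x. ennreal (v x) * rho_P x \<partial>Cm) - enn2real (\<integral>\<^sup>+x. ennreal (- v x) * rho_P x \<partial>Cm)" for v
  define b0 b1 where "b0 = body_sum N m u0" and "b1 = body_sum N m u1"
  \<comment> \<open>Both Gibbs weights have marginals proportional to \<open>rho_P\<close>, with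
    factors \<open>Z0\<close> and \<open>Z1\<close>. Hence the integral of a body sum against weight
    \<open>j\<close>, divided by \<open>Zj\<close>, is \<open>k * F v\<close> for both weights, and
    the difference against \<open>b1 - b0\<close> cancels.\<close>
  note w0 = integral_body_sum_weight[OF gibbs_weight_meas[OF gen(1)] q0(1) gibbs_weight_sym[OF gen(1)] rho_P_meas _
      marginal_gibbs_weight[OF gen(1) U(1) rho(1)] mN, folded Z0_def, folded F_def k_def]
  note w1 = integral_body_sum_weight[OF gibbs_weight_meas[OF gen(2)] q0(2) gibbs_weight_sym[OF gen(2)] rho_P_meas _
      marginal_gibbs_weight[OF gen(2) U(2) rho(2)] mN, folded Z1_def, folded F_def k_def]
  have ints: "integrable C (\<lambda>x. gibbs_weight u0 x * b0 x)" "integrable C (\<lambda>x. gibbs_weight u0 x * b1 x)"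
      "integrable C (\<lambda>x. gibbs_weight u1 x * b0 x)" "integrable C (\<lambda>x. gibbs_weight u1 x * b1 x)"
    and vals: "(\<integral>x. gibbs_weight u0 x * b0 x \<partial>C) = k * (Z0 * F u0)" "(\<integral>x. gibbs_weight u0 x * b1 x \<partial>C) = k * (Z0 * F u1)"
      "(\<integral>x. gibbs_weight u1 x * b0 x \<partial>C) = k * (Z1 * F u0)" "(\<integral>x. gibbs_weight u1 x * b1 x \<partial>C) = k * (Z1 * F u1)"
    using w0[of u0] w0[of u1] w1[of u0] w1[of u1] fin Z gen_meas(1)[OF gen(1)] gen_meas(1)[OF gen(2)]
    by (simp_all add: b0_def b1_def)
  have ex: "(gibbs_weight u0 x / Z0 - gibbs_weight u1 x / Z1) * (b1 x - b0 x) =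
      gibbs_weight u0 x * b1 x / Z0 - gibbs_weight u0 x * b0 x / Z0 - (gibbs_weight u1 x * b1 x / Z1 - gibbs_weight u1 x * b0 x / Z1)" for x
    by (simp add: left_diff_distrib right_diff_distrib)
  have int: "integrable C (\<lambda>x. (gibbs_weight u0 x / Z0 - gibbs_weight u1 x / Z1) * (b1 x - b0 x))"
    unfolding ex using ints by auto
  have zero: "(\<integral>x. (gibbs_weight u0 x / Z0 - gibbs_weight u1 x / Z1) * (b1 x - b0 x) \<partial>C) = 0"
    unfolding ex using ints vals Z by simp
  define c where "c = ln Z0 - ln Z1"
  have cst: "AE x in C. b1 x - b0 x = c"
    unfolding c_def
    by (rule gibbs_unique[of C w b0 b1])
       (use i int zero Z in \<open>simp_all add: gibbs_weight_def[OF gen(1), abs_def] gibbs_weight_def[OF gen(2), abs_def] b0_def b1_def Z0_def Z1_def\<close>)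
  have "AE x in C. U1 x - U0 x = ereal c"
    using cst gen_eq[OF gen(1)] gen_eq[OF gen(2)] by eventually_elim (simp add: b0_def b1_def)
  \<comment> \<open>By linearity \<open>b1 - b0\<close> is the body sum of the difference of the
    potentials, so its a.e. constancy passes to that difference by
    \<open>potential_AE_const\<close>.\<close>
  moreover have "AE x in C. body_sum N m (\<lambda>x. 1 * u1 x + (-1) * u0 x) x = c"
    using cst unfolding body_sum_lincomb b0_def b1_def by eventually_elim simp
  then have "\<exists>c. AE x in PiM {..<m} (\<lambda>_. M). 1 * u1 x + (-1) * u0 x = c"
    unfolding pow_measure_def AE_completion_iff by (rule potential_AE_const[OF _ mN nonnull])
  then have "\<exists>c. AE x in Cm. u1 x - u0 x = c"
    unfolding pow_measure_def AE_completion_iff by simp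
  ultimately show ?thesis by blast
qed

end

theorem theorem3p10:
  fixes M :: "'a measure"
    and N m :: nat
    and P W :: "(nat \<Rightarrow> 'a) \<Rightarrow> ereal"
    and B :: "'a set"
  assumes "sigma_finite_measure M" and "complete_measure M" and "emeasure M (space M) \<noteq> 0"
    and "2 \<le> N" and "1 \<le> m" and "m \<le> N - 1"
    and "prob_density M N P"
    and "AE x in pow_measure M {..<N}. P x > 0"
    and "ae_symmetric M N P"
    and "B \<in> sets M" and "emeasure M B > 0"
    and "AE t in M. t \<in> B \<longrightarrow>
           (\<exists>\<gamma>::real. \<gamma> > 0 \<and>
              (AE y in pow_measure M {..<N - 1}.
                 P (y(N - 1 := t)) \<ge> ereal \<gamma> * enn2ereal (reduction M N (N - 1) P y)))"
    and "W \<in> borel_measurable (pow_measure M {..<N})"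
    and "AE x in pow_measure M {..<N}. \<bar>W x\<bar> \<noteq> \<infinity>"
    and "ae_symmetric M N W"
  shows "V_P M N m W P = V_rho M N m W (reduction M N m P) \<and>
    (V_P M N m W P \<noteq> {} \<and>
       (\<lambda>x. max (W x + ln_ereal (P x)) 0)
         \<in> L1 (density (pow_measure M {..<N}) (\<lambda>x. e2ennreal (P x))) \<longrightarrow>
       (\<exists>U\<in>V_P M N m W P. \<exists>u. generates M N m u U \<and>
          (AE x in pow_measure M {..<m}. rho_U M N m W U x = reduction M N m P x))) \<and>
    (\<forall>U\<^sub>0\<in>V_P M N m W P. \<forall>U\<^sub>1\<in>V_P M N m W P. \<forall>u\<^sub>0 u\<^sub>1.
       generates M N m u\<^sub>0 U\<^sub>0 \<longrightarrow> generates M N m u\<^sub>1 U\<^sub>1 \<longrightarrow>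
       (AE x in pow_measure M {..<m}. rho_U M N m W U\<^sub>0 x = reduction M N m P x) \<longrightarrow>
       (AE x in pow_measure M {..<m}. rho_U M N m W U\<^sub>1 x = reduction M N m P x) \<longrightarrow>
       (\<exists>c::real. AE x in pow_measure M {..<N}. U\<^sub>1 x - U\<^sub>0 x = ereal c) \<and>
       (\<exists>c::real. AE x in pow_measure M {..<m}. u\<^sub>1 x - u\<^sub>0 x = c))"
proof -
  interpret sigma_finite_measure M by fact
  interpret reduced_density M N m P W
    by unfold_locales (use assms in auto)
  obtain n where n: "N = Suc n" using assms(4) by (cases N) auto
  have L1: "(\<integral>\<^sup>+x. ennreal \<bar>v x\<bar> * rho_P x \<partial>pow_measure M {..<m}) < \<infinity>"
    if "generates M N m v V" "V \<in> V_P M N m W P" for v V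
    by (rule v_L1_rho[OF that n assms(10,11)]) (use assms(12)[unfolded n diff_Suc_1] in \<open>unfold n\<close>)
  \<comment> \<open>One inclusion is the recovery of an integrable potential by freezing variables
    in \<open>B\<close>. In the other, each term of the body sum is integrated against the reduction
    by symmetry of the density.\<close>
  have "V_P M N m W P = V_rho M N m W (reduction M N m P)"
  proof (intro equalityI subsetI)
    fix V assume V: "V \<in> V_P M N m W P"
    then obtain v where v: "generates M N m v V" by (auto simp: V_P_def)
    with V L1[OF v V] show "V \<in> V_rho M N m W (reduction M N m P)"
      by (auto simp: V_rho_def V_P_def L1_rho_iff[OF v])
  next
    fix V assume "V \<in> V_rho M N m W (reduction M N m P)"
    then obtain v where v: "exp_integrable M N W V" "generates M N m v V"
      "(\<lambda>x. ereal (v x)) \<in> L1 (density (pow_measure M {..<m}) (reduction M N m P))"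
      by (auto simp: V_rho_def)
    then show "V \<in> V_P M N m W P"
      unfolding V_P_def using integrable_of_rho[OF v(2)] L1_P_iff[OF v(2)] L1_rho_iff[OF v(2)] by auto
  qed
  then show ?thesis
    using exists_reduced_potential reduced_potential_unique L1 by blast
qed

end
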